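(* Let $u$ be a blow-up (non-global) solution of $\partial_t^2u=\partial_x^2u+e^u$ with initial data $(u_0,u_1)\in H^1_{loc,u}(\mathbb R)\times L^2_{loc,u}(\mathbb R)$, with maximal domain of definition $D=\{(x,t): 0\le t<T(x)\}$ and blow-up graph $\Gamma=\{(x,T(x)):x\in\mathbb R\}$. Then: (i) (Upper bound) For all $R>0$ and $a\in\mathbb R$ such that $(a,T(a))\in D_R$, $$\forall |y|<1,\ \forall s\ge-\log T(a),\quad w_a(y,s)\le -2\log(1-|y|)+C(R),$$ $$\forall t\in[0,T(a)),\quad e^{u(a,t)}\le \frac{C(R)}{d((a,t),\Gamma)^2}\le\frac{C(R)}{(T(a)-t)^2}.$$ (ii) (Lower bound) For all $R>0$ and $a\in\mathbb R$ such that $(a,T(a))\in D_R$, for all $t\in[0,T(a))$, $$\frac1{T(a)-t}\int_{I(a,t)}e^{-u(x,t)}\,dx\le C(R)\sqrt{d((a,t),\Gamma)}\le C(R)\sqrt{T(a)-t}.$$ If in addition $(u_0,u_1)\in W^{1,\infty}(\mathbb R)\times L^\infty(\mathbb R)$, then $$\forall t\in[0,T(a)),\quad e^{u(a,t)}\ge\frac{C(R)}{d((a,t),\Gamma)}\ge\frac{C(R)}{T(a)-t}.$$ (iii) (Lower bound on the local energy "norm") There exists $\epsilon_0>0$ such that for all $a\in\mathbb R$ and $t\in[0,T(a))$, $$\frac1{T(a)-t}\int_{I(a,t)}\left((\partial_tu(x,t))^2+(\partial_xu(x,t))^2+e^{u(x,t)}\right)dx\ge\frac{\epsilon_0}{(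T(a)-t)^2}.$$
   Context: $L^2_{loc,u}(\mathbb R)$ is the space of $v$ with $\sup_{a\in\mathbb R}\int_{a-1}^{a+1}v^2\,dx<\infty$, and $H^1_{loc,u}(\mathbb R)=\{v: v,v'\in L^2_{loc,u}(\mathbb R)\}$. For $x\in\mathbb R$, $t>0$, $\delta>0$, let $\mathcal C_{x,t,\delta}=\{(\xi,\tau)\ne(x,t): 0\le\tau\le t-\delta|\xi-x|\}$. A solution on $\mathcal C_{x_0,t_0,1}$ is a function $u$ with $(u,\partial_tu)\in C([0,t_0),H^1\times L^2(|x-x_0|<t_0-t))$ satisfying Duhamel's formula $u(x,t)=\frac12(u_0(x-t)+u_0(x+t))+\frac12\int_{x-t}^{x+t}u_1+\frac12\int_0^t\int_{x-t+\tau}^{x+t-\tau}e^{u(z,\tau)}dz\,d\tau$. The maximal domain of definition $D$ is the set of $(x,t)$, $t\ge0$, such that the solution exists on $\mathcal C_{x,t',1}$ for some $t'>t$. The solution is a blow-up solution if it is not global, i.e. $D\ne\mathbb R\times[0,\infty)$; then $D=\{(x,t):0\le t<T(x)\}$ for a 1-Lipschitz function $T:\mathbb R\to(0,\infty)$, and $\Gamma$ is the graph of $T$. $d((x,t),\Gamma)$ is the Euclidean distance from $(x,t)$ to $\Gamma$; $D_R=\{(x,t)\in\mathbb R\times\mathbb R_+: |x|<R-t\}$; $I(a,t)=(a-(T(a)-t),a+(T(a)-t))$. Similarity variables: $w_a(y,s)=u(x,t)+2\log(T(a)-t)$, with $y=\frac{x-a}{T(a)-t}$, $s=-\log(T(a)-t)$.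 $C(R)$ denotes positive constants, possibly different at each occurrence, depending only on $R$ and on the initial data $(u_0,u_1)$ (not on $a,t,y,s$). *)

theory Defs
  imports "HOL-Analysis.Analysis"
begin

section \<open>Function spaces on the line\<close>

definition L2_on :: "real set \<Rightarrow> (real \<Rightarrow> real) set" where
  "L2_on S = {f. set_borel_measurable lebesgue S f \<and> set_integrable lebesgue S (\<lambda>x. (f x)\<^sup>2)}"

definition L2_norm_on :: "real set \<Rightarrow> (real \<Rightarrow> real) \<Rightarrow> real" where
  "L2_norm_on S f = sqrt (LINT x:S|lebesgue. (f x)\<^sup>2)"

definition test_function :: "real set \<Rightarrow> (real \<Rightarrow> real) \<Rightarrow> bool" where
  "test_function S \<phi> \<longleftrightarrow>
     (\<forall>n x. (deriv ^^ n) \<phi> differentiable (at x)) \<and>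
     (\<exists>K. compact K \<and> K \<subseteq> S \<and> (\<forall>x. x \<notin> K \<longrightarrow> \<phi> x = 0))"

definition has_weak_deriv_on :: "(real \<Rightarrow> real) \<Rightarrow> (real \<Rightarrow> real) \<Rightarrow> real set \<Rightarrow> bool" where
  "has_weak_deriv_on v g S \<longleftrightarrow>
     (\<forall>K. compact K \<and> K \<subseteq> S \<longrightarrow> set_integrable lebesgue K v \<and> set_integrable lebesgue K g) \<and>
     (\<forall>\<phi>. test_function S \<phi> \<longrightarrow>
        (LINT x:S|lebesgue. v x * deriv \<phi> x) = - (LINT x:S|lebesgue. g x * \<phi> x))"

definition L2_locu :: "(real \<Rightarrow> real) set" where
  "L2_locu = {v. v \<in> borel_measurable lebesgue \<and>
     (SUP a. \<integral>\<^sup>+x\<in>{a-1..a+1}. ennreal ((v x)\<^sup>2) \<partial>lebesgue) < \<infinity>}"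

text \<open>Functions are honest functions here, not classes modulo null sets. An element of a
  first-order Sobolev space is always taken to be its continuous representative; this matters
  because initial data and solutions are evaluated pointwise.\<close>

definition H1_locu :: "(real \<Rightarrow> real) set" where
  "H1_locu = {v \<in> L2_locu. continuous_on UNIV v \<and> (\<exists>g \<in> L2_locu. has_weak_deriv_on v g UNIV)}"

definition L_inf :: "(real \<Rightarrow> real) set" where
  "L_inf = {v. v \<in> borel_measurable lebesgue \<and> (\<exists>M. AE x in lebesgue. \<bar>v x\<bar> \<le> M)}"

definition W1_inf :: "(real \<Rightarrow> real) set" where
  "W1_inf = {v \<in> L_inf. continuous_on UNIV v \<and> (\<exists>g \<in> L_inf. has_weak_deriv_on v g UNIV)}"

section \<open>Solutions of the wave equation with exponential nonlinearity\<close>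

definition backward_cone :: "real \<Rightarrow> real \<Rightarrow> real \<Rightarrow> (real \<times> real) set" where
  "backward_cone x t \<delta> = {(\<xi>, \<tau>). (\<xi>, \<tau>) \<noteq> (x, t) \<and> 0 \<le> \<tau> \<and> \<tau> \<le> t - \<delta> * \<bar>\<xi> - x\<bar>}"

text \<open>\<open>u\<close> is a solution on the backward cone of slope one with apex \<open>(x0, t0)\<close>, and \<open>ux\<close>, \<open>ut\<close>
  are representatives of its space and time derivatives: \<open>ux\<close> is the weak derivative on each
  time slice and \<open>ut\<close> is the time derivative of \<open>u\<close> as a map into the space of square-integrable
  functions (one-sided at time zero). As the spatial domain \<open>ball x0 (t0 - t)\<close> shrinks with
  time, two time slices \<open>t\<close> and \<open>\<tau>\<close> are compared on the smaller ball.\<close>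

definition solution_on_cone ::
  "(real \<Rightarrow> real) \<Rightarrow> (real \<Rightarrow> real) \<Rightarrow> (real \<Rightarrow> real \<Rightarrow> real) \<Rightarrow> (real \<Rightarrow> real \<Rightarrow> real) \<Rightarrow>
   (real \<Rightarrow> real \<Rightarrow> real) \<Rightarrow> real \<Rightarrow> real \<Rightarrow> bool" where
  "solution_on_cone u0 u1 u ux ut x0 t0 \<longleftrightarrow>
     (\<forall>t\<in>{0..<t0}.
        continuous_on (ball x0 (t0 - t)) (\<lambda>x. u x t) \<and>
        (\<lambda>x. u x t) \<in> L2_on (ball x0 (t0 - t)) \<and>
        (\<lambda>x. ux x t) \<in> L2_on (ball x0 (t0 - t)) \<and>
        (\<lambda>x. ut x t) \<in> L2_on (ball x0 (t0 - t)) \<and>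
        has_weak_deriv_on (\<lambda>x. u x t) (\<lambda>x. ux x t) (ball x0 (t0 - t)) \<and>
        ((\<lambda>\<tau>. L2_norm_on (ball x0 (t0 - max t \<tau>)) (\<lambda>x. (u x \<tau> - u x t) / (\<tau> - t) - ut x t))
           \<longlongrightarrow> 0) (at t within {0..<t0})) \<and>
     (\<forall>t\<in>{0..<t0}. \<forall>f\<in>{u, ux, ut}.
        ((\<lambda>\<tau>. L2_norm_on (ball x0 (t0 - max t \<tau>)) (\<lambda>x. f x \<tau> - f x t))
           \<longlongrightarrow> 0) (at t within {0..<t0})) \<and>
     (\<forall>(x, t)\<in>backward_cone x0 t0 1.
        u x t = (u0 (x - t) + u0 (x + t)) / 2
          + (LINT z:{x - t..x + t}|lebesgue. u1 z) / 2
          + (LINT \<tau>:{0..t}|lebesgue.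
               (LINT z:{x - t + \<tau>..x + t - \<tau>}|lebesgue. exp (u z \<tau>))) / 2)"

definition max_domain :: "(real \<Rightarrow> real) \<Rightarrow> (real \<Rightarrow> real) \<Rightarrow> (real \<times> real) set" where
  "max_domain u0 u1 =
     {(x, t). 0 \<le> t \<and> (\<exists>t'>t. \<exists>v vx vt. solution_on_cone u0 u1 v vx vt x t')}"

definition maximal_solution ::
  "(real \<Rightarrow> real) \<Rightarrow> (real \<Rightarrow> real) \<Rightarrow> (real \<Rightarrow> real \<Rightarrow> real) \<Rightarrow> (real \<Rightarrow> real \<Rightarrow> real) \<Rightarrow>
   (real \<Rightarrow> real \<Rightarrow> real) \<Rightarrow> bool" where
  "maximal_solution u0 u1 u ux ut \<longleftrightarrow>
     (\<forall>(x, t)\<in>max_domain u0 u1. t > 0 \<longrightarrow> solution_on_cone u0 u1 u ux ut x t)"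

definition blowup_solution ::
  "(real \<Rightarrow> real) \<Rightarrow> (real \<Rightarrow> real) \<Rightarrow> (real \<Rightarrow> real \<Rightarrow> real) \<Rightarrow> (real \<Rightarrow> real \<Rightarrow> real) \<Rightarrow>
   (real \<Rightarrow> real \<Rightarrow> real) \<Rightarrow> bool" where
  "blowup_solution u0 u1 u ux ut \<longleftrightarrow>
     maximal_solution u0 u1 u ux ut \<and> max_domain u0 u1 \<noteq> UNIV \<times> {0..}"

text \<open>For a blow-up solution this is the function \<open>T\<close> with
  \<open>max_domain u0 u1 = {(x, t). 0 \<le> t \<and> t < T x}\<close>.\<close>

definition blowup_time :: "(real \<Rightarrow> real) \<Rightarrow> (real \<Rightarrow> real) \<Rightarrow> real \<Rightarrow> real" where
  "blowup_time u0 u1 x = Sup {t. (x, t) \<in> max_domain u0 u1}"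

definition blowup_graph :: "(real \<Rightarrow> real) \<Rightarrow> (real \<times> real) set" where
  "blowup_graph T = range (\<lambda>x. (x, T x))"

definition D_R :: "real \<Rightarrow> (real \<times> real) set" where
  "D_R R = {(x, t). 0 \<le> t \<and> \<bar>x\<bar> < R - t}"

definition cone_section :: "(real \<Rightarrow> real) \<Rightarrow> real \<Rightarrow> real \<Rightarrow> real set" where
  "cone_section T a t = {a - (T a - t)<..<a + (T a - t)}"

text \<open>The similarity variables \<open>y = (x - a) / (T a - t)\<close>, \<open>s = - ln (T a - t)\<close>, solved for
  \<open>x\<close> and \<open>t\<close>.\<close>

definition sim_w ::
  "(real \<Rightarrow> real) \<Rightarrow> (real \<Rightarrow> real \<Rightarrow> real) \<Rightarrow> real \<Rightarrow> real \<Rightarrow> real \<Rightarrow> real" where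
  "sim_w T u a y s =
     (let t = T a - exp (- s); x = a + y * (T a - t) in u x t + 2 * ln (T a - t))"

end

theory Submission
  imports Defs
begin

text \<open>
The linear part of the solution is a sum of two travelling waves and is bounded on bounded sets,
so the blow-up is governed by the nonlinear part \<open>F\<close>, which is half the integral of \<open>exp u\<close> over
the backward cone. Let \<open>A\<close> and \<open>B\<close> be the integrals of \<open>exp u\<close> along the two edges of that cone.
They are the derivatives of \<open>F\<close> in the two characteristic directions, and differentiating \<open>A\<close> in
the direction that belongs to \<open>B\<close>, or \<open>B\<close> in the direction that belongs to \<open>A\<close>, gives \<open>exp u\<close>.
In particular \<open>F\<close> does not decrease along any future-pointing path that is at most as fast as light.

\<^emph>\<open>Blow-up criterion\<close> (\<open>nl_unbounded\<close>). \<open>F\<close> tends to infinity at the apex \<open>(a, T a)\<close> of a maximal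
cone. If it stayed bounded, then so would \<open>u\<close> on the whole open cone. Cut off the exponential a
little above this bound. The resulting equation has a continuous global solution, obtained as the
limit of an increasing iteration that starts at the linear part; the iterates stay below \<open>u\<close> on the
cone. By continuity the limit stays below the cut-off on a slightly taller cone. There it solves the
original equation, so the cone was not maximal.

\<^emph>\<open>Upper rate\<close> (\<open>upper_rate\<close>). Integrating \<open>exp u\<close> over the diamond of height \<open>r\<close> above a point
shows that \<open>F\<close> grows during the time \<open>r\<close> by at least a multiple of \<open>r\<^sup>2 * exp F\<close>. If this product
is large, then it is still larger at the top of the diamond with \<open>r / 2\<close> in place of \<open>r\<close>, and the
argument repeats; \<open>F\<close> would become infinite after the time \<open>2 * r\<close>. Hence \<open>exp F\<close> is at most a
multiple of \<open>(T x - t) powr (-2)\<close>.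

\<^emph>\<open>Lower rate\<close> (\<open>lower_rate\<close>). In the direction of \<open>B\<close> the derivative of \<open>A * exp (- F)\<close> is
\<open>exp (- F) * (exp u - A * B)\<close>, which is at most the exponential of the linear part. Since \<open>A\<close> vanishes
initially, \<open>A * exp (- F)\<close> and likewise \<open>B * exp (- F)\<close> are bounded, that is, \<open>exp (- F)\<close> is Lipschitz
in time. It tends to zero at the blow-up time, so it is at most a multiple of \<open>T x - t\<close>. Both the
mean bound and the pointwise bound follow.

\<^emph>\<open>Energy\<close> (\<open>energy_lower_bound\<close>). If the energy on a section of the cone is below a small multiple of
its critical size, then the one-dimensional Sobolev inequality bounds \<open>u\<close> on the section from
above by the logarithm of a small multiple of \<open>(T a - t) powr (-2)\<close>. Restarting Duhamel's formula from this section, the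
source is too weak to raise \<open>u\<close> by more than one within the remaining time. So \<open>F\<close> would stay bounded
on the axis of the cone, against the blow-up criterion.

The link with the definition of a solution is made by three facts: weak derivatives integrate to
increments and conversely, translations are continuous in mean square, and a solution is jointly
continuous by the Sobolev inequality. The distance to the graph is comparable to \<open>T a - t\<close> because
\<open>T\<close> is Lipschitz with constant one.
\<close>

section \<open>The wave generated by a continuous source\<close>

definition duhamel :: "(real \<Rightarrow> real \<Rightarrow> real) \<Rightarrow> real \<Rightarrow> real \<Rightarrow> real" where
  "duhamel f x t = integral {0..t} (\<lambda>\<tau>. integral {x - t + \<tau>..x + t - \<tau>} (\<lambda>z. f z \<tau>)) / 2"

text \<open>The two edges of the backward cone with apex \<open>(x, t)\<close> carry these integrals: the left edge starts
at \<open>x - t\<close>, the right one at \<open>x + t\<close>. For negative times the interval of integration is empty.\<close>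

definition left_ray :: "(real \<Rightarrow> real \<Rightarrow> real) \<Rightarrow> real \<Rightarrow> real \<Rightarrow> real" where
  "left_ray f x t = integral {0..t} (\<lambda>\<tau>. f (x - t + \<tau>) \<tau>)"

definition right_ray :: "(real \<Rightarrow> real \<Rightarrow> real) \<Rightarrow> real \<Rightarrow> real \<Rightarrow> real" where
  "right_ray f x t = integral {0..t} (\<lambda>\<tau>. f (x + t - \<tau>) \<tau>)"

lemma integral_rescale_unit:
  fixes h :: "real \<Rightarrow> real"
  assumes "continuous_on UNIV h" "0 \<le> a"
  shows "integral {0..a} h = a * integral {0..1} (\<lambda>\<sigma>. h (a * \<sigma>))"
proof (cases "a = 0")
  case False
  with assms have a: "a > 0" by simp
  have "h integrable_on {0..a}"
    by (intro integrable_continuous_real continuous_on_subset[OF assms(1)]) auto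
  then have "(h has_integral integral {0..a} h) (cbox 0 a)"
    by (simp add: integrable_integral)
  from has_integral_affinity[OF this, of a 0] a
  have "((\<lambda>\<sigma>. h (a * \<sigma>)) has_integral (integral {0..a} h / a)) {0..1}"
    by simp
  then have "integral {0..1} (\<lambda>\<sigma>. h (a * \<sigma>)) = integral {0..a} h / a"
    by (rule integral_unique)
  with a show ?thesis by simp
qed simp

lemma continuous_on_slice:
  fixes f :: "real \<Rightarrow> real \<Rightarrow> real"
  assumes "continuous_on UNIV (\<lambda>p. f (fst p) (snd p))"
    and "continuous_on S g" "continuous_on S h"
  shows "continuous_on S (\<lambda>x. f (g x) (h x))"
  using continuous_on_compose2[OF assms(1) continuous_on_Pair[OF assms(2,3)]] by simp

text \<open>Rescaling the integral from \<open>0\<close> to \<open>z\<close> to the unit interval gives a formula with fixed limits and the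
right sign on both sides of the origin, so joint continuity is immediate. The antiderivative turns the
inner integral of the Duhamel term into a difference of values at the endpoints.\<close>

lemma spatial_antiderivative:
  fixes f :: "real \<Rightarrow> real \<Rightarrow> real"
  assumes f: "continuous_on UNIV (\<lambda>p. f (fst p) (snd p))"
  obtains G :: "real \<Rightarrow> real \<Rightarrow> real"
  where "\<And>z \<tau>. ((\<lambda>z. G z \<tau>) has_real_derivative f z \<tau>) (at z)"
    and "continuous_on UNIV (\<lambda>p. G (fst p) (snd p))"
proof
  define G where "G z \<tau> = z * integral {0..1} (\<lambda>\<sigma>. f (z * \<sigma>) \<tau>)" for z \<tau>
  note cs = continuous_on_slice[OF f]
  have pos: "G z \<tau> = integral {0..z} (\<lambda>\<zeta>. f \<zeta> \<tau>)" if "z \<ge> 0" for z \<tau>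
    unfolding G_def using that
    by (intro integral_rescale_unit[symmetric]) (auto intro!: cs continuous_intros)
  have neg: "G z \<tau> = - integral {z..0} (\<lambda>\<zeta>. f \<zeta> \<tau>)" if "z \<le> 0" for z \<tau>
  proof -
    have "integral {0..-z} (\<lambda>\<zeta>. f (-\<zeta>) \<tau>) = (-z) * integral {0..1} (\<lambda>\<sigma>. f (-((-z) * \<sigma>)) \<tau>)"
      using that by (intro integral_rescale_unit) (auto intro!: cs continuous_intros)
    moreover have "integral {0..-z} (\<lambda>\<zeta>. f (-\<zeta>) \<tau>) = integral {z..0} (\<lambda>\<zeta>. f \<zeta> \<tau>)"
      using Henstock_Kurzweil_Integration.integral_reflect_real[of 0 z "\<lambda>\<zeta>. f \<zeta> \<tau>"] unfolding minus_zero .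
    moreover have "G z \<tau> = - ((-z) * integral {0..1} (\<lambda>\<sigma>. f (-((-z) * \<sigma>)) \<tau>))"
      unfolding G_def by simp
    ultimately show ?thesis by linarith
  qed
  show "((\<lambda>z. G z \<tau>) has_real_derivative f z \<tau>) (at z)" for z \<tau>
  proof -
    define m where "m = \<bar>z\<bar> + 1"
    have int: "(\<lambda>\<zeta>. f \<zeta> \<tau>) integrable_on {x..y}" for x y
      by (intro integrable_continuous_real cs continuous_intros)
    have eq: "G y \<tau> = integral {-m..y} (\<lambda>\<zeta>. f \<zeta> \<tau>) - integral {-m..0} (\<lambda>\<zeta>. f \<zeta> \<tau>)"
      if "y \<in> {-m<..<m}" for y
    proof (cases "y \<ge> 0")
      case True
      have "integral {-m..0} (\<lambda>\<zeta>. f \<zeta> \<tau>) + integral {0..y} (\<lambda>\<zeta>. f \<zeta> \<tau>) = integral {-m..y} (\<lambda>\<zeta>. f \<zeta> \<tau>)"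
        by (rule Henstock_Kurzweil_Integration.integral_combine) (use True in \<open>simp_all add: m_def int\<close>)
      with pos[OF True, of \<tau>] show ?thesis by linarith
    next
      case False
      have "integral {-m..y} (\<lambda>\<zeta>. f \<zeta> \<tau>) + integral {y..0} (\<lambda>\<zeta>. f \<zeta> \<tau>) = integral {-m..0} (\<lambda>\<zeta>. f \<zeta> \<tau>)"
        by (rule Henstock_Kurzweil_Integration.integral_combine) (use False that in \<open>simp_all add: int\<close>)
      with neg[of y \<tau>] False show ?thesis by linarith
    qed
    have zz: "z \<in> {-m<..<m}" by (auto simp: m_def)
    have "((\<lambda>y. integral {-m..y} (\<lambda>\<zeta>. f \<zeta> \<tau>)) has_real_derivative f z \<tau>) (at z within {-m..m})"
      using zz by (intro integral_has_real_derivative cs continuous_intros) auto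
    then have "((\<lambda>y. integral {-m..y} (\<lambda>\<zeta>. f \<zeta> \<tau>)) has_real_derivative f z \<tau>) (at z)"
      using at_within_Icc_at[of "-m" z m] zz by (simp only: greaterThanLessThan_iff)
    then have "((\<lambda>y. integral {-m..y} (\<lambda>\<zeta>. f \<zeta> \<tau>) - integral {-m..0} (\<lambda>\<zeta>. f \<zeta> \<tau>)) has_real_derivative f z \<tau>) (at z)"
      by (auto intro!: derivative_eq_intros)
    then show ?thesis
      by (rule has_field_derivative_transform_within_open[of _ _ _ "{-m<..<m}"]) (use zz eq in simp_all)
  qed
  have "continuous_on UNIV (\<lambda>p. integral (cbox 0 1) (\<lambda>\<sigma>. f (fst p * \<sigma>) (snd p)))"
    by (intro integral_continuous_on_param)
       (auto simp: case_prod_beta' intro!: cs continuous_intros)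
  then show "continuous_on UNIV (\<lambda>p. G (fst p) (snd p))"
    unfolding G_def by (auto intro!: continuous_intros)
qed

lemma right_ray_continuous_aux:
  fixes f :: "real \<Rightarrow> real \<Rightarrow> real"
  assumes f: "continuous_on UNIV (\<lambda>p. f (fst p) (snd p))"
  shows "continuous_on ({0..} \<times> UNIV) (\<lambda>p. integral {0..fst p} (\<lambda>\<tau>. f (snd p - \<tau>) \<tau>))"
proof -
  note cs = continuous_on_slice[OF f]
  have "continuous_on UNIV (\<lambda>p. integral (cbox 0 1) (\<lambda>\<sigma>. f (snd p - fst p * \<sigma>) (fst p * \<sigma>)))"
    by (intro integral_continuous_on_param)
       (auto simp: case_prod_beta' intro!: cs continuous_intros)
  then have "continuous_on ({0..} \<times> UNIV) (\<lambda>p. fst p * integral {0..1} (\<lambda>\<sigma>. f (snd p - fst p * \<sigma>) (fst p * \<sigma>)))"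
    by (auto intro!: continuous_intros intro: continuous_on_subset)
  moreover have "integral {0..fst p} (\<lambda>\<tau>. f (snd p - \<tau>) \<tau>) =
      fst p * integral {0..1} (\<lambda>\<sigma>. f (snd p - fst p * \<sigma>) (fst p * \<sigma>))"
    if "p \<in> {0..} \<times> UNIV" for p :: "real \<times> real"
    using that by (intro integral_rescale_unit) (auto intro!: cs continuous_intros)
  ultimately show ?thesis by (simp cong: continuous_on_cong)
qed

text \<open>The upper limit and the shift of the integrand are separate variables here. Each partial derivative
is elementary and both are continuous, which gives the total derivative.\<close>

lemma ray_primitive_derivative:
  fixes f G :: "real \<Rightarrow> real \<Rightarrow> real"
  assumes f: "continuous_on UNIV (\<lambda>p. f (fst p) (snd p))"
    and G: "continuous_on UNIV (\<lambda>p. G (fst p) (snd p))"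
    and dG: "\<And>z \<tau>. ((\<lambda>z. G z \<tau>) has_real_derivative f z \<tau>) (at z)"
    and a: "a \<ge> 0"
  shows "((\<lambda>(a, v). integral {0..a} (\<lambda>\<tau>. G (v - \<tau>) \<tau>)) has_derivative
     (\<lambda>(da, dv). G (v - a) a * da + integral {0..a} (\<lambda>\<tau>. f (v - \<tau>) \<tau>) * dv))
     (at (a, v) within {0..} \<times> UNIV)"
proof -
  note csf = continuous_on_slice[OF f] and csG = continuous_on_slice[OF G]
  let ?K = "\<lambda>a v. integral {0..a} (\<lambda>\<tau>. f (v - \<tau>) \<tau>)"
  have 1: "((\<lambda>a. integral {0..a} (\<lambda>\<tau>. G (v - \<tau>) \<tau>)) has_derivative (\<lambda>da. G (v - a) a * da)) (at a within {0..})"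
  proof -
    have "((\<lambda>a. integral {0..a} (\<lambda>\<tau>. G (v - \<tau>) \<tau>)) has_real_derivative G (v - a) a) (at a within {0..a+1})"
      using a by (intro integral_has_real_derivative csG continuous_intros) auto
    moreover have "at a within {0..a+1} = at a within {0..}"
      by (rule at_within_nhd[of _ "{a-1<..<a+1}"]) auto
    ultimately show ?thesis by (simp add: has_field_derivative_def)
  qed
  have 2: "((\<lambda>v. integral {0..a} (\<lambda>\<tau>. G (v - \<tau>) \<tau>)) has_derivative blinfun_apply (blinfun_mult_right (?K a v))) (at v within UNIV)" for a v
  proof -
    have "((\<lambda>v. integral (cbox 0 a) (\<lambda>\<tau>. G (v - \<tau>) \<tau>)) has_real_derivative integral (cbox 0 a) (\<lambda>\<tau>. f (v - \<tau>) \<tau>)) (at v within UNIV)"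
    proof (rule leibniz_rule_field_derivative)
      show "((\<lambda>x. G (x - t) t) has_real_derivative f (x - t) t) (at x within UNIV)" for x t
      proof -
        have "((\<lambda>x. G (x - t) t) has_real_derivative f (x - t) t * 1) (at x)"
          by (rule DERIV_chain2[of "\<lambda>z. G z t", OF dG]) (auto intro!: derivative_eq_intros)
        then show ?thesis by simp
      qed
    qed (auto simp: case_prod_beta' intro!: integrable_continuous_real csf csG continuous_intros)
    then show ?thesis by (simp add: has_field_derivative_def)
  qed
  have 3: "continuous (at (a, v) within {0..} \<times> UNIV) (\<lambda>(a, v). blinfun_mult_right (?K a v))"
  proof -
    have "continuous_on ({0..} \<times> UNIV) (\<lambda>p. blinfun_mult_right (?K (fst p) (snd p)))"
      by (intro bounded_linear.continuous_on[OF bounded_linear_blinfun_mult_right] right_ray_continuous_aux f)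
    then show ?thesis using a by (auto simp: continuous_on_eq_continuous_within case_prod_beta')
  qed
  from has_derivative_partialsI[OF 1 2 3] show ?thesis by (simp)
qed

lemma duhamel_eq_antiderivative:
  fixes f G :: "real \<Rightarrow> real \<Rightarrow> real"
  assumes dG: "\<And>z \<tau>. ((\<lambda>z. G z \<tau>) has_real_derivative f z \<tau>) (at z)"
    and G: "continuous_on UNIV (\<lambda>p. G (fst p) (snd p))"
    and t: "t \<ge> 0"
  shows "duhamel f x t = (integral {0..t} (\<lambda>\<tau>. G (x + t - \<tau>) \<tau>) - integral {0..t} (\<lambda>\<tau>. G (x - t + \<tau>) \<tau>)) / 2"
proof -
  note csG = continuous_on_slice[OF G]
  have "integral {x - t + \<tau>..x + t - \<tau>} (\<lambda>z. f z \<tau>) = G (x + t - \<tau>) \<tau> - G (x - t + \<tau>) \<tau>"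
    if "\<tau> \<in> {0..t}" for \<tau>
    using that dG
    by (intro integral_unique fundamental_theorem_of_calculus)
       (auto intro: has_field_derivative_at_within simp flip: has_real_derivative_iff_has_vector_derivative)
  then have "duhamel f x t = integral {0..t} (\<lambda>\<tau>. G (x + t - \<tau>) \<tau> - G (x - t + \<tau>) \<tau>) / 2"
    unfolding duhamel_def
    by (intro arg_cong[where f = "\<lambda>r. r / 2"] Henstock_Kurzweil_Integration.integral_cong)
  also have "\<dots> = (integral {0..t} (\<lambda>\<tau>. G (x + t - \<tau>) \<tau>) - integral {0..t} (\<lambda>\<tau>. G (x - t + \<tau>) \<tau>)) / 2"
    by (subst Henstock_Kurzweil_Integration.integral_diff)
       (auto intro!: integrable_continuous_real csG continuous_intros)
  finally show ?thesis .
qed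

text \<open>The moving upper limit contributes nothing, because the two edges of the cone meet at the apex. What
remains is the integral along each edge, multiplied by the increment of the characteristic coordinate
that is constant on this edge.\<close>

lemma duhamel_has_derivative:
  fixes f :: "real \<Rightarrow> real \<Rightarrow> real"
  assumes f: "continuous_on UNIV (\<lambda>p. f (fst p) (snd p))" and t: "t \<ge> 0"
  shows "((\<lambda>(x, t). duhamel f x t) has_derivative
     (\<lambda>(dx, dt). (right_ray f x t * (dx + dt) + left_ray f x t * (dt - dx)) / 2))
     (at (x, t) within UNIV \<times> {0..})"
proof -
  obtain G where dG: "\<And>z \<tau>. ((\<lambda>z. G z \<tau>) has_real_derivative f z \<tau>) (at z)"
    and G: "continuous_on UNIV (\<lambda>p. G (fst p) (snd p))"
    using spatial_antiderivative[OF f] by blast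
  \<comment> \<open>The left edge of the cone is the right edge of the cone of the mirror image.\<close>
  define f' where "f' z \<tau> = f (- z) \<tau>" for z \<tau>
  define G' where "G' z \<tau> = - G (- z) \<tau>" for z \<tau>
  have f': "continuous_on UNIV (\<lambda>p. f' (fst p) (snd p))" and G': "continuous_on UNIV (\<lambda>p. G' (fst p) (snd p))"
    unfolding f'_def G'_def by (auto intro!: continuous_on_slice[OF f] continuous_on_slice[OF G] continuous_intros)
  have dG': "((\<lambda>z. G' z \<tau>) has_real_derivative f' z \<tau>) (at z)" for z \<tau>
  proof -
    have "((\<lambda>z. G (- z) \<tau>) has_real_derivative f (-z) \<tau> * (-1)) (at z)"
      by (rule DERIV_chain2[of "\<lambda>z. G z \<tau>", OF dG]) (auto intro!: derivative_eq_intros)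
    from DERIV_minus[OF this] show ?thesis unfolding f'_def G'_def by simp
  qed
  have L: "((\<lambda>(x, t). (t, x + t)) has_derivative (\<lambda>(dx, dt). (dt, dx + dt))) (at (x, t) within UNIV \<times> {0..})"
    for x t :: real
    by (auto intro!: derivative_eq_intros simp: case_prod_beta')
  have R: "((\<lambda>(x, t). (t, t - x)) has_derivative (\<lambda>(dx, dt). (dt, dt - dx))) (at (x, t) within UNIV \<times> {0..})"
    for x t :: real
    by (auto intro!: derivative_eq_intros simp: case_prod_beta')
  have 1: "((\<lambda>(a, v). integral {0..a} (\<lambda>\<tau>. G (v - \<tau>) \<tau>)) \<circ> (\<lambda>(x, t). (t, x + t)) has_derivative
      (\<lambda>(da, dv). G (x + t - t) t * da + integral {0..t} (\<lambda>\<tau>. f (x + t - \<tau>) \<tau>) * dv) \<circ> (\<lambda>(dx, dt). (dt, dx + dt)))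
      (at (x, t) within UNIV \<times> {0..})"
    by (rule diff_chain_within[OF L])
       (simp only: prod.case, rule has_derivative_subset[OF ray_primitive_derivative[OF f G dG, of t "x + t"]], use t in auto)
  have 2: "((\<lambda>(a, v). integral {0..a} (\<lambda>\<tau>. G' (v - \<tau>) \<tau>)) \<circ> (\<lambda>(x, t). (t, t - x)) has_derivative
      (\<lambda>(da, dv). G' (t - x - t) t * da + integral {0..t} (\<lambda>\<tau>. f' (t - x - \<tau>) \<tau>) * dv) \<circ> (\<lambda>(dx, dt). (dt, dt - dx)))
      (at (x, t) within UNIV \<times> {0..})"
    by (rule diff_chain_within[OF R])
       (simp only: prod.case, rule has_derivative_subset[OF ray_primitive_derivative[OF f' G' dG', of t "t - x"]], use t in auto)
  have e: "x - t + \<tau> = - (t - x - \<tau>)" for x t \<tau> :: real by simp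
  have eq: "duhamel f x t = (integral {0..t} (\<lambda>\<tau>. G (x + t - \<tau>) \<tau>) + integral {0..t} (\<lambda>\<tau>. G' (t - x - \<tau>) \<tau>)) / 2"
    if "t \<ge> 0" for x t
    unfolding duhamel_eq_antiderivative[of G f, OF dG G that] G'_def
    by (simp add: algebra_simps)
  have "((\<lambda>(x, t). (integral {0..t} (\<lambda>\<tau>. G (x + t - \<tau>) \<tau>) + integral {0..t} (\<lambda>\<tau>. G' (t - x - \<tau>) \<tau>)) / 2) has_derivative
     (\<lambda>(dx, dt). (right_ray f x t * (dx + dt) + left_ray f x t * (dt - dx)) / 2))
     (at (x, t) within UNIV \<times> {0..})"
    using has_derivative_divide[OF has_derivative_add[OF 1 2] has_derivative_const[of 2]]
    by (simp add: o_def case_prod_beta' right_ray_def left_ray_def f'_def G'_def algebra_simps)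
  then show ?thesis
    by (rule has_derivative_transform[rotated 2]) (use t eq in auto)
qed

lemma duhamel_derivative_along:
  fixes f :: "real \<Rightarrow> real \<Rightarrow> real"
  assumes f: "continuous_on UNIV (\<lambda>p. f (fst p) (snd p))"
    and X: "(X has_real_derivative c) (at h within S)" and Y: "(Y has_real_derivative d) (at h within S)"
    and pos: "\<And>s. s \<in> S \<Longrightarrow> Y s \<ge> 0" and h: "h \<in> S"
  shows "((\<lambda>h. duhamel f (X h) (Y h)) has_real_derivative
     (right_ray f (X h) (Y h) * (d + c) + left_ray f (X h) (Y h) * (d - c)) / 2) (at h within S)"
proof -
  have 1: "((\<lambda>h. (X h, Y h)) has_derivative (\<lambda>k. (c * k, d * k))) (at h within S)"
    using X Y by (intro has_derivative_Pair) (simp_all add: has_field_derivative_def)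
  have "((\<lambda>(x, t). duhamel f x t) \<circ> (\<lambda>h. (X h, Y h)) has_derivative
     (\<lambda>(dx, dt). (right_ray f (X h) (Y h) * (dx + dt) + left_ray f (X h) (Y h) * (dt - dx)) / 2) \<circ> (\<lambda>k. (c * k, d * k)))
     (at h within S)"
    by (rule diff_chain_within[OF 1])
       (rule has_derivative_subset[OF duhamel_has_derivative[OF f]], use pos h in auto)
  then have "((\<lambda>h. duhamel f (X h) (Y h)) has_derivative
     (\<lambda>k. (right_ray f (X h) (Y h) * (c * k + d * k) + left_ray f (X h) (Y h) * (d * k - c * k)) / 2)) (at h within S)"
    by (simp add: o_def)
  then show ?thesis
    unfolding has_field_derivative_def
    by (rule has_derivative_eq_rhs) (simp add: fun_eq_iff algebra_simps)
qed

lemma duhamel_continuous: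
  fixes f :: "real \<Rightarrow> real \<Rightarrow> real"
  assumes f: "continuous_on UNIV (\<lambda>p. f (fst p) (snd p))"
  shows "continuous_on (UNIV \<times> {0..}) (\<lambda>p. duhamel f (fst p) (snd p))"
proof -
  have "((\<lambda>p. duhamel f (fst p) (snd p)) has_derivative
      (\<lambda>q. (right_ray f (fst p) (snd p) * (fst q + snd q) + left_ray f (fst p) (snd p) * (snd q - fst q)) / 2))
      (at p within UNIV \<times> {0..})" if "p \<in> UNIV \<times> {0..}" for p :: "real \<times> real"
    using duhamel_has_derivative[OF f, of "snd p" "fst p"] that by (simp add: case_prod_beta' mem_Times_iff)
  then show ?thesis by (rule has_derivative_continuous_on)
qed

lemma right_ray_continuous:
  fixes f :: "real \<Rightarrow> real \<Rightarrow> real"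
  assumes f: "continuous_on UNIV (\<lambda>p. f (fst p) (snd p))"
  shows "continuous_on (UNIV \<times> {0..}) (\<lambda>p. right_ray f (fst p) (snd p))"
proof -
  have "continuous_on (UNIV \<times> {0..}) (\<lambda>p. (\<lambda>p. integral {0..fst p} (\<lambda>\<tau>. f (snd p - \<tau>) \<tau>)) (snd p, fst p + snd p))"
    by (rule continuous_on_compose2[OF right_ray_continuous_aux[OF f]]) (auto intro!: continuous_intros)
  then show ?thesis by (simp add: right_ray_def)
qed

lemma left_ray_mirror: "left_ray f x t = right_ray (\<lambda>z. f (- z)) (- x) t"
  by (simp add: left_ray_def right_ray_def algebra_simps)

lemma left_ray_continuous:
  fixes f :: "real \<Rightarrow> real \<Rightarrow> real"
  assumes f: "continuous_on UNIV (\<lambda>p. f (fst p) (snd p))"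
  shows "continuous_on (UNIV \<times> {0..}) (\<lambda>p. left_ray f (fst p) (snd p))"
proof -
  have f': "continuous_on UNIV (\<lambda>p. (\<lambda>z. f (- z)) (fst p) (snd p))"
    by (auto intro!: continuous_on_slice[OF f] continuous_intros)
  have "continuous_on (UNIV \<times> {0..}) (\<lambda>p. (\<lambda>p. right_ray (\<lambda>z. f (- z)) (fst p) (snd p)) (- fst p, snd p))"
    by (rule continuous_on_compose2[OF right_ray_continuous[OF f']]) (auto intro!: continuous_intros)
  then show ?thesis by (simp add: left_ray_mirror)
qed

lemma right_ray_derivative:
  fixes f :: "real \<Rightarrow> real \<Rightarrow> real"
  assumes f: "continuous_on UNIV (\<lambda>p. f (fst p) (snd p))" and h: "h \<ge> 0"
  shows "((\<lambda>h. right_ray f (c - h) h) has_real_derivative f (c - h) h) (at h within {0..})"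
proof -
  have "((\<lambda>h. integral {0..h} (\<lambda>\<tau>. f (c - \<tau>) \<tau>)) has_real_derivative f (c - h) h) (at h within {0..h+1})"
    using h by (intro integral_has_real_derivative continuous_on_slice[OF f] continuous_intros) auto
  moreover have "at h within {0..h+1} = at h within {0..}"
    by (rule at_within_nhd[of _ "{h-1<..<h+1}"]) auto
  ultimately show ?thesis by (simp add: right_ray_def)
qed

lemma left_ray_derivative:
  fixes f :: "real \<Rightarrow> real \<Rightarrow> real"
  assumes f: "continuous_on UNIV (\<lambda>p. f (fst p) (snd p))" and h: "h \<ge> 0"
  shows "((\<lambda>h. left_ray f (c + h) h) has_real_derivative f (c + h) h) (at h within {0..})"
proof -
  have f': "continuous_on UNIV (\<lambda>p. (\<lambda>z. f (- z)) (fst p) (snd p))"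
    by (auto intro!: continuous_on_slice[OF f] continuous_intros)
  have e: "left_ray f (c + h) h = right_ray (\<lambda>z. f (- z)) (- c - h) h" for h
    by (simp add: left_ray_mirror)
  show ?thesis using right_ray_derivative[OF f' h, of "-c"] unfolding e by (simp add: add.commute)
qed

section \<open>Translations and difference quotients in mean square\<close>

definition shift_distance :: "(real \<Rightarrow> real) \<Rightarrow> real \<Rightarrow> real" where
  "shift_distance f h = (\<integral>x. \<bar>f (x + h) - f x\<bar> \<partial>lborel)"

lemma integrable_shift:
  fixes f :: "real \<Rightarrow> real"
  assumes "integrable lborel f"
  shows "integrable lborel (\<lambda>x. f (x + h))"
  using lborel_integrable_real_affine[OF assms, of 1 h] by (simp add: add.commute)

lemma integral_shift:
  fixes f :: "real \<Rightarrow> real"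
  shows "(\<integral>x. f (x + h) \<partial>lborel) = (\<integral>x. f x \<partial>lborel)"
  using lborel_integral_real_affine[of 1 f h] by (simp add: add.commute)

lemma shift_distance_nonneg: "shift_distance f h \<ge> 0"
  by (simp add: shift_distance_def)

lemma shift_distance_approx:
  fixes f g :: "real \<Rightarrow> real"
  assumes f: "integrable lborel f" and g: "integrable lborel g"
  shows "shift_distance f h \<le> 2 * (\<integral>x. \<bar>f x - g x\<bar> \<partial>lborel) + shift_distance g h"
proof -
  note i = f g integrable_shift[OF f] integrable_shift[OF g]
  have "shift_distance f h \<le> (\<integral>x. \<bar>f (x + h) - g (x + h)\<bar> + \<bar>f x - g x\<bar> + \<bar>g (x + h) - g x\<bar> \<partial>lborel)"
    unfolding shift_distance_def by (rule integral_mono) (auto intro!: i Bochner_Integration.integrable_add integrable_abs Bochner_Integration.integrable_diff)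
  also have "\<dots> = (\<integral>x. \<bar>f (x + h) - g (x + h)\<bar> \<partial>lborel) + (\<integral>x. \<bar>f x - g x\<bar> \<partial>lborel) + shift_distance g h"
    unfolding shift_distance_def by (simp add: i)
  also have "(\<integral>x. \<bar>f (x + h) - g (x + h)\<bar> \<partial>lborel) = (\<integral>x. \<bar>f x - g x\<bar> \<partial>lborel)"
    by (rule integral_shift)
  finally show ?thesis by simp
qed

text \<open>Continuity of translations is inherited by limits in the mean, because the shift distance depends on
the function in a Lipschitz manner, uniformly in the shift.\<close>

lemma shift_distance_tendsto_approx:
  fixes f :: "real \<Rightarrow> real"
  assumes f: "integrable lborel f"
    and approx: "\<And>e. e > 0 \<Longrightarrow> \<exists>g. integrable lborel g \<and> (\<lambda>n. shift_distance g (X n)) \<longlonglongrightarrow> 0 \<and> (\<integral>x. \<bar>f x - g x\<bar> \<partial>lborel) < e"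
  shows "(\<lambda>n. shift_distance f (X n)) \<longlonglongrightarrow> 0"
proof (rule LIMSEQ_I)
  fix r :: real assume r: "r > 0"
  obtain g where g: "integrable lborel g" "(\<lambda>n. shift_distance g (X n)) \<longlonglongrightarrow> 0" "(\<integral>x. \<bar>f x - g x\<bar> \<partial>lborel) < r / 4"
    using approx[of "r / 4"] r by auto
  obtain N where N: "\<And>n. n \<ge> N \<Longrightarrow> \<bar>shift_distance g (X n)\<bar> < r / 2"
    using LIMSEQ_D[OF g(2), of "r / 2"] r by auto
  show "\<exists>N. \<forall>n\<ge>N. norm (shift_distance f (X n) - 0) < r"
  proof (intro exI[of _ N] allI impI)
    fix n assume "n \<ge> N"
    from N[OF this] shift_distance_approx[OF f g(1), of "X n"] g(3) shift_distance_nonneg[of f "X n"]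
    show "norm (shift_distance f (X n) - 0) < r" by simp
  qed
qed

text \<open>The integral of the indicator does not change under translation, so the positive and the negative part
of the difference have equal integrals. The positive part tends to zero pointwise: a point of an open
set stays in it under small translations.\<close>

lemma shift_distance_open:
  fixes U :: "real set"
  assumes U: "open U" and fin: "emeasure lborel U < \<infinity>" and X: "X \<longlonglongrightarrow> 0"
  shows "(\<lambda>n. shift_distance (indicator U) (X n)) \<longlonglongrightarrow> 0"
proof -
  have [measurable]: "U \<in> sets borel" using U by simp
  have i: "integrable lborel (indicator U :: real \<Rightarrow> real)"
    using fin by (simp add: integrable_indicator_iff)
  let ?D = "\<lambda>h x. max 0 (indicator U x - indicator U (x + h)) :: real"
  have D: "integrable lborel (?D h)" for h
    using i integrable_shift[OF i] by auto
  have eq: "shift_distance (indicator U) h = 2 * (\<integral>x. ?D h x \<partial>lborel)" for h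
  proof -
    have "shift_distance (indicator U) h = (\<integral>x. 2 * ?D h x + (indicator U (x + h) - indicator U x) \<partial>lborel)"
      unfolding shift_distance_def by (rule Bochner_Integration.integral_cong) (auto simp: indicator_def)
    also have "\<dots> = 2 * (\<integral>x. ?D h x \<partial>lborel) + ((\<integral>x. indicator U (x + h) \<partial>lborel) - (\<integral>x. indicator U x \<partial>lborel))"
      using D[of h] i integrable_shift[OF i, of h]
      by (subst Bochner_Integration.integral_add) auto
    also have "(\<integral>x. indicator U (x + h) \<partial>lborel) = (\<integral>x. (indicator U x :: real) \<partial>lborel)"
      by (rule integral_shift)
    finally show ?thesis by simp
  qed
  have "(\<lambda>n. \<integral>x. ?D (X n) x \<partial>lborel) \<longlonglongrightarrow> (\<integral>x. 0 \<partial>(lborel :: real measure))"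
  proof (rule integral_dominated_convergence[where w = "indicator U"])
    show "AE x in lborel. (\<lambda>n. ?D (X n) x) \<longlonglongrightarrow> 0"
    proof (rule AE_I2)
      fix x :: real
      show "(\<lambda>n. ?D (X n) x) \<longlonglongrightarrow> 0"
      proof (cases "x \<in> U")
        case True
        have "(\<lambda>n. x + X n) \<longlonglongrightarrow> x" using tendsto_add[OF tendsto_const X, of x] by simp
        then have "eventually (\<lambda>n. x + X n \<in> U) sequentially"
          using U True by (rule topological_tendstoD)
        then have "eventually (\<lambda>n. ?D (X n) x = 0) sequentially"
          by eventually_elim (use True in auto)
        then show ?thesis by (rule tendsto_eventually)
      qed auto
    qed
  qed (use i in \<open>auto simp: indicator_def\<close>)
  from tendsto_mult[OF tendsto_const this, of 2] show ?thesis by (simp add: eq)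
qed

text \<open>Outer regularity reduces an indicator to that of an open set; sums and dominated limits do the rest.\<close>

lemma translation_continuous_L1:
  fixes f :: "real \<Rightarrow> real"
  assumes f: "integrable lborel f" and X: "X \<longlonglongrightarrow> 0"
  shows "(\<lambda>n. shift_distance f (X n)) \<longlonglongrightarrow> 0"
  using f
proof (induction f rule: integrable_induct)
  case (base A c)
  have A: "A \<in> sets borel" and fin: "emeasure lborel A < \<infinity>" using base by auto
  have iA: "integrable lborel (indicator A :: real \<Rightarrow> real)"
    using A fin by (simp add: integrable_indicator_iff)
  have "(\<lambda>n. shift_distance (indicator A) (X n)) \<longlonglongrightarrow> 0"
  proof (rule shift_distance_tendsto_approx[OF iA])
    fix e :: real assume e: "e > 0"
    obtain U where U: "open U" "A \<subseteq> U" "emeasure lborel (U - A) < e"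
      using outer_regular_lborel[OF A e] by auto
    have "emeasure lborel U = emeasure lborel A + emeasure lborel (U - A)"
      using U A by (subst plus_emeasure) (auto intro!: arg_cong[where f = "emeasure lborel"])
    then have finU: "emeasure lborel U < \<infinity>"
      using fin U(3) by (auto simp: less_top[symmetric] dest: order.strict_trans)
    have iU: "integrable lborel (indicator U :: real \<Rightarrow> real)"
      using U(1) finU by (simp add: integrable_indicator_iff)
    have "(\<integral>x. \<bar>indicator A x - indicator U x :: real\<bar> \<partial>lborel) = (\<integral>x. (indicator (U - A) x :: real) \<partial>lborel)"
      using U(2) by (intro Bochner_Integration.integral_cong) (auto simp: indicator_def)
    also have "\<dots> = measure lborel (U - A)" using A U by simp
    also have "\<dots> < e" using U(3) e
      by (metis emeasure_eq_ennreal_measure ennreal_less_iff measure_nonneg order_less_le_trans top_greatest top.not_eq_extremum)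
    finally show "\<exists>g. integrable lborel g \<and> (\<lambda>n. shift_distance g (X n)) \<longlonglongrightarrow> 0 \<and> (\<integral>x. \<bar>indicator A x - g x\<bar> \<partial>lborel) < e"
      using iU shift_distance_open[OF U(1) finU X] by blast
  qed
  from tendsto_mult[OF tendsto_const this, of "\<bar>c\<bar>"]
  have "(\<lambda>n. \<bar>c\<bar> * shift_distance (indicator A) (X n)) \<longlonglongrightarrow> 0" by simp
  moreover have "shift_distance (\<lambda>x. indicator A x *\<^sub>R c) h = \<bar>c\<bar> * shift_distance (indicator A) h" for h
    unfolding shift_distance_def
    by (subst integral_mult_right_zero[symmetric], rule Bochner_Integration.integral_cong)
       (auto simp: abs_mult[symmetric] algebra_simps)
  ultimately show ?case by simp
next
  case (add f g)
  have "shift_distance (\<lambda>x. f x + g x) h \<le> shift_distance f h + shift_distance g h" for h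
  proof -
    note i = add.hyps integrable_shift[OF add.hyps(1)] integrable_shift[OF add.hyps(2)]
    have "shift_distance (\<lambda>x. f x + g x) h \<le> (\<integral>x. \<bar>f (x + h) - f x\<bar> + \<bar>g (x + h) - g x\<bar> \<partial>lborel)"
      unfolding shift_distance_def by (rule integral_mono) (auto intro!: i Bochner_Integration.integrable_add integrable_abs Bochner_Integration.integrable_diff)
    also have "\<dots> = shift_distance f h + shift_distance g h"
      unfolding shift_distance_def by (simp add: i)
    finally show ?thesis .
  qed
  moreover have "(\<lambda>n. shift_distance f (X n) + shift_distance g (X n)) \<longlonglongrightarrow> 0"
    using tendsto_add[OF add.IH] by simp
  ultimately show ?case
    using tendsto_sandwich[of "\<lambda>n. 0" "\<lambda>n. shift_distance (\<lambda>x. f x + g x) (X n)" sequentially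
      "\<lambda>n. shift_distance f (X n) + shift_distance g (X n)" 0]
    by (simp add: shift_distance_nonneg)
next
  case (lim f s)
  show ?case
  proof (rule shift_distance_tendsto_approx[OF lim.hyps(4)])
    fix e :: real assume e: "e > 0"
    have "(\<lambda>i. \<integral>x. \<bar>f x - s i x\<bar> \<partial>lborel) \<longlonglongrightarrow> (\<integral>x. 0 \<partial>(lborel :: real measure))"
    proof (rule integral_dominated_convergence[where w = "\<lambda>x. 3 * \<bar>f x\<bar>"])
      show "AE x in lborel. (\<lambda>i. \<bar>f x - s i x\<bar>) \<longlonglongrightarrow> 0"
      proof (rule AE_I2)
        fix x :: real
        have "(\<lambda>i. \<bar>f x - s i x\<bar>) \<longlonglongrightarrow> \<bar>f x - f x\<bar>"
          using lim.hyps(2)[of x] by (intro tendsto_intros) auto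
        then show "(\<lambda>i. \<bar>f x - s i x\<bar>) \<longlonglongrightarrow> 0" by simp
      qed
      show "AE x in lborel. norm \<bar>f x - s i x\<bar> \<le> 3 * \<bar>f x\<bar>" for i
      proof (rule AE_I2)
        fix x :: real
        show "norm \<bar>f x - s i x\<bar> \<le> 3 * \<bar>f x\<bar>"
          using lim.hyps(3)[of x i] by simp
      qed
    qed (use lim.hyps(1,4) in auto)
    then have "eventually (\<lambda>i. (\<integral>x. \<bar>f x - s i x\<bar> \<partial>lborel) < e) sequentially"
      using e by (intro order_tendstoD(2)) auto
    then obtain i where "(\<integral>x. \<bar>f x - s i x\<bar> \<partial>lborel) < e"
      by (auto simp: eventually_sequentially)
    with lim.hyps(1) lim.IH show "\<exists>g. integrable lborel g \<and> (\<lambda>n. shift_distance g (X n)) \<longlonglongrightarrow> 0 \<and> (\<integral>x. \<bar>f x - g x\<bar> \<partial>lborel) < e"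
      by blast
  qed
qed

lemma translation_continuous_L1_eps:
  fixes f :: "real \<Rightarrow> real"
  assumes f: "integrable lborel f" and e: "e > 0"
  shows "\<exists>d>0. \<forall>h. \<bar>h\<bar> < d \<longrightarrow> shift_distance f h < e"
proof -
  have "((shift_distance f) \<longlongrightarrow> 0) (at 0)"
    unfolding tendsto_at_iff_sequentially
    using translation_continuous_L1[OF f] by (auto simp: o_def)
  moreover have "shift_distance f 0 = 0" by (simp add: shift_distance_def)
  ultimately have "isCont (shift_distance f) 0" by (simp add: isCont_def)
  then obtain d where "d > 0" "\<And>h. dist h 0 < d \<Longrightarrow> dist (shift_distance f h) (shift_distance f 0) < e"
    using e unfolding continuous_at_eps_delta by blast
  with \<open>shift_distance f 0 = 0\<close> show ?thesis
    by (intro exI[of _ d]) (auto simp: dist_real_def shift_distance_nonneg)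
qed

definition L2_loc :: "(real \<Rightarrow> real) \<Rightarrow> bool" where
  "L2_loc p \<longleftrightarrow> p \<in> borel_measurable borel \<and> (\<forall>a b. set_integrable lborel {a..b} (\<lambda>x. (p x)\<^sup>2))"

lemma L2_loc_measurable: "L2_loc p \<Longrightarrow> p \<in> borel_measurable borel"
  by (simp add: L2_loc_def)

lemma L2_loc_square: "L2_loc p \<Longrightarrow> set_integrable lborel {a..b} (\<lambda>x. (p x)\<^sup>2)"
  by (simp add: L2_loc_def)

lemma abs_le_one_plus_square: "\<bar>x\<bar> \<le> 1 + (x::real)\<^sup>2"
proof -
  have "0 \<le> (\<bar>x\<bar> - 1)\<^sup>2" by simp
  then have "2 * \<bar>x\<bar> \<le> 1 + x\<^sup>2" by (simp add: power2_eq_square algebra_simps)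
  then show ?thesis by linarith
qed

lemma set_integrable_bound_Icc:
  fixes f g :: "real \<Rightarrow> real"
  assumes "f \<in> borel_measurable borel" "set_integrable lborel {a..b} g" "\<And>x. \<bar>f x\<bar> \<le> g x"
  shows "set_integrable lborel {a..b} f"
  using assms(2) unfolding set_integrable_def
  by (rule Bochner_Integration.integrable_bound)
     (use assms(1) in \<open>measurable, auto simp: indicator_def intro!: AE_I2 order.trans[OF assms(3)]\<close>)

lemma set_integrable_const_Icc: "set_integrable lborel {a..b::real} (\<lambda>x. c::real)"
  unfolding set_integrable_def by (auto simp: emeasure_lborel_Icc_eq)

lemma L2_loc_integrable:
  assumes "L2_loc p" shows "set_integrable lborel {a..b} p"
  by (rule set_integrable_bound_Icc[where g = "\<lambda>x. 1 + (p x)\<^sup>2"])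
     (auto intro!: set_integral_add set_integrable_const_Icc L2_loc_square L2_loc_measurable assms abs_le_one_plus_square)

text \<open>This elementary inequality transfers the continuity of translations from integrable functions to square
integrable ones: apply the former to \<open>p * \<bar>p\<bar>\<close>.\<close>

lemma square_diff_le_signed_square:
  fixes a b :: real
  shows "(a - b)\<^sup>2 \<le> 2 * \<bar>a * \<bar>a\<bar> - b * \<bar>b\<bar>\<bar>"
proof -
  have *: "(a - b)\<^sup>2 \<le> 2 * (a * \<bar>a\<bar> - b * \<bar>b\<bar>)" if "a \<ge> b" for a b :: real
  proof (cases "b \<ge> 0")
    case True
    then have "(a - b) * (a - b) \<le> (a - b) * (a + b)" using that by (intro mult_left_mono) auto
    moreover have "0 \<le> (a - b) * (a + b)" using that True by simp
    ultimately show ?thesis using True that by (simp add: power2_eq_square algebra_simps)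
  next
    case b: False
    show ?thesis
    proof (cases "a \<le> 0")
      case True
      then have "(a - b) * (a - b) \<le> (a - b) * (- a - b)" using that by (intro mult_left_mono) auto
      moreover have "0 \<le> (a - b) * (- a - b)" using that True b by simp
      ultimately show ?thesis using True b that by (simp add: power2_eq_square algebra_simps)
    next
      case False
      have "0 \<le> (a + b)\<^sup>2" by simp
      with False b show ?thesis by (simp add: power2_eq_square algebra_simps)
    qed
  qed
  show ?thesis
  proof (cases "a \<ge> b")
    case True
    show ?thesis using *[OF True] abs_ge_self[of "a * \<bar>a\<bar> - b * \<bar>b\<bar>"]
      by (meson mult_left_mono order.trans zero_le_numeral)
  next
    case False
    then have ab: "a \<le> b" by simp
    have "(a - b)\<^sup>2 \<le> 2 * (b * \<bar>b\<bar> - a * \<bar>a\<bar>)" using *[OF ab] by (simp add: power2_commute[of a b])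
    then show ?thesis using abs_ge_self[of "b * \<bar>b\<bar> - a * \<bar>a\<bar>"] unfolding abs_minus_commute[of "a * \<bar>a\<bar>"]
      by (meson mult_left_mono order.trans zero_le_numeral)
  qed
qed

lemma translation_continuous_L2:
  assumes p: "L2_loc p" and e: "e > 0"
  shows "\<exists>d>0. d \<le> 1 \<and> (\<forall>h. \<bar>h\<bar> < d \<longrightarrow>
    (\<integral>\<^sup>+x. ennreal (indicator {a..b} x * (p (x + h) - p x)\<^sup>2) \<partial>lborel) \<le> ennreal e)"
proof -
  define f where "f x = indicator {a-1..b+1} x * (p x * \<bar>p x\<bar>)" for x
  note [measurable] = L2_loc_measurable[OF p]
  have f: "integrable lborel f"
    using L2_loc_square[OF p, of "a-1" "b+1"] unfolding set_integrable_def
    unfolding f_def by (rule Bochner_Integration.integrable_bound) (auto simp: abs_mult power2_eq_square)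
  obtain d where d: "d > 0" "\<And>h. \<bar>h\<bar> < d \<Longrightarrow> shift_distance f h < e / 2"
    using translation_continuous_L1_eps[OF f, of "e/2"] e by auto
  show ?thesis
  proof (intro exI[of _ "min d 1"] conjI allI impI)
    fix h assume h: "\<bar>h\<bar> < min d 1"
    have i: "integrable lborel (\<lambda>x. \<bar>f (x + h) - f x\<bar>)"
      using f integrable_shift[OF f, of h] by auto
    have "(\<integral>\<^sup>+x. ennreal (indicator {a..b} x * (p (x + h) - p x)\<^sup>2) \<partial>lborel)
       \<le> (\<integral>\<^sup>+x. ennreal (2 * \<bar>f (x + h) - f x\<bar>) \<partial>lborel)"
    proof (intro nn_integral_mono ennreal_leI)
      fix x
      show "indicator {a..b} x * (p (x + h) - p x)\<^sup>2 \<le> 2 * \<bar>f (x + h) - f x\<bar>"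
      proof (cases "x \<in> {a..b}")
        case True
        with h have "x \<in> {a-1..b+1}" "x + h \<in> {a-1..b+1}" by auto
        with True square_diff_le_signed_square[of "p (x + h)" "p x"] show ?thesis by (simp add: f_def)
      qed simp
    qed
    also have "\<dots> = ennreal (2 * shift_distance f h)"
      using i unfolding shift_distance_def by (subst nn_integral_eq_integral) auto
    also have "\<dots> \<le> ennreal e" using d(2)[of h] h by (intro ennreal_leI) auto
    finally show "(\<integral>\<^sup>+x. ennreal (indicator {a..b} x * (p (x + h) - p x)\<^sup>2) \<partial>lborel) \<le> ennreal e" .
  qed (use d in auto)
qed

text \<open>Absolute continuity in integrated form; it is used with a locally square integrable \<open>p\<close>.\<close>

definition primitive :: "(real \<Rightarrow> real) \<Rightarrow> (real \<Rightarrow> real) \<Rightarrow> bool" where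
  "primitive \<phi> p \<longleftrightarrow> (\<forall>\<alpha> \<beta>. \<alpha> \<le> \<beta> \<longrightarrow> \<phi> \<beta> - \<phi> \<alpha> = integral {\<alpha>..\<beta>} p)"

lemma unit_interval_affine_image:
  fixes h x :: real
  assumes "h \<noteq> 0"
  shows "(\<lambda>y. (y - x) / h) ` (if h > 0 then {x..x + h} else {x + h..x}) = {0..1}"
proof
  show "(\<lambda>y. (y - x) / h) ` (if h > 0 then {x..x + h} else {x + h..x}) \<subseteq> {0..1}"
    using assms by (auto simp: field_simps)
  show "{0..1} \<subseteq> (\<lambda>y. (y - x) / h) ` (if h > 0 then {x..x + h} else {x + h..x})"
  proof
    fix r :: real assume r: "r \<in> {0..1}"
    have "r = (\<lambda>y. (y - x) / h) (x + h * r)" using assms by simp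
    moreover have "x + h * r \<in> (if h > 0 then {x..x + h} else {x + h..x})"
    proof (cases "h > 0")
      case True
      then have "0 \<le> h * r" "h * r \<le> h * 1" using r by (auto intro: mult_left_mono)
      with True show ?thesis by simp
    next
      case False
      with assms have "h * r \<le> h * 0" "h * 1 \<le> h * r" using r by (auto simp: mult_le_0_iff intro: mult_left_mono_neg)
      with False show ?thesis by simp
    qed
    ultimately show "r \<in> (\<lambda>y. (y - x) / h) ` (if h > 0 then {x..x + h} else {x + h..x})"
      by (rule image_eqI)
  qed
qed

lemma primitive_difference_quotient:
  assumes p: "L2_loc p" and \<phi>: "primitive \<phi> p" and h: "h \<noteq> 0"
  shows "((\<lambda>\<sigma>. p (x + h * \<sigma>)) has_integral (\<phi> (x + h) - \<phi> x) / h) {0..1}"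
proof -
  have int: "p integrable_on {\<alpha>..\<beta>}" for \<alpha> \<beta>
    using set_borel_integral_eq_integral(1)[OF L2_loc_integrable[OF p]] .
  show ?thesis
  proof (cases "h > 0")
    case True
    have "(p has_integral (\<phi> (x + h) - \<phi> x)) (cbox x (x + h))"
      using \<phi> True int[of x "x + h"] by (auto simp: primitive_def has_integral_integral)
    from has_integral_affinity[OF this h, of x]
    have "((\<lambda>\<sigma>. p (x + h * \<sigma>)) has_integral (\<phi> (x + h) - \<phi> x) / h) ((\<lambda>y. (1 / h) *\<^sub>R y + - ((1 / h) *\<^sub>R x)) ` cbox x (x + h))"
      using True by (simp add: add.commute divide_inverse mult.commute)
    moreover have "(\<lambda>y. (1 / h) *\<^sub>R y + - ((1 / h) *\<^sub>R x)) ` cbox x (x + h) = {0..1}"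
      using unit_interval_affine_image[OF h, of x] True by (simp add: diff_divide_distrib)
    ultimately show ?thesis by simp
  next
    case False
    with h have h': "h < 0" by simp
    have "(p has_integral (\<phi> x - \<phi> (x + h))) (cbox (x + h) x)"
      using \<phi> h' int[of "x + h" x] by (auto simp: primitive_def has_integral_integral)
    from has_integral_affinity[OF this h, of x]
    have "((\<lambda>\<sigma>. p (x + h * \<sigma>)) has_integral (\<phi> (x + h) - \<phi> x) / h) ((\<lambda>y. (1 / h) *\<^sub>R y + - ((1 / h) *\<^sub>R x)) ` cbox (x + h) x)"
    proof -
      have "- ((\<phi> x - \<phi> (x + h)) / h) = (\<phi> (x + h) - \<phi> x) / h"
        by (simp add: diff_divide_distrib)
      with has_integral_affinity[OF \<open>(p has_integral (\<phi> x - \<phi> (x + h))) (cbox (x + h) x)\<close> h, of x] h'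
      show ?thesis by (simp add: add.commute)
    qed
    moreover have "(\<lambda>y. (1 / h) *\<^sub>R y + - ((1 / h) *\<^sub>R x)) ` cbox (x + h) x = {0..1}"
      using unit_interval_affine_image[OF h, of x] h' by (simp add: diff_divide_distrib)
    ultimately show ?thesis by simp
  qed
qed

lemma mean_square_jensen:
  fixes f :: "real \<Rightarrow> real"
  assumes m: "f \<in> borel_measurable borel" and I: "(f has_integral I) {0..1}"
  shows "ennreal (I\<^sup>2) \<le> (\<integral>\<^sup>+\<sigma>. ennreal (indicator {0..1} \<sigma> * (f \<sigma>)\<^sup>2) \<partial>lborel)"
proof (cases "set_integrable lborel {0..1} (\<lambda>\<sigma>. (f \<sigma>)\<^sup>2)")
  case True
  have i1: "set_integrable lborel {0..1} f"
    by (rule set_integrable_bound_Icc[where g = "\<lambda>x. 1 + (f x)\<^sup>2"])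
       (auto intro!: set_integral_add set_integrable_const_Icc True m abs_le_one_plus_square)
  have I': "I = (LBINT \<sigma>:{0..1}. f \<sigma>)"
    using set_borel_integral_eq_integral(2)[OF i1] integral_unique[OF I] by simp
  have "0 \<le> (LBINT \<sigma>:{0..1}. (f \<sigma> - I)\<^sup>2)"
    unfolding set_lebesgue_integral_def by (rule Bochner_Integration.integral_nonneg) (auto simp: indicator_def)
  also have "(LBINT \<sigma>:{0..1}. (f \<sigma> - I)\<^sup>2) = (LBINT \<sigma>:{0..1}. ((f \<sigma>)\<^sup>2 - (2 * I) * f \<sigma>) + I\<^sup>2)"
    by (simp add: power2_diff algebra_simps)
  also have "\<dots> = (LBINT \<sigma>:{0..1}. (f \<sigma>)\<^sup>2) - 2 * I * (LBINT \<sigma>:{0..1}. f \<sigma>) + (LBINT \<sigma>:{0..1::real}. I\<^sup>2)"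
    using True i1 by (simp add: set_integral_add set_integral_diff set_integrable_const_Icc)
  also have "(LBINT \<sigma>:{0..1::real}. I\<^sup>2) = I\<^sup>2"
    by (simp add: set_lebesgue_integral_def)
  finally have "I\<^sup>2 \<le> (LBINT \<sigma>:{0..1}. (f \<sigma>)\<^sup>2)"
    unfolding I'[symmetric] by (simp add: power2_eq_square)
  also have "(LBINT \<sigma>:{0..1}. (f \<sigma>)\<^sup>2) = (\<integral>\<sigma>. indicator {0..1} \<sigma> * (f \<sigma>)\<^sup>2 \<partial>lborel)"
    by (simp add: set_lebesgue_integral_def)
  also have "ennreal \<dots> = (\<integral>\<^sup>+\<sigma>. ennreal (indicator {0..1} \<sigma> * (f \<sigma>)\<^sup>2) \<partial>lborel)"
    using True unfolding set_integrable_def by (intro nn_integral_eq_integral[symmetric]) auto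
  finally show ?thesis by (simp add: ennreal_leI)
next
  case False
  have "\<not> integrable lborel (\<lambda>\<sigma>. indicator {0..1} \<sigma> * (f \<sigma>)\<^sup>2)"
    using False by (simp add: set_integrable_def)
  then have "(\<integral>\<^sup>+\<sigma>. ennreal (indicator {0..1} \<sigma> * (f \<sigma>)\<^sup>2) \<partial>lborel) = \<infinity>"
    using m by (auto simp: integrable_iff_bounded abs_mult less_top[symmetric])
  then show ?thesis by simp
qed

text \<open>The difference quotient is the mean of the translates \<open>p (x + h * \<sigma>)\<close> over the unit interval. By
Jensen's inequality and Tonelli's theorem its distance to \<open>p\<close> is at most the largest distance between
\<open>p\<close> and one of these translates.\<close>

lemma primitive_difference_quotient_L2:
  assumes p: "L2_loc p" and \<phi>: "primitive \<phi> p" and e: "e > 0"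
  shows "\<exists>d>0. \<forall>h. h \<noteq> 0 \<longrightarrow> \<bar>h\<bar> < d \<longrightarrow>
    (\<integral>\<^sup>+x. ennreal (indicator {a..b} x * ((\<phi> (x + h) - \<phi> x) / h - p x)\<^sup>2) \<partial>lborel) \<le> ennreal e"
proof -
  note [measurable] = L2_loc_measurable[OF p]
  obtain d where d: "d > 0" "\<And>h. \<bar>h\<bar> < d \<Longrightarrow>
      (\<integral>\<^sup>+x. ennreal (indicator {a..b} x * (p (x + h) - p x)\<^sup>2) \<partial>lborel) \<le> ennreal e"
    using translation_continuous_L2[OF p e, of a b] by auto
  show ?thesis
  proof (intro exI[of _ d] conjI allI impI d(1))
    fix h :: real assume h: "h \<noteq> 0" "\<bar>h\<bar> < d"
    have "(\<integral>\<^sup>+x. ennreal (indicator {a..b} x * ((\<phi> (x + h) - \<phi> x) / h - p x)\<^sup>2) \<partial>lborel) \<le>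
      (\<integral>\<^sup>+x. (\<integral>\<^sup>+\<sigma>. ennreal (indicator {a..b} x * (indicator {0..1} \<sigma> * (p (x + h * \<sigma>) - p x)\<^sup>2)) \<partial>lborel) \<partial>lborel)"
    proof (rule nn_integral_mono)
      fix x :: real
      show "ennreal (indicator {a..b} x * ((\<phi> (x + h) - \<phi> x) / h - p x)\<^sup>2) \<le>
        (\<integral>\<^sup>+\<sigma>. ennreal (indicator {a..b} x * (indicator {0..1} \<sigma> * (p (x + h * \<sigma>) - p x)\<^sup>2)) \<partial>lborel)"
      proof (cases "x \<in> {a..b}")
        case True
        have "((\<lambda>\<sigma>. p (x + h * \<sigma>) - p x) has_integral ((\<phi> (x + h) - \<phi> x) / h - p x)) {0..1}"
          using has_integral_diff[OF primitive_difference_quotient[OF p \<phi> h(1)] has_integral_const_real[of "p x" 0 1]] by simp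
        from mean_square_jensen[OF _ this] True show ?thesis by simp
      qed simp
    qed
    also have "\<dots> = (\<integral>\<^sup>+\<sigma>. (\<integral>\<^sup>+x. ennreal (indicator {a..b} x * (indicator {0..1} \<sigma> * (p (x + h * \<sigma>) - p x)\<^sup>2)) \<partial>lborel) \<partial>lborel)"
      by (rule lborel_pair.Fubini') measurable
    also have "\<dots> \<le> (\<integral>\<^sup>+\<sigma>. ennreal e * indicator {0..1::real} \<sigma> \<partial>lborel)"
    proof (rule nn_integral_mono)
      fix \<sigma> :: real
      show "(\<integral>\<^sup>+x. ennreal (indicator {a..b} x * (indicator {0..1} \<sigma> * (p (x + h * \<sigma>) - p x)\<^sup>2)) \<partial>lborel) \<le> ennreal e * indicator {0..1} \<sigma>"
      proof (cases "\<sigma> \<in> {0..1}")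
        case True
        have "\<bar>h * \<sigma>\<bar> \<le> \<bar>h\<bar> * 1" unfolding abs_mult using True by (intro mult_left_mono) auto
        with h(2) d(2)[of "h * \<sigma>"] True show ?thesis by simp
      qed simp
    qed
    also have "\<dots> = ennreal e" by (subst nn_integral_cmult_indicator) auto
    finally show "(\<integral>\<^sup>+x. ennreal (indicator {a..b} x * ((\<phi> (x + h) - \<phi> x) / h - p x)\<^sup>2) \<partial>lborel) \<le> ennreal e" .
  qed
qed

section \<open>Weak derivatives on the line\<close>

text \<open>The classical bump on the unit interval, multiplied by a rational function with poles at the endpoints
only. This family is closed under differentiation, with \<open>bump_next\<close> as the new numerator, and so all
its members are smooth.\<close>

definition bump_term :: "real poly \<Rightarrow> nat \<Rightarrow> real \<Rightarrow> real" where
  "bump_term P m x = (if 0 < x \<and> x < 1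
     then poly P x / (x ^ m * (1 - x) ^ m) * exp (- 1 / x - 1 / (1 - x)) else 0)"

definition bump_next :: "real poly \<Rightarrow> nat \<Rightarrow> real poly" where
  "bump_next P m = pderiv P * [:0, 1:] ^ 2 * [:1, -1:] ^ 2
     - smult (real m) (P * [:0, 1:] * [:1, -1:] ^ 2) + smult (real m) (P * [:0, 1:] ^ 2 * [:1, -1:])
     + P * [:1, -1:] ^ 2 - P * [:0, 1:] ^ 2"

lemma exp_neg_inverse_le:
  fixes x :: real assumes x: "x > 0"
  shows "exp (- 1 / x) \<le> fact k * x ^ k"
proof -
  let ?f = "\<lambda>n. (1 / x) ^ n /\<^sub>R fact n"
  have "sum ?f {k} \<le> suminf ?f"
    using x by (intro sum_le_suminf summable_exp_generic) auto
  also have "suminf ?f = exp (1 / x)"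
    by (simp add: exp_def)
  finally have "(1 / x) ^ k / fact k \<le> exp (1 / x)"
    by (simp add: divide_inverse mult.commute)
  then have "inverse (exp (1 / x)) \<le> inverse ((1 / x) ^ k / fact k)"
    using x by (intro le_imp_inverse_le) auto
  then show ?thesis using x
    by (simp add: exp_minus field_simps power_divide)
qed

text \<open>Each factor \<open>exp (- 1 / x)\<close> beats the pole and two more powers, so the derivative at the endpoints is zero.\<close>

lemma bump_term_quadratic_bound:
  "\<exists>C. (\<forall>x. \<bar>bump_term P m x\<bar> \<le> C * x\<^sup>2) \<and> (\<forall>x. \<bar>bump_term P m x\<bar> \<le> C * (1 - x)\<^sup>2)"
proof -
  have "compact (poly P ` {0..1})" by (intro compact_continuous_image continuous_intros) auto
  then have "bounded (poly P ` {0..1})" by (rule compact_imp_bounded)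
  then obtain B where "\<forall>x\<in>{0..1}. \<bar>poly P x\<bar> \<le> B"
    unfolding bounded_iff by auto
  then have B: "\<bar>poly P x\<bar> \<le> B" if "x \<in> {0..1}" for x using that by blast
  have B0: "B \<ge> 0" using B[of 0] by simp
  define C where "C = B * (fact (m + 2) * fact m)"
  have key: "\<bar>poly P x / (x ^ m * (1 - x) ^ m) * exp (- 1 / x - 1 / (1 - x))\<bar> \<le> B * (fact i * fact j) * (x ^ i / x ^ m) * ((1 - x) ^ j / (1 - x) ^ m)"
    if x: "0 < x" "x < 1" for x i j
  proof -
    have "exp (- 1 / x - 1 / (1 - x)) = exp (- 1 / x) * exp (- 1 / (1 - x))"
      by (simp flip: exp_add)
    also have "\<dots> \<le> (fact i * x ^ i) * (fact j * (1 - x) ^ j)"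
      using x exp_neg_inverse_le[of x i] exp_neg_inverse_le[of "1 - x" j] by (intro mult_mono) auto
    finally have 1: "exp (- 1 / x - 1 / (1 - x)) \<le> (fact i * x ^ i) * (fact j * (1 - x) ^ j)" .
    have "\<bar>poly P x / (x ^ m * (1 - x) ^ m) * exp (- 1 / x - 1 / (1 - x))\<bar>
      = \<bar>poly P x\<bar> / (x ^ m * (1 - x) ^ m) * exp (- 1 / x - 1 / (1 - x))"
      using x by (simp add: abs_mult power_abs)
    also have "\<dots> \<le> B / (x ^ m * (1 - x) ^ m) * ((fact i * x ^ i) * (fact j * (1 - x) ^ j))"
      using x B[of x] 1 B0 by (intro mult_mono divide_right_mono) auto
    finally show ?thesis by (simp add: mult_ac)
  qed
  show ?thesis
  proof (intro exI[of _ C] conjI allI)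
    have C0: "C \<ge> 0" using B0 by (simp add: C_def)
    show "\<bar>bump_term P m x\<bar> \<le> C * x\<^sup>2" for x
    proof (cases "0 < x \<and> x < 1")
      case True
      with key[of x "m + 2" m] show ?thesis by (simp add: bump_term_def C_def power_add power2_eq_square)
    qed (use C0 in \<open>auto simp: bump_term_def\<close>)
    show "\<bar>bump_term P m x\<bar> \<le> C * (1 - x)\<^sup>2" for x
    proof (cases "0 < x \<and> x < 1")
      case True
      with key[of x m "m + 2"] show ?thesis by (simp add: bump_term_def C_def power_add power2_eq_square mult_ac)
    qed (use C0 in \<open>auto simp: bump_term_def\<close>)
  qed
qed

lemma has_derivative_zero_of_quadratic_bound:
  fixes f :: "real \<Rightarrow> real"
  assumes "\<And>x. \<bar>f x\<bar> \<le> C * (x - a)\<^sup>2"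
  shows "(f has_real_derivative 0) (at a)"
proof -
  have fa: "f a = 0" using assms[of a] by simp
  have "((\<lambda>h. (f (a + h) - f a) / h) \<longlongrightarrow> 0) (at 0)"
  proof (rule Lim_null_comparison)
    show "\<forall>\<^sub>F h in at 0. norm ((f (a + h) - f a) / h) \<le> C * \<bar>h\<bar>"
    proof (rule eventually_at_filter[THEN iffD2], rule always_eventually, intro allI impI)
      fix h :: real assume "h \<noteq> 0"
      then show "norm ((f (a + h) - f a) / h) \<le> C * \<bar>h\<bar>"
        using assms[of "a + h"] fa unfolding power2_abs[of h, symmetric]
        by (simp add: pos_divide_le_eq power2_eq_square mult.assoc)
    qed
    show "((\<lambda>h. C * \<bar>h\<bar>) \<longlongrightarrow> 0) (at 0)"
      by (auto intro!: tendsto_eq_intros)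
  qed
  then show ?thesis by (simp add: DERIV_def)
qed

lemma inverse_power_derivative:
  fixes x :: real assumes x: "x \<noteq> 0"
  shows "((\<lambda>x. inverse (x ^ m)) has_real_derivative - real m * inverse (x ^ m) / x) (at x)"
proof -
  have "((\<lambda>x. x ^ m) has_real_derivative real m * x ^ m / x) (at x)"
    by (rule DERIV_cong[OF DERIV_pow]) (use x in \<open>cases m, auto\<close>)
  from DERIV_inverse'[OF this] x show ?thesis by (simp add: field_simps)
qed

lemma bump_term_derivative:
  "(bump_term P m has_real_derivative bump_term (bump_next P m) (m + 2) x) (at x)"
proof -
  obtain C where C: "\<And>x. \<bar>bump_term P m x\<bar> \<le> C * x\<^sup>2" "\<And>x. \<bar>bump_term P m x\<bar> \<le> C * (1 - x)\<^sup>2"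
    using bump_term_quadratic_bound[of P m] by blast
  consider "x < 0" | "x = 0" | "0 < x" "x < 1" | "x = 1" | "x > 1" by linarith
  then show ?thesis
  proof cases
    case 1
    have "((\<lambda>x. 0) has_real_derivative 0) (at x)" by simp
    then have "(bump_term P m has_real_derivative 0) (at x)"
      by (rule has_field_derivative_transform_within_open[of _ _ _ "{..<0}"]) (use 1 in \<open>auto simp: bump_term_def\<close>)
    with 1 show ?thesis by (simp add: bump_term_def)
  next
    case 2
    have "(bump_term P m has_real_derivative 0) (at 0)"
      by (rule has_derivative_zero_of_quadratic_bound[of _ C]) (use C in auto)
    with 2 show ?thesis by (simp add: bump_term_def)
  next
    case 3
    let ?g = "\<lambda>x. poly P x * inverse (x ^ m) * inverse ((1 - x) ^ m) * exp (- 1 / x - 1 / (1 - x))"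
    have d1: "((\<lambda>x. inverse (x ^ m)) has_real_derivative - real m * inverse (x ^ m) / x) (at x)"
      using 3 by (intro inverse_power_derivative) auto
    have d2: "((\<lambda>x. inverse ((1 - x) ^ m)) has_real_derivative real m * inverse ((1 - x) ^ m) / (1 - x)) (at x)"
    proof -
      have "((\<lambda>x. inverse ((1 - x) ^ m)) has_real_derivative - real m * inverse ((1 - x) ^ m) / (1 - x) * (- 1)) (at x)"
        by (rule DERIV_chain2[OF inverse_power_derivative]) (use 3 in \<open>auto intro!: derivative_eq_intros\<close>)
      then show ?thesis by simp
    qed
    have d3: "((\<lambda>x. exp (- 1 / x - 1 / (1 - x))) has_real_derivative exp (- 1 / x - 1 / (1 - x)) * (1 / x\<^sup>2 - 1 / (1 - x)\<^sup>2)) (at x)"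
    proof -
      have "((\<lambda>x. - 1 / x - 1 / (1 - x)) has_real_derivative (1 / x\<^sup>2 - 1 / (1 - x)\<^sup>2)) (at x)"
        by (rule derivative_eq_intros refl | (use 3 in \<open>simp add: power2_eq_square\<close>))+
      from DERIV_fun_exp[OF this] show ?thesis .
    qed
    have "(?g has_real_derivative
       (poly (pderiv P) x * inverse (x ^ m) * inverse ((1 - x) ^ m)
        + poly P x * (- real m * inverse (x ^ m) / x) * inverse ((1 - x) ^ m)
        + poly P x * inverse (x ^ m) * (real m * inverse ((1 - x) ^ m) / (1 - x))
        + poly P x * inverse (x ^ m) * inverse ((1 - x) ^ m) * (1 / x\<^sup>2 - 1 / (1 - x)\<^sup>2)) * exp (- 1 / x - 1 / (1 - x))) (at x)"
      by (rule DERIV_cong[OF DERIV_mult'[OF DERIV_mult'[OF DERIV_mult'[OF poly_DERIV d1] d2] d3]]) (simp add: algebra_simps)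
    moreover have "(poly (pderiv P) x * inverse (x ^ m) * inverse ((1 - x) ^ m)
        + poly P x * (- real m * inverse (x ^ m) / x) * inverse ((1 - x) ^ m)
        + poly P x * inverse (x ^ m) * (real m * inverse ((1 - x) ^ m) / (1 - x))
        + poly P x * inverse (x ^ m) * inverse ((1 - x) ^ m) * (1 / x\<^sup>2 - 1 / (1 - x)\<^sup>2))
        = poly (bump_next P m) x / (x ^ (m + 2) * (1 - x) ^ (m + 2))"
    proof -
      define q where "q = 1 - x"
      have q: "q \<noteq> 0" "x \<noteq> 0" using 3 by (auto simp: q_def)
      have eq: "poly (bump_next P m) x = poly (pderiv P) x * x\<^sup>2 * q\<^sup>2 - real m * (poly P x * x * q\<^sup>2)
          + real m * (poly P x * x\<^sup>2 * q) + poly P x * q\<^sup>2 - poly P x * x\<^sup>2"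
        by (simp add: bump_next_def q_def) (simp add: algebra_simps)
      have e1: "poly (bump_next P m) x / (x\<^sup>2 * q\<^sup>2)
          = poly (pderiv P) x - real m * poly P x / x + real m * poly P x / q + poly P x / x\<^sup>2 - poly P x / q\<^sup>2"
        unfolding eq using q by (simp add: field_simps power2_eq_square)
      have e2: "poly (bump_next P m) x / (x ^ (m + 2) * q ^ (m + 2))
          = poly (bump_next P m) x / (x\<^sup>2 * q\<^sup>2) * inverse (x ^ m) * inverse (q ^ m)"
        unfolding power_add divide_inverse inverse_mult_distrib by (simp only: mult_ac)
      show ?thesis unfolding q_def[symmetric] e2 e1
        by (simp add: algebra_simps)
    qed
    ultimately have "(?g has_real_derivative bump_term (bump_next P m) (m + 2) x) (at x)"
      using 3 by (simp add: bump_term_def)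
    then show ?thesis
      by (rule has_field_derivative_transform_within_open[of _ _ _ "{0<..<1}"])
         (use 3 in \<open>auto simp: bump_term_def divide_inverse mult_ac\<close>)
  next
    case 4
    have "(bump_term P m has_real_derivative 0) (at 1)"
      by (rule has_derivative_zero_of_quadratic_bound[of _ C]) (use C in \<open>auto simp: power2_commute\<close>)
    with 4 show ?thesis by (simp add: bump_term_def)
  next
    case 5
    have "((\<lambda>x. 0) has_real_derivative 0) (at x)" by simp
    then have "(bump_term P m has_real_derivative 0) (at x)"
      by (rule has_field_derivative_transform_within_open[of _ _ _ "{1<..}"]) (use 5 in \<open>auto simp: bump_term_def\<close>)
    with 5 show ?thesis by (simp add: bump_term_def)
  qed
qed

text \<open>Smoothness by coinduction: it suffices to exhibit a set of differentiable functions that contains the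
function and is closed under differentiation.\<close>

lemma iterated_deriv_differentiable:
  fixes f :: "real \<Rightarrow> real"
  assumes f: "f \<in> S" and S: "\<And>g x. g \<in> S \<Longrightarrow> g differentiable (at x)" "\<And>g. g \<in> S \<Longrightarrow> deriv g \<in> S"
  shows "(deriv ^^ n) f differentiable (at x)"
proof -
  have "(deriv ^^ n) f \<in> S" by (induction n) (use f S(2) in auto)
  then show ?thesis by (rule S(1))
qed

text \<open>The normalised antiderivative of the bump: a smooth transition from zero to one.\<close>

lemma smooth_step_exists:
  obtains H :: "real \<Rightarrow> real" and c :: real
  where "c > 0" "\<And>x. (H has_real_derivative c * bump_term 1 0 x) (at x)"
    "\<And>x. x \<le> 0 \<Longrightarrow> H x = 0" "\<And>x. x \<ge> 1 \<Longrightarrow> H x = 1" "\<And>x. 0 \<le> H x" "\<And>x. H x \<le> 1"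
proof -
  let ?b = "bump_term 1 0"
  have cont: "continuous_on UNIV ?b"
    by (meson bump_term_derivative DERIV_isCont continuous_at_imp_continuous_on)
  obtain G where dG: "\<And>z. (G has_real_derivative ?b z) (at z)"
  proof -
    have "continuous_on UNIV (\<lambda>p::real\<times>real. ?b (fst p))"
      by (intro continuous_on_compose2[OF cont] continuous_intros) auto
    then obtain G where "\<And>z \<tau>::real. ((\<lambda>z. G z \<tau>) has_real_derivative ?b z) (at z)"
      using spatial_antiderivative[of "\<lambda>z \<tau>. ?b z"] by metis
    then show ?thesis using that by blast
  qed
  have b0: "?b x \<ge> 0" for x by (simp add: bump_term_def)
  have mono: "G x \<le> G y" if "x \<le> y" for x y
    using DERIV_nonneg_imp_nondecreasing[OF that] dG b0 by blast
  have pos: "G 0 < G 1"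
  proof (rule DERIV_pos_imp_increasing_open[of 0 1])
    show "\<exists>y. (G has_real_derivative y) (at x) \<and> 0 < y" if "0 < x" "x < 1" for x
      using dG[of x] that by (intro exI[of _ "?b x"]) (auto simp: bump_term_def)
    show "continuous_on {0..1} G" by (meson dG DERIV_isCont continuous_at_imp_continuous_on)
  qed simp
  have left: "G x = G 0" if "x \<le> 0" for x
  proof (cases "x < 0")
    case True
    show ?thesis
    proof (rule DERIV_isconst_end[OF True, symmetric])
      show "continuous_on {x..0} G" by (meson dG DERIV_isCont continuous_at_imp_continuous_on)
      show "(G has_real_derivative 0) (at y)" if "x < y" "y < 0" for y
        using dG[of y] that by (simp add: bump_term_def)
    qed
  qed (use that in auto)
  have right: "G x = G 1" if "x \<ge> 1" for x
  proof (cases "x > 1")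
    case True
    show ?thesis
    proof (rule DERIV_isconst_end[OF True])
      show "continuous_on {1..x} G" by (meson dG DERIV_isCont continuous_at_imp_continuous_on)
      show "(G has_real_derivative 0) (at y)" if "1 < y" "y < x" for y
        using dG[of y] that by (simp add: bump_term_def)
    qed
  qed (use that in auto)
  have range: "G 0 \<le> G x" "G x \<le> G 1" for x
    using mono[of 0 x] left[of x] mono[of x 1] right[of x] by (cases "x \<le> 0"; cases "x \<ge> 1"; simp)+
  show thesis
  proof
    show "1 / (G 1 - G 0) > 0" using pos by simp
    show "((\<lambda>x. (G x - G 0) / (G 1 - G 0)) has_real_derivative 1 / (G 1 - G 0) * bump_term 1 0 x) (at x)" for x
      by (rule derivative_eq_intros dG refl)+ (use pos in auto)
    show "(G x - G 0) / (G 1 - G 0) = 0" if "x \<le> 0" for x using left[OF that] by simp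
    show "(G x - G 0) / (G 1 - G 0) = 1" if "x \<ge> 1" for x using right[OF that] pos by simp
    show "0 \<le> (G x - G 0) / (G 1 - G 0)" for x using range[of x] pos by simp
    show "(G x - G 0) / (G 1 - G 0) \<le> 1" for x using range[of x] pos by simp
  qed
qed

text \<open>For large \<open>k\<close> this is a smooth approximation of the indicator of the interval from \<open>\<alpha>\<close> to \<open>\<beta>\<close>, and
its derivative is the difference of approximate unit masses at the endpoints.\<close>

lemma smooth_step_difference_test_function:
  fixes H :: "real \<Rightarrow> real"
  assumes H: "\<And>x. (H has_real_derivative c * bump_term 1 0 x) (at x)"
    "\<And>x. x \<le> 0 \<Longrightarrow> H x = 0" "\<And>x. x \<ge> 1 \<Longrightarrow> H x = 1"
    and k: "k > 0" and ab: "\<alpha> \<le> \<beta>" and sub: "{\<alpha>..\<beta> + 1 / k} \<subseteq> S"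
  shows "test_function S (\<lambda>x. H (k * (x - \<alpha>)) - H (k * (x - \<beta>)))" (is "test_function S ?\<phi>")
    and "deriv (\<lambda>x. H (k * (x - \<alpha>)) - H (k * (x - \<beta>)))
       = (\<lambda>x. k * c * bump_term 1 0 (k * (x - \<alpha>)) - k * c * bump_term 1 0 (k * (x - \<beta>)))"
proof -
  define F where "F A P m B Q l x = A * bump_term P m (k * (x - \<alpha>)) + B * bump_term Q l (k * (x - \<beta>))"
    for A P m B Q l x
  define D where "D = insert ?\<phi> {F A P m B Q l |A P m B Q l. True}"
  have chain: "((\<lambda>x. bump_term P m (k * (x - \<gamma>))) has_real_derivative
      bump_term (bump_next P m) (m + 2) (k * (x - \<gamma>)) * k) (at x)" for P m \<gamma> x
    by (rule DERIV_chain2[OF bump_term_derivative]) (auto intro!: derivative_eq_intros)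
  have dF: "(F A P m B Q l has_real_derivative
      F (A * k) (bump_next P m) (m + 2) (B * k) (bump_next Q l) (l + 2) x) (at x)" for A P m B Q l x
    unfolding F_def by (rule derivative_eq_intros chain refl)+ simp
  have chainH: "((\<lambda>x. H (k * (x - \<gamma>))) has_real_derivative c * bump_term 1 0 (k * (x - \<gamma>)) * k) (at x)" for \<gamma> x
    by (rule DERIV_chain2[OF H(1)]) (auto intro!: derivative_eq_intros)
  have dphi: "(?\<phi> has_real_derivative F (k * c) 1 0 (- (k * c)) 1 0 x) (at x)" for x
    unfolding F_def by (rule derivative_eq_intros chainH refl)+ simp
  show deriv: "deriv ?\<phi> = (\<lambda>x. k * c * bump_term 1 0 (k * (x - \<alpha>)) - k * c * bump_term 1 0 (k * (x - \<beta>)))"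
    using DERIV_imp_deriv[OF dphi] by (auto simp: F_def)
  have diffF: "F A P m B Q l differentiable (at x)" for A P m B Q l x
    using dF real_differentiable_def by blast
  have derivF: "deriv (F A P m B Q l) = F (A * k) (bump_next P m) (m + 2) (B * k) (bump_next Q l) (l + 2)" for A P m B Q l
    using DERIV_imp_deriv[OF dF] by auto
  have derivphi: "deriv ?\<phi> = F (k * c) 1 0 (- (k * c)) 1 0"
    using DERIV_imp_deriv[OF dphi] by auto
  have "(deriv ^^ n) ?\<phi> differentiable (at x)" for n x
  proof (rule iterated_deriv_differentiable[of _ D])
    show "?\<phi> \<in> D" by (simp add: D_def)
    show "g differentiable (at x)" if "g \<in> D" for g x
    proof -
      from that consider "g = ?\<phi>" | A P m B Q l where "g = F A P m B Q l" unfolding D_def by blast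
      then show ?thesis
      proof cases
        case 1
        show ?thesis unfolding 1 using dphi real_differentiable_def by blast
      next
        case 2
        show ?thesis unfolding 2 by (rule diffF)
      qed
    qed
    show "deriv g \<in> D" if "g \<in> D" for g
    proof -
      from that consider "g = ?\<phi>" | A P m B Q l where "g = F A P m B Q l" unfolding D_def by blast
      then show ?thesis
      proof cases
        case 1
        show ?thesis unfolding 1 derivphi D_def by blast
      next
        case 2
        show ?thesis unfolding 2 derivF D_def by blast
      qed
    qed
  qed
  moreover have "?\<phi> x = 0" if "x \<notin> {\<alpha>..\<beta> + 1 / k}" for x
  proof (cases "x < \<alpha>")
    case True
    then have "k * (x - \<alpha>) \<le> 0" "k * (x - \<beta>) \<le> 0" using k ab by (auto simp: mult_le_0_iff)
    then show ?thesis using H(2) by simp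
  next
    case False
    with that have "x > \<beta> + 1 / k" by auto
    then have "k * (x - \<beta>) \<ge> 1" using k by (simp add: field_simps)
    moreover have "k * (x - \<alpha>) \<ge> k * (x - \<beta>)" using k ab by (intro mult_left_mono) auto
    ultimately show ?thesis using H(3) by simp
  qed
  ultimately show "test_function S ?\<phi>"
    unfolding test_function_def using sub by (intro conjI exI[of _ "{\<alpha>..\<beta> + 1 / k}"]) auto
qed

lemma smooth_step_approximates_evaluation:
  fixes H v :: "real \<Rightarrow> real"
  assumes H: "\<And>x. (H has_real_derivative c * bump_term 1 0 x) (at x)"
    "\<And>x. x \<le> 0 \<Longrightarrow> H x = 0" "\<And>x. x \<ge> 1 \<Longrightarrow> H x = 1" and c: "c > 0"
    and v: "continuous_on {\<alpha>..b} v" and \<gamma>: "\<alpha> \<le> \<gamma>" "\<gamma> < b"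
  shows "(\<lambda>n. integral {\<alpha>..b} (\<lambda>x. v x * (real n * c * bump_term 1 0 (real n * (x - \<gamma>))))) \<longlonglongrightarrow> v \<gamma>"
proof (rule LIMSEQ_I)
  fix r :: real assume r: "r > 0"
  let ?w = "\<lambda>n x. real n * c * bump_term 1 0 (real n * (x - \<gamma>))"
  have cb: "continuous_on UNIV (bump_term 1 0)"
    by (meson bump_term_derivative DERIV_isCont continuous_at_imp_continuous_on)
  have cw: "continuous_on A (?w n)" for n A
    by (intro continuous_intros continuous_on_compose2[OF cb]) auto
  have "\<gamma> \<in> {\<alpha>..b}" using \<gamma> by simp
  then obtain d where d: "d > 0" "\<And>x. x \<in> {\<alpha>..b} \<Longrightarrow> \<bar>x - \<gamma>\<bar> < d \<Longrightarrow> \<bar>v x - v \<gamma>\<bar> < r / 2"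
    using v r unfolding continuous_on_iff dist_real_def by (metis half_gt_zero)
  obtain N where N: "N > 0" "1 / real N < min d (b - \<gamma>)"
    using d(1) \<gamma>(2) by (metis nat_approx_posE diff_gt_0_iff_gt min_less_iff_conj zero_less_Suc)
  show "\<exists>N. \<forall>n\<ge>N. norm (integral {\<alpha>..b} (\<lambda>x. v x * ?w n x) - v \<gamma>) < r"
  proof (intro exI[of _ N] allI impI)
    fix n assume n: "n \<ge> N"
    have n0: "n > 0" using n N by simp
    have "1 / real n \<le> 1 / real N" using n N by (simp add: frac_le)
    with N(2) have n1: "1 / real n < d" "1 / real n < b - \<gamma>" by auto
    have w0: "?w n x \<ge> 0" for x using c by (simp add: bump_term_def)
    have "((?w n) has_integral (H (real n * (b - \<gamma>)) - H (real n * (\<alpha> - \<gamma>)))) {\<alpha>..b}"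
    proof (rule fundamental_theorem_of_calculus)
      have "((\<lambda>x. H (real n * (x - \<gamma>))) has_real_derivative c * bump_term 1 0 (real n * (x - \<gamma>)) * real n) (at x)" for x
        by (rule DERIV_chain2[OF H(1)]) (auto intro!: derivative_eq_intros)
      then show "((\<lambda>x. H (real n * (x - \<gamma>))) has_vector_derivative ?w n x) (at x within {\<alpha>..b})" for x
        unfolding has_real_derivative_iff_has_vector_derivative[symmetric]
        by (metis (no_types, lifting) has_field_derivative_at_within mult.commute mult.left_commute)
    qed (use \<gamma> in auto)
    moreover have "H (real n * (b - \<gamma>)) = 1" using n0 n1(2) by (intro H(3)) (simp add: field_simps)
    moreover have "H (real n * (\<alpha> - \<gamma>)) = 0" using \<gamma> by (intro H(2)) (simp add: mult_le_0_iff)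
    ultimately have w1: "(?w n has_integral 1) {\<alpha>..b}" by simp
    have iv: "(\<lambda>x. (v x - v \<gamma>) * ?w n x) integrable_on {\<alpha>..b}"
      by (intro integrable_continuous_real continuous_intros v cw)
    have "integral {\<alpha>..b} (\<lambda>x. v x * ?w n x) - v \<gamma> = integral {\<alpha>..b} (\<lambda>x. v x * ?w n x) - v \<gamma> * integral {\<alpha>..b} (?w n)"
      using integral_unique[OF w1] by simp
    also have "\<dots> = integral {\<alpha>..b} (\<lambda>x. v x * ?w n x) - integral {\<alpha>..b} (\<lambda>x. v \<gamma> * ?w n x)"
      by simp
    also have "\<dots> = integral {\<alpha>..b} (\<lambda>x. v x * ?w n x - v \<gamma> * ?w n x)"
      by (intro Henstock_Kurzweil_Integration.integral_diff[symmetric] integrable_continuous_real continuous_intros v cw)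
    also have "\<dots> = integral {\<alpha>..b} (\<lambda>x. (v x - v \<gamma>) * ?w n x)"
      by (simp only: left_diff_distrib)
    also have "norm \<dots> \<le> integral {\<alpha>..b} (\<lambda>x. r / 2 * ?w n x)"
    proof (rule integral_norm_bound_integral[OF iv])
      show "(\<lambda>x. r / 2 * ?w n x) integrable_on {\<alpha>..b}"
        by (intro integrable_continuous_real continuous_intros cw)
      fix x assume x: "x \<in> {\<alpha>..b}"
      show "norm ((v x - v \<gamma>) * ?w n x) \<le> r / 2 * ?w n x"
      proof (cases "?w n x = 0")
        case False
        then have "0 < real n * (x - \<gamma>)" "real n * (x - \<gamma>) < 1" by (auto simp: bump_term_def split: if_splits)
        then have "x - \<gamma> > 0" "x - \<gamma> < 1 / real n" using n0 by (auto simp: zero_less_mult_iff field_simps)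
        with n1(1) have "\<bar>x - \<gamma>\<bar> < d" by auto
        from d(2)[OF x this] show ?thesis
          using w0[of x] unfolding real_norm_def abs_mult[of "v x - v \<gamma>"] abs_of_nonneg[OF w0]
          by (intro mult_right_mono) auto
      qed (simp only: mult_zero_right norm_zero)
    qed
    also have "\<dots> = r / 2" using integral_unique[OF w1] by simp
    finally show "norm (integral {\<alpha>..b} (\<lambda>x. v x * ?w n x) - v \<gamma>) < r" using r by simp
  qed
qed

lemma L2_on_integrable:
  assumes f: "f \<in> L2_on S" and S: "S \<in> lmeasurable"
  shows "set_integrable lebesgue S f"
proof -
  have [measurable]: "S \<in> sets lebesgue" using S by auto
  have m: "(\<lambda>x. indicator S x *\<^sub>R f x) \<in> borel_measurable lebesgue"
    using f by (simp add: L2_on_def set_borel_measurable_def)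
  have i: "integrable lebesgue (\<lambda>x. indicator S x *\<^sub>R (f x)\<^sup>2)"
    using f by (simp add: L2_on_def set_integrable_def)
  have "integrable lebesgue (\<lambda>x. indicator S x + indicator S x *\<^sub>R (f x)\<^sup>2)"
    using S i by (intro Bochner_Integration.integrable_add) (auto simp: fmeasurable_def)
  then show ?thesis unfolding set_integrable_def
    by (rule Bochner_Integration.integrable_bound)
       (use m in \<open>auto simp: indicator_def intro!: AE_I2 abs_le_one_plus_square\<close>)
qed

text \<open>Cauchy-Schwarz against the indicator, from the fact that the mean square deviation of \<open>\<bar>f x\<bar>\<close> from
a constant \<open>c\<close> is a nonnegative quadratic polynomial in \<open>c\<close>.\<close>

lemma L2_on_abs_integral_le:
  assumes f: "f \<in> L2_on S" and S: "S \<in> lmeasurable"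
  shows "(LINT x:S|lebesgue. \<bar>f x\<bar>) \<le> sqrt (measure lebesgue S) * L2_norm_on S f"
proof -
  define I where "I = (LINT x:S|lebesgue. \<bar>f x\<bar>)"
  define Q where "Q = (LINT x:S|lebesgue. (f x)\<^sup>2)"
  define m where "m = measure lebesgue S"
  have if1: "set_integrable lebesgue S (\<lambda>x. \<bar>f x\<bar>)"
    using L2_on_integrable[OF f S] by (rule set_integrable_abs)
  have if2: "set_integrable lebesgue S (\<lambda>x. (f x)\<^sup>2)"
    using f by (simp add: L2_on_def)
  have ic: "set_integrable lebesgue S (\<lambda>x. c)" for c :: real
    using S unfolding set_integrable_def by (auto simp: fmeasurable_def)
  have I0: "I \<ge> 0" and Q0: "Q \<ge> 0" and m0: "m \<ge> 0"
    unfolding I_def Q_def m_def set_lebesgue_integral_def by (auto intro!: Bochner_Integration.integral_nonneg)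
  have quad: "0 \<le> Q - 2 * c * I + c\<^sup>2 * m" for c
  proof -
    have "0 \<le> (LINT x:S|lebesgue. (\<bar>f x\<bar> - c)\<^sup>2)"
      unfolding set_lebesgue_integral_def by (rule Bochner_Integration.integral_nonneg) (auto simp: indicator_def)
    also have "(LINT x:S|lebesgue. (\<bar>f x\<bar> - c)\<^sup>2) = (LINT x:S|lebesgue. ((f x)\<^sup>2 - (2 * c) * \<bar>f x\<bar>) + c\<^sup>2)"
      by (simp add: power2_diff algebra_simps)
    also have "\<dots> = Q - 2 * c * I + (LINT x:S|lebesgue. c\<^sup>2)"
      using if1 if2 unfolding Q_def I_def by (simp add: set_integral_add set_integral_diff ic)
    also have "(LINT x:S|lebesgue. c\<^sup>2) = c\<^sup>2 * m"
      using S unfolding m_def set_lebesgue_integral_def by (simp add: fmeasurable_def)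
    finally show ?thesis .
  qed
  have "I\<^sup>2 \<le> m * Q"
  proof (cases "m = 0")
    case True
    have "I = 0"
    proof (rule ccontr)
      assume "I \<noteq> 0"
      then show False using quad[of "(Q + 1) / (2 * I)"] True by (simp add: field_simps)
    qed
    then show ?thesis using True by simp
  next
    case False
    then show ?thesis using quad[of "I / m"] m0 by (simp add: field_simps power2_eq_square)
  qed
  then have "I \<le> sqrt (m * Q)" by (rule real_le_rsqrt)
  then show ?thesis by (simp add: I_def Q_def m_def L2_norm_on_def real_sqrt_mult)
qed

text \<open>The lemma of du Bois-Reymond. Testing the weak derivative with smooth approximations of the indicator
of the interval gives the increment of \<open>v\<close> on one side and the integral of \<open>g\<close> on the other. The
approximations live on a slightly longer interval, for which the open set leaves room.\<close>

lemma weak_deriv_imp_integral: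
  fixes v g :: "real \<Rightarrow> real"
  assumes w: "has_weak_deriv_on v g S" and S: "open S" and v: "continuous_on S v"
    and ab: "\<alpha> \<le> \<beta>" "{\<alpha>..\<beta>} \<subseteq> S"
  shows "v \<beta> - v \<alpha> = (LINT x:{\<alpha>..\<beta>}|lebesgue. g x)"
proof -
  obtain c H where c: "c > 0" and H: "\<And>x. (H has_real_derivative c * bump_term 1 0 x) (at x)"
    "\<And>x. x \<le> 0 \<Longrightarrow> H x = 0" "\<And>x. x \<ge> 1 \<Longrightarrow> H x = 1" "\<And>x. 0 \<le> H x" "\<And>x. H x \<le> 1"
    using smooth_step_exists by metis
  have "\<beta> \<in> S" using ab by auto
  then obtain e where e: "e > 0" "ball \<beta> e \<subseteq> S" using S open_contains_ball by blast
  define b where "b = \<beta> + e / 2"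
  have b: "b > \<beta>" using e by (simp add: b_def)
  have bS: "{\<alpha>..b} \<subseteq> S"
  proof
    fix x assume x: "x \<in> {\<alpha>..b}"
    show "x \<in> S"
    proof (cases "x \<le> \<beta>")
      case False
      with x e have "x \<in> ball \<beta> e" by (auto simp: b_def dist_real_def)
      then show ?thesis using e by auto
    qed (use x ab in auto)
  qed
  have vc: "continuous_on {\<alpha>..b} v" by (rule continuous_on_subset[OF v bS])
  have gi: "set_integrable lebesgue {\<alpha>..b} g"
    using w bS unfolding has_weak_deriv_on_def by (meson compact_Icc)
  define \<phi> where "\<phi> n x = H (real n * (x - \<alpha>)) - H (real n * (x - \<beta>))" for n x
  have cb: "continuous_on UNIV (bump_term 1 0)"
    by (meson bump_term_derivative DERIV_isCont continuous_at_imp_continuous_on)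
  have cH: "continuous_on UNIV H"
    by (meson H(1) DERIV_isCont continuous_at_imp_continuous_on)
  have c\<phi>: "continuous_on UNIV (\<phi> n)" for n
    unfolding \<phi>_def by (intro continuous_intros continuous_on_compose2[OF cH]) auto
  obtain N where N: "N > 0" "1 / real N < b - \<beta>"
    using b by (metis nat_approx_posE diff_gt_0_iff_gt zero_less_Suc)
  have key: "(LINT x:{\<alpha>..b}|lebesgue. g x * \<phi> n x) =
      integral {\<alpha>..b} (\<lambda>x. v x * (real n * c * bump_term 1 0 (real n * (x - \<beta>))))
      - integral {\<alpha>..b} (\<lambda>x. v x * (real n * c * bump_term 1 0 (real n * (x - \<alpha>))))" if n: "n \<ge> N" for n
  proof -
    have n0: "real n > 0" using n N by simp
    have "1 / real n \<le> 1 / real N" using n N by (simp add: frac_le)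
    then have nb: "\<beta> + 1 / real n \<le> b" using N(2) by simp
    then have sub: "{\<alpha>..\<beta> + 1 / real n} \<subseteq> S" using bS by auto
    note T = smooth_step_difference_test_function[OF H(1-3) n0 ab(1) sub]
    have d: "deriv (\<phi> n) = (\<lambda>x. real n * c * bump_term 1 0 (real n * (x - \<alpha>)) - real n * c * bump_term 1 0 (real n * (x - \<beta>)))"
      using T(2) by (simp add: \<phi>_def[abs_def])
    have zero: "\<phi> n x = 0" "deriv (\<phi> n) x = 0" if "x \<notin> {\<alpha>..b}" for x
    proof -
      have "real n * (x - \<alpha>) \<le> 0 \<and> real n * (x - \<beta>) \<le> 0 \<or> real n * (x - \<alpha>) \<ge> 1 \<and> real n * (x - \<beta>) \<ge> 1"
      proof (cases "x < \<alpha>")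
        case True
        then show ?thesis using n0 ab by (auto simp: mult_le_0_iff)
      next
        case False
        with that nb have "x - \<beta> \<ge> 1 / real n" by auto
        then have "real n * (x - \<beta>) \<ge> 1" using n0 by (simp add: field_simps)
        moreover have "real n * (x - \<alpha>) \<ge> real n * (x - \<beta>)" using n0 ab by (intro mult_left_mono) auto
        ultimately show ?thesis by simp
      qed
      then show "\<phi> n x = 0" "deriv (\<phi> n) x = 0"
        unfolding d using H(2,3) by (auto simp: \<phi>_def bump_term_def)
    qed
    have "test_function S (\<phi> n)" using T(1) by (simp add: \<phi>_def[abs_def])
    then have "(LINT x:S|lebesgue. v x * deriv (\<phi> n) x) = - (LINT x:S|lebesgue. g x * \<phi> n x)"
      using w unfolding has_weak_deriv_on_def by blast
    moreover have "(LINT x:S|lebesgue. v x * deriv (\<phi> n) x) = (LINT x:{\<alpha>..b}|lebesgue. v x * deriv (\<phi> n) x)"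
      unfolding set_lebesgue_integral_def using bS zero
      by (intro Bochner_Integration.integral_cong) (auto simp: indicator_def)
    moreover have "(LINT x:S|lebesgue. g x * \<phi> n x) = (LINT x:{\<alpha>..b}|lebesgue. g x * \<phi> n x)"
      unfolding set_lebesgue_integral_def using bS zero
      by (intro Bochner_Integration.integral_cong) (auto simp: indicator_def)
    moreover have "(LINT x:{\<alpha>..b}|lebesgue. v x * deriv (\<phi> n) x) = integral {\<alpha>..b} (\<lambda>x. v x * deriv (\<phi> n) x)"
    proof (rule set_lebesgue_integral_eq_integral(2))
      have "continuous_on {\<alpha>..b} (\<lambda>x. v x * deriv (\<phi> n) x)"
        unfolding d by (intro continuous_intros vc continuous_on_compose2[OF cb]) auto
      then show "set_integrable lebesgue {\<alpha>..b} (\<lambda>x. v x * deriv (\<phi> n) x)"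
        by (rule absolutely_integrable_continuous_real)
    qed
    moreover have "integral {\<alpha>..b} (\<lambda>x. v x * deriv (\<phi> n) x) =
       integral {\<alpha>..b} (\<lambda>x. v x * (real n * c * bump_term 1 0 (real n * (x - \<alpha>))))
       - integral {\<alpha>..b} (\<lambda>x. v x * (real n * c * bump_term 1 0 (real n * (x - \<beta>))))"
      unfolding d right_diff_distrib
      by (rule Henstock_Kurzweil_Integration.integral_diff)
         (auto intro!: integrable_continuous_real continuous_intros vc continuous_on_compose2[OF cb])
    ultimately show ?thesis by linarith
  qed
  have lim1: "(\<lambda>n. integral {\<alpha>..b} (\<lambda>x. v x * (real n * c * bump_term 1 0 (real n * (x - \<beta>))))
      - integral {\<alpha>..b} (\<lambda>x. v x * (real n * c * bump_term 1 0 (real n * (x - \<alpha>))))) \<longlonglongrightarrow> v \<beta> - v \<alpha>"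
    using ab(1) b by (intro tendsto_diff smooth_step_approximates_evaluation[OF H(1-3) c vc]) auto
  have lim2: "(\<lambda>n. LINT x:{\<alpha>..b}|lebesgue. g x * \<phi> n x) \<longlonglongrightarrow> (LINT x:{\<alpha>..\<beta>}|lebesgue. g x)"
    unfolding set_lebesgue_integral_def
  proof (rule integral_dominated_convergence[where w = "\<lambda>x. \<bar>indicator {\<alpha>..b} x *\<^sub>R g x\<bar>"])
    have gm: "(\<lambda>x. indicator {\<alpha>..b} x *\<^sub>R g x) \<in> borel_measurable lebesgue"
      using gi unfolding set_integrable_def by auto
    have "set_integrable lebesgue {\<alpha>..\<beta>} g"
      by (rule set_integrable_subset[OF gi]) (use b in auto)
    then show "(\<lambda>x. indicator {\<alpha>..\<beta>} x *\<^sub>R g x) \<in> borel_measurable lebesgue"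
      unfolding set_integrable_def by auto
    show "(\<lambda>x. indicator {\<alpha>..b} x *\<^sub>R (g x * \<phi> n x)) \<in> borel_measurable lebesgue" for n
    proof -
      have "\<phi> n \<in> borel_measurable lebesgue"
        using borel_measurable_continuous_onI[OF c\<phi>] by (intro measurable_completion) auto
      with gm have "(\<lambda>x. (indicator {\<alpha>..b} x *\<^sub>R g x) * \<phi> n x) \<in> borel_measurable lebesgue" by auto
      then show ?thesis by (simp add: mult.assoc)
    qed
    show "integrable lebesgue (\<lambda>x. \<bar>indicator {\<alpha>..b} x *\<^sub>R g x\<bar>)"
      using gi unfolding set_integrable_def by (rule integrable_abs)
    show "AE x in lebesgue. norm (indicator {\<alpha>..b} x *\<^sub>R (g x * \<phi> n x)) \<le> \<bar>indicator {\<alpha>..b} x *\<^sub>R g x\<bar>" for n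
    proof (rule AE_I2)
      fix x
      have "\<bar>\<phi> n x\<bar> \<le> 1" using H(4,5)[of "real n * (x - \<alpha>)"] H(4,5)[of "real n * (x - \<beta>)"]
        unfolding \<phi>_def by linarith
      then show "norm (indicator {\<alpha>..b} x *\<^sub>R (g x * \<phi> n x)) \<le> \<bar>indicator {\<alpha>..b} x *\<^sub>R g x\<bar>"
        by (auto simp: abs_mult indicator_def mult_left_le)
    qed
    have "AE x in lebesgue. x \<noteq> \<alpha>"
      using AE_lborel_singleton[of \<alpha>] by (rule AE_completion)
    then show "AE x in lebesgue. (\<lambda>n. indicator {\<alpha>..b} x *\<^sub>R (g x * \<phi> n x)) \<longlonglongrightarrow> indicator {\<alpha>..\<beta>} x *\<^sub>R g x"
    proof (rule AE_mp, intro AE_I2 impI)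
      fix x :: real assume x: "x \<noteq> \<alpha>"
      have ev1: "eventually (\<lambda>n. H (real n * (x - \<gamma>)) = 1) sequentially" if "x > \<gamma>" for \<gamma>
      proof -
        have "filterlim (\<lambda>n. (x - \<gamma>) * real n) at_top sequentially"
          by (rule filterlim_tendsto_pos_mult_at_top[OF tendsto_const _ filterlim_real_sequentially]) (use that in simp)
        then have "eventually (\<lambda>n. real n * (x - \<gamma>) \<ge> 1) sequentially" by (simp add: filterlim_at_top mult.commute)
        then show ?thesis by eventually_elim (use H(3) in auto)
      qed
      have H0: "H (real n * (x - \<gamma>)) = 0" if "x \<le> \<gamma>" for n \<gamma>
        using that by (intro H(2)) (simp add: mult_le_0_iff)
      have "eventually (\<lambda>n. indicator {\<alpha>..b} x *\<^sub>R (g x * \<phi> n x) = indicator {\<alpha>..\<beta>} x *\<^sub>R g x) sequentially"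
      proof -
        consider "x < \<alpha>" | "\<alpha> < x" "x \<le> \<beta>" | "x > \<beta>" using x by linarith
        then show ?thesis
        proof cases
          case 1
          then show ?thesis by simp
        next
          case 2
          from ev1[OF 2(1)] show ?thesis by eventually_elim (use 2 b H0 in \<open>auto simp: \<phi>_def\<close>)
        next
          case 3
          have "x > \<alpha>" using 3 ab(1) by simp
          from ev1[OF 3] ev1[OF this] show ?thesis
            by eventually_elim (use 3 in \<open>auto simp: \<phi>_def\<close>)
        qed
      qed
      then show "(\<lambda>n. indicator {\<alpha>..b} x *\<^sub>R (g x * \<phi> n x)) \<longlonglongrightarrow> indicator {\<alpha>..\<beta>} x *\<^sub>R g x"
        by (rule tendsto_eventually)
    qed
  qed
  have "eventually (\<lambda>n. (LINT x:{\<alpha>..b}|lebesgue. g x * \<phi> n x) =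
      integral {\<alpha>..b} (\<lambda>x. v x * (real n * c * bump_term 1 0 (real n * (x - \<beta>))))
      - integral {\<alpha>..b} (\<lambda>x. v x * (real n * c * bump_term 1 0 (real n * (x - \<alpha>))))) sequentially"
    using key by (auto simp: eventually_sequentially)
  from tendsto_cong[OF this] lim2 have
    "(\<lambda>n. integral {\<alpha>..b} (\<lambda>x. v x * (real n * c * bump_term 1 0 (real n * (x - \<beta>))))
      - integral {\<alpha>..b} (\<lambda>x. v x * (real n * c * bump_term 1 0 (real n * (x - \<alpha>))))) \<longlonglongrightarrow> (LINT x:{\<alpha>..\<beta>}|lebesgue. g x)"
    by blast
  from LIMSEQ_unique[OF lim1 this] show ?thesis .
qed

lemma L2_loc_cong_le:
  assumes "p \<in> borel_measurable borel" "\<And>a b. set_integrable lborel {a..b} k" "\<And>x. (p x)\<^sup>2 \<le> k x"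
  shows "L2_loc p"
  unfolding L2_loc_def
proof (intro conjI allI)
  show "set_integrable lborel {a..b} (\<lambda>x. (p x)\<^sup>2)" for a b
    by (rule set_integrable_bound_Icc[OF _ assms(2)]) (use assms(1,3) in auto)
qed (rule assms(1))

lemma L2_loc_cmult: "L2_loc p \<Longrightarrow> L2_loc (\<lambda>x. c * p x)"
  unfolding L2_loc_def by (auto simp: power_mult_distrib)

lemma L2_loc_add:
  assumes p: "L2_loc p" and q: "L2_loc q"
  shows "L2_loc (\<lambda>x. p x + q x)"
proof (rule L2_loc_cong_le)
  show "(\<lambda>x. p x + q x) \<in> borel_measurable borel"
    using p q by (auto simp: L2_loc_def)
  show "set_integrable lborel {a..b} (\<lambda>x. 2 * (p x)\<^sup>2 + 2 * (q x)\<^sup>2)" for a b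
    using L2_loc_square[OF p] L2_loc_square[OF q] by (intro set_integral_add) auto
  show "(p x + q x)\<^sup>2 \<le> 2 * (p x)\<^sup>2 + 2 * (q x)\<^sup>2" for x
    using zero_le_power2[of "p x - q x"] by (simp add: power2_eq_square algebra_simps)
qed

lemma L2_loc_diff:
  assumes p: "L2_loc p" and q: "L2_loc q"
  shows "L2_loc (\<lambda>x. p x - q x)"
  using L2_loc_add[OF p L2_loc_cmult[OF q, of "-1"]] by simp

lemma L2_loc_shift:
  assumes p: "L2_loc p"
  shows "L2_loc (\<lambda>x. p (x + h))"
  unfolding L2_loc_def
proof (intro conjI allI)
  note [measurable] = L2_loc_measurable[OF p]
  show "(\<lambda>x. p (x + h)) \<in> borel_measurable borel" by measurable
  show "set_integrable lborel {a..b} (\<lambda>x. (p (x + h))\<^sup>2)" for a b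
    using integrable_shift[OF L2_loc_square[OF p, of "a + h" "b + h", unfolded set_integrable_def], of h]
    by (simp add: set_integrable_def indicator_def)
qed

lemma L2_loc_continuous:
  assumes p: "continuous_on UNIV p"
  shows "L2_loc p"
  unfolding L2_loc_def
  using borel_measurable_continuous_onI[OF p]
  by (auto intro!: borel_integrable_atLeastAtMost' continuous_intros continuous_on_subset[OF p])

lemma L2_loc_integrable_on: "L2_loc p \<Longrightarrow> p integrable_on {a..b}"
  using set_borel_integral_eq_integral(1)[OF L2_loc_integrable] .

lemma primitive_shift:
  assumes \<phi>: "primitive \<phi> p" and p: "L2_loc p"
  shows "primitive (\<lambda>x. \<phi> (x + h)) (\<lambda>x. p (x + h))"
  unfolding primitive_def
proof (intro allI impI)
  fix \<alpha> \<beta> :: real assume le: "\<alpha> \<le> \<beta>"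
  have "(p has_integral (\<phi> (\<beta> + h) - \<phi> (\<alpha> + h))) (cbox (\<alpha> + h) (\<beta> + h))"
    using \<phi> le L2_loc_integrable_on[OF p, of "\<alpha> + h" "\<beta> + h"] by (auto simp: primitive_def has_integral_integral)
  from has_integral_affinity[OF this, of 1 h]
  have "((\<lambda>x. p (x + h)) has_integral (\<phi> (\<beta> + h) - \<phi> (\<alpha> + h))) ((\<lambda>x. x + - h) ` {\<alpha> + h..\<beta> + h})"
    by simp
  also have "(\<lambda>x. x + - h) ` {\<alpha> + h..\<beta> + h} = {\<alpha>..\<beta>}"
    by (subst image_add_atLeastAtMost') simp
  finally show "\<phi> (\<beta> + h) - \<phi> (\<alpha> + h) = integral {\<alpha>..\<beta>} (\<lambda>x. p (x + h))"
    by (simp add: integral_unique)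
qed

lemma primitive_add:
  assumes "primitive \<phi> p" "primitive \<psi> q" "L2_loc p" "L2_loc q"
  shows "primitive (\<lambda>x. \<phi> x + \<psi> x) (\<lambda>x. p x + q x)"
  using assms by (auto simp: primitive_def Henstock_Kurzweil_Integration.integral_add L2_loc_integrable_on algebra_simps)

lemma primitive_cmult:
  assumes "primitive \<phi> p"
  shows "primitive (\<lambda>x. c * \<phi> x) (\<lambda>x. c * p x)"
  using assms by (simp add: primitive_def flip: right_diff_distrib)

lemma primitive_of_derivative:
  assumes "\<And>x. (\<phi> has_real_derivative p x) (at x)"
  shows "primitive \<phi> p"
  unfolding primitive_def
proof (intro allI impI)
  fix \<alpha> \<beta> :: real assume "\<alpha> \<le> \<beta>"
  then have "(p has_integral (\<phi> \<beta> - \<phi> \<alpha>)) {\<alpha>..\<beta>}"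
    using assms by (intro fundamental_theorem_of_calculus)
      (auto intro: has_field_derivative_at_within simp flip: has_real_derivative_iff_has_vector_derivative)
  then show "\<phi> \<beta> - \<phi> \<alpha> = integral {\<alpha>..\<beta>} p" by (simp add: integral_unique)
qed

lemma primitive_continuous:
  assumes p: "L2_loc p" and \<phi>: "primitive \<phi> p"
  shows "continuous_on UNIV \<phi>"
proof -
  have "isCont \<phi> x" for x
  proof -
    have "continuous_on {x - 1..x + 1} (\<lambda>y. integral {x - 1..y} p + \<phi> (x - 1))"
      by (intro continuous_intros indefinite_integral_continuous_1 L2_loc_integrable_on p)
    moreover have "integral {x - 1..y} p + \<phi> (x - 1) = \<phi> y" if "y \<in> {x - 1..x + 1}" for y
      using \<phi> that by (simp add: primitive_def flip: \<phi>[unfolded primitive_def, rule_format])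
    ultimately have "continuous_on {x - 1..x + 1} \<phi>" by (rule continuous_on_eq)
    then show "isCont \<phi> x" by (rule continuous_on_interior) simp
  qed
  then show ?thesis by (simp add: continuous_at_imp_continuous_on)
qed

lemma set_integrable_lebesgue_of_lborel:
  fixes f :: "real \<Rightarrow> real"
  assumes f: "set_integrable lborel S f"
  shows "set_integrable lebesgue S f"
proof -
  have "(\<lambda>x. indicator S x *\<^sub>R f x) \<in> borel_measurable lborel"
    using f unfolding set_integrable_def by (rule borel_measurable_integrable)
  from integrable_completion[OF this] f show ?thesis by (simp add: set_integrable_def)
qed

lemma L2_loc_imp_L2_on:
  assumes p: "L2_loc p"
  shows "p \<in> L2_on (ball x r)"
proof -
  note [measurable] = L2_loc_measurable[OF p]
  have [measurable]: "ball x r \<in> sets borel" by simp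
  have "(\<lambda>y. indicator (ball x r) y *\<^sub>R p y) \<in> borel_measurable lborel" by simp
  then have 1: "set_borel_measurable lebesgue (ball x r) p"
    unfolding set_borel_measurable_def by (rule measurable_completion)
  have "set_integrable lebesgue {x - r..x + r} (\<lambda>x. (p x)\<^sup>2)"
    by (rule set_integrable_lebesgue_of_lborel[OF L2_loc_square[OF p]])
  then have "set_integrable lebesgue (ball x r) (\<lambda>x. (p x)\<^sup>2)"
    by (rule set_integrable_subset) (auto simp: dist_real_def)
  with 1 show ?thesis by (simp add: L2_on_def)
qed

lemma L2_norm_on_le:
  assumes f: "f \<in> borel_measurable borel" and e: "e \<ge> 0"
    and le: "(\<integral>\<^sup>+x. ennreal (indicator {a..b} x * (f x)\<^sup>2) \<partial>lborel) \<le> ennreal (e\<^sup>2)"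
    and S: "S \<subseteq> {a..b}" "S \<in> sets borel"
  shows "L2_norm_on S f \<le> e"
proof -
  note [measurable] = f S(2)
  have "(LINT x:S|lebesgue. (f x)\<^sup>2) = (\<integral>x. indicator S x * (f x)\<^sup>2 \<partial>lborel)"
    unfolding set_lebesgue_integral_def by (subst integral_completion) auto
  also have "\<dots> = enn2real (\<integral>\<^sup>+x. ennreal (indicator S x * (f x)\<^sup>2) \<partial>lborel)"
    by (rule integral_eq_nn_integral) auto
  also have "\<dots> \<le> enn2real (ennreal (e\<^sup>2))"
  proof (rule enn2real_mono)
    have "(\<integral>\<^sup>+x. ennreal (indicator S x * (f x)\<^sup>2) \<partial>lborel) \<le> (\<integral>\<^sup>+x. ennreal (indicator {a..b} x * (f x)\<^sup>2) \<partial>lborel)"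
      using S(1) by (intro nn_integral_mono ennreal_leI) (auto simp: indicator_def)
    also note le
    finally show "(\<integral>\<^sup>+x. ennreal (indicator S x * (f x)\<^sup>2) \<partial>lborel) \<le> ennreal (e\<^sup>2)" .
  qed simp
  finally have "(LINT x:S|lebesgue. (f x)\<^sup>2) \<le> e\<^sup>2" by simp
  then show ?thesis unfolding L2_norm_on_def using e by (intro real_le_lsqrt) auto
qed

lemma integrable_continuous_support:
  fixes f :: "real \<Rightarrow> real"
  assumes "continuous_on UNIV f" "\<And>x. x \<notin> {a..b} \<Longrightarrow> f x = 0"
  shows "integrable lborel f"
proof -
  have "set_integrable lborel {a..b} f"
    by (intro borel_integrable_atLeastAtMost' continuous_on_subset[OF assms(1)]) auto
  moreover have "(\<lambda>x. indicator {a..b} x *\<^sub>R f x) = f"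
    using assms(2) by (auto simp: indicator_def fun_eq_iff)
  ultimately show ?thesis by (simp add: set_integrable_def)
qed

lemma deriv_zero_outside_support:
  fixes \<phi> :: "real \<Rightarrow> real"
  assumes "compact K" "\<And>x. x \<notin> K \<Longrightarrow> \<phi> x = 0" "x \<notin> K"
  shows "deriv \<phi> x = 0"
proof -
  have "((\<lambda>x. 0) has_real_derivative 0) (at x)" by simp
  then have "(\<phi> has_real_derivative 0) (at x)"
    by (rule has_field_derivative_transform_within_open[of _ _ _ "-K"])
       (use assms compact_imp_closed[OF assms(1)] in auto)
  then show ?thesis by (rule DERIV_imp_deriv)
qed

text \<open>Integration by parts without a pointwise derivative of \<open>v\<close>. The integral of \<open>v x * \<phi> x\<close> is invariant
under translation by \<open>h\<close>; expanding the difference as a discrete product rule, dividing by \<open>h\<close> and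
letting \<open>h\<close> tend to zero gives the claim, since the difference quotients of \<open>v\<close> converge to \<open>g\<close> in mean
square, and those of \<open>\<phi>\<close> converge pointwise and are uniformly bounded.\<close>

lemma primitive_has_weak_deriv:
  assumes g: "L2_loc g" and v: "primitive v g" and S: "open S"
  shows "has_weak_deriv_on v g S"
proof -
  note [measurable] = L2_loc_measurable[OF g]
  have cv: "continuous_on UNIV v" by (rule primitive_continuous[OF g v])
  have [measurable]: "v \<in> borel_measurable borel" by (rule borel_measurable_continuous_onI[OF cv])
  have loc: "set_integrable lebesgue K p" if cK: "compact K" and p: "L2_loc p" for K and p :: "real \<Rightarrow> real"
  proof -
    obtain M where "\<forall>x\<in>K. norm x \<le> M" using compact_imp_bounded[OF cK] unfolding bounded_iff by auto
    then have "K \<subseteq> {-M..M}" by (auto simp: abs_le_iff minus_le_iff)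
    moreover have "K \<in> sets lebesgue" using borel_compact[OF cK] by simp
    ultimately show ?thesis
      using set_integrable_subset[OF set_integrable_lebesgue_of_lborel[OF L2_loc_integrable[OF p]]] by blast
  qed
  have main: "(LINT x:S|lebesgue. v x * deriv \<phi> x) = - (LINT x:S|lebesgue. g x * \<phi> x)" if T: "test_function S \<phi>" for \<phi>
  proof -
    obtain K where K: "compact K" "K \<subseteq> S" "\<And>x. x \<notin> K \<Longrightarrow> \<phi> x = 0"
      using T unfolding test_function_def by blast
    have "(deriv ^^ 0) \<phi> differentiable (at x)" "(deriv ^^ 1) \<phi> differentiable (at x)" for x
      using T unfolding test_function_def by blast+
    then have d\<phi>: "(\<phi> has_real_derivative deriv \<phi> x) (at x)" and dd: "deriv \<phi> differentiable (at x)" for x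
      by (auto simp: DERIV_deriv_iff_real_differentiable)
    have c\<phi>: "continuous_on UNIV \<phi>" by (meson d\<phi> DERIV_isCont continuous_at_imp_continuous_on)
    have cd: "continuous_on UNIV (deriv \<phi>)"
      by (meson dd differentiable_imp_continuous_within continuous_at_imp_continuous_on)
    have d0: "deriv \<phi> x = 0" if "x \<notin> K" for x
      by (rule deriv_zero_outside_support[OF K(1,3) that])
    obtain M0 where "\<forall>x\<in>K. norm x \<le> M0" using compact_imp_bounded[OF K(1)] unfolding bounded_iff by auto
    then have KM: "K \<subseteq> {-M0..M0}" by (auto simp: abs_le_iff minus_le_iff)
    define a b where "a = - \<bar>M0\<bar> - 1" and "b = \<bar>M0\<bar> + 1"
    have ab: "a \<le> b" by (simp add: a_def b_def)
    have K1: "x \<notin> K" "x + h \<notin> K" if "x \<notin> {a..b}" "\<bar>h\<bar> \<le> 1" for x h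
      using KM that by (auto simp: a_def b_def)
    have bdd: "\<exists>B\<ge>0. \<forall>x\<in>{c..d}. \<bar>f x\<bar> \<le> B" if "continuous_on UNIV f" for f :: "real \<Rightarrow> real" and c d
    proof -
      have "compact (f ` {c..d})" by (intro compact_continuous_image continuous_on_subset[OF that]) auto
      then have "bounded (f ` {c..d})" by (rule compact_imp_bounded)
      then obtain B where "\<forall>x\<in>{c..d}. \<bar>f x\<bar> \<le> B" unfolding bounded_iff by auto
      then show ?thesis by (intro exI[of _ "\<bar>B\<bar>"]) auto
    qed
    obtain B where B0: "B \<ge> 0" "\<forall>x\<in>{a..b}. \<bar>\<phi> x\<bar> \<le> B"
      using bdd[OF c\<phi>, of a b] by (elim exE conjE)
    have B: "B \<ge> 0" "\<bar>\<phi> x\<bar> \<le> B" for x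
      using B0 K1(1)[of x 0] K(3)[of x] by (cases "x \<in> {a..b}"; simp)+
    obtain L where L0: "L \<ge> 0" "\<forall>x\<in>{a..b}. \<bar>deriv \<phi> x\<bar> \<le> L"
      using bdd[OF cd, of a b] by (elim exE conjE)
    have L: "L \<ge> 0" "\<bar>deriv \<phi> x\<bar> \<le> L" for x
      using L0 K1(1)[of x 0] d0[of x] by (cases "x \<in> {a..b}"; simp)+
    obtain V where V: "V \<ge> 0" "\<And>x. x \<in> {a-1..b+1} \<Longrightarrow> \<bar>v x\<bar> \<le> V"
      using bdd[OF cv, of "a-1" "b+1"] by (elim exE conjE) simp
    have [measurable]: "\<phi> \<in> borel_measurable borel" "deriv \<phi> \<in> borel_measurable borel"
      using borel_measurable_continuous_onI[OF c\<phi>] borel_measurable_continuous_onI[OF cd] by auto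
    define h where "h n = 1 / real (Suc n)" for n
    have h: "h n > 0" "h n \<le> 1" for n by (auto simp: h_def)
    have hlim: "h \<longlonglongrightarrow> 0" unfolding h_def by (rule LIMSEQ_Suc[OF lim_1_over_n])
    let ?A = "\<lambda>n x. v (x + h n) * ((\<phi> (x + h n) - \<phi> x) / h n)"
    let ?D = "\<lambda>n x. (v (x + h n) - v x) / h n"
    have cs: "continuous_on UNIV (\<lambda>x. f (x + c))" if "continuous_on UNIV f" for f :: "real \<Rightarrow> real" and c
      by (rule continuous_on_compose2[OF that]) (auto intro!: continuous_intros)
    have out: "\<phi> x = 0" "\<phi> (x + h n) = 0" if "x \<notin> {a..b}" for x n
      using K1[OF that, of 0] K1[OF that, of "h n"] h[of n] K(3) by auto
    have hn: "h n \<noteq> 0" for n using h(1)[of n] by simp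
    have iA: "integrable lborel (?A n)" for n
    proof (rule integrable_continuous_support[of _ a b])
      show "continuous_on UNIV (?A n)" by (intro continuous_intros cs[OF cv] cs[OF c\<phi>] c\<phi>) (simp add: hn)
    qed (simp add: out)
    have iD: "integrable lborel (\<lambda>x. \<phi> x * ?D n x)" for n
    proof (rule integrable_continuous_support[of _ a b])
      show "continuous_on UNIV (\<lambda>x. \<phi> x * ?D n x)" by (intro continuous_intros cs[OF cv] c\<phi> cv) (simp add: hn)
    qed (simp add: out)
    have ig: "integrable lborel (\<lambda>x. g x * \<phi> x)"
    proof (rule Bochner_Integration.integrable_bound)
      show "integrable lborel (\<lambda>x. B * (indicator {a..b} x * \<bar>g x\<bar>))"
        using set_integrable_abs[OF L2_loc_integrable[OF g, of a b]] by (simp add: set_integrable_def)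
      show "AE x in lborel. norm (g x * \<phi> x) \<le> norm (B * (indicator {a..b} x * \<bar>g x\<bar>))"
        using B K1[of _ 0] K(3) by (intro AE_I2) (auto simp: abs_mult indicator_def mult.commute[of "\<bar>g _\<bar>"] intro: mult_right_mono)
    qed measurable
    have iv: "integrable lborel (\<lambda>x. v x * \<phi> x)"
      by (rule integrable_continuous_support[of _ a b])
         (use K1[of _ 0] in \<open>auto intro!: continuous_intros cv c\<phi> simp: K(3)\<close>)
    have ident: "(\<integral>x. ?A n x \<partial>lborel) + (\<integral>x. \<phi> x * (?D n x - g x) \<partial>lborel) + (\<integral>x. g x * \<phi> x \<partial>lborel) = 0" for n
    proof -
      have "0 = (\<integral>x. (v (x + h n) * \<phi> (x + h n) - v x * \<phi> x) / h n \<partial>lborel)"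
        using integral_shift[of "\<lambda>x. v x * \<phi> x" "h n"] iv integrable_shift[OF iv, of "h n"] by simp
      also have "\<dots> = (\<integral>x. ?A n x + \<phi> x * ?D n x \<partial>lborel)"
        using h(1)[of n] by (intro Bochner_Integration.integral_cong) (auto simp: field_simps)
      also have "\<dots> = (\<integral>x. ?A n x \<partial>lborel) + (\<integral>x. \<phi> x * ?D n x \<partial>lborel)"
        using iA iD by (intro Bochner_Integration.integral_add)
      also have "(\<integral>x. \<phi> x * ?D n x \<partial>lborel) = (\<integral>x. \<phi> x * ?D n x - g x * \<phi> x \<partial>lborel) + (\<integral>x. g x * \<phi> x \<partial>lborel)"
        using iD[of n] ig by simp
      also have "(\<lambda>x. \<phi> x * ?D n x - g x * \<phi> x) = (\<lambda>x. \<phi> x * (?D n x - g x))"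
        by (auto simp: algebra_simps)
      finally show ?thesis by simp
    qed
    have limA: "(\<lambda>n. \<integral>x. ?A n x \<partial>lborel) \<longlonglongrightarrow> (\<integral>x. v x * deriv \<phi> x \<partial>lborel)"
    proof (rule integral_dominated_convergence[where w = "\<lambda>x. indicator {a..b} x * (V * L)"])
      show "integrable lborel (\<lambda>x. indicator {a..b} x * (V * L))"
        using set_integrable_const_Icc[of a b "V * L"] by (simp add: set_integrable_def)
      show "AE x in lborel. norm (?A n x) \<le> indicator {a..b} x * (V * L)" for n
      proof (rule AE_I2)
        fix x
        show "norm (?A n x) \<le> indicator {a..b} x * (V * L)"
        proof (cases "x \<in> {a..b}")
          case True
          have "x + h n \<in> {a-1..b+1}" using True h(1,2)[of n] by auto
          moreover have "\<bar>(\<phi> (x + h n) - \<phi> x) / h n\<bar> \<le> L"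
          proof -
            obtain z where "\<phi> (x + h n) - \<phi> x = (x + h n - x) * deriv \<phi> z"
              using MVT2[of x "x + h n" \<phi> "deriv \<phi>"] d\<phi> h(1)[of n] by auto
            then show ?thesis using L(2)[of z] h(1)[of n] by simp
          qed
          ultimately show ?thesis using True V L(1) by (simp only: real_norm_def abs_mult indicator_simps mult_1) (intro mult_mono, auto)
        next
          case False
          with K1[of x "h n"] K1[of x 0] h[of n] K(3) show ?thesis by simp
        qed
      qed
      show "AE x in lborel. (\<lambda>n. ?A n x) \<longlonglongrightarrow> v x * deriv \<phi> x"
      proof (intro AE_I2 tendsto_mult)
        fix x
        have "(\<lambda>n. x + h n) \<longlonglongrightarrow> x" using tendsto_add[OF tendsto_const hlim, of x] by simp
        then show "(\<lambda>n. v (x + h n)) \<longlonglongrightarrow> v x"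
          using cv by (metis UNIV_I continuous_on_eq_continuous_at open_UNIV isCont_tendsto_compose)
        have "((\<lambda>h. (\<phi> (x + h) - \<phi> x) / h) \<longlongrightarrow> deriv \<phi> x) (at 0)"
          using d\<phi>[of x] by (simp add: DERIV_def)
        then show "(\<lambda>n. (\<phi> (x + h n) - \<phi> x) / h n) \<longlonglongrightarrow> deriv \<phi> x"
          unfolding tendsto_at_iff_sequentially o_def using hlim h(1) by (metis UNIV_I Diff_iff empty_iff insert_iff less_irrefl)
      qed
    qed measurable
    have limB: "(\<lambda>n. \<integral>x. \<phi> x * (?D n x - g x) \<partial>lborel) \<longlonglongrightarrow> 0"
    proof (rule LIMSEQ_I)
      fix r :: real assume r: "r > 0"
      define \<eta> where "\<eta> = r / (2 * (B + 1) * (b - a + 1))"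
      have \<eta>: "\<eta> > 0" using r B ab by (simp add: \<eta>_def)
      obtain d where d: "d > 0" "\<And>h. h \<noteq> 0 \<Longrightarrow> \<bar>h\<bar> < d \<Longrightarrow>
          (\<integral>\<^sup>+x. ennreal (indicator {a..b} x * ((v (x + h) - v x) / h - g x)\<^sup>2) \<partial>lborel) \<le> ennreal (\<eta>\<^sup>2)"
        using primitive_difference_quotient_L2[OF g v, of "\<eta>\<^sup>2" a b] \<eta> by auto
      obtain N where N: "\<And>n. n \<ge> N \<Longrightarrow> \<bar>h n\<bar> < d" using LIMSEQ_D[OF hlim d(1)] by auto
      show "\<exists>N. \<forall>n\<ge>N. norm ((\<integral>x. \<phi> x * (?D n x - g x) \<partial>lborel) - 0) < r"
      proof (intro exI[of _ N] allI impI)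
        fix n assume n: "n \<ge> N"
        let ?d = "\<lambda>x. ?D n x - g x"
        have int: "integrable lborel (\<lambda>x. \<phi> x * ?d x)"
          using Bochner_Integration.integrable_diff[OF iD[of n] ig] by (simp add: algebra_simps)
        have "ennreal (norm (\<integral>x. \<phi> x * ?d x \<partial>lborel)) \<le> (\<integral>\<^sup>+x. ennreal (norm (\<phi> x * ?d x)) \<partial>lborel)"
          by (rule integral_norm_bound_ennreal[OF int])
        also have "\<dots> \<le> (\<integral>\<^sup>+x. ennreal (B * \<eta>) * indicator {a..b} x + ennreal (B / \<eta>) * ennreal (indicator {a..b} x * (?d x)\<^sup>2) \<partial>lborel)"
        proof (rule nn_integral_mono)
          fix x :: real
          show "ennreal (norm (\<phi> x * ?d x)) \<le> ennreal (B * \<eta>) * indicator {a..b} x + ennreal (B / \<eta>) * ennreal (indicator {a..b} x * (?d x)\<^sup>2)"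
          proof (cases "x \<in> {a..b}")
            case True
            have "\<bar>?d x\<bar> \<le> \<eta> + (?d x)\<^sup>2 / \<eta>"
              using abs_le_one_plus_square[of "?d x / \<eta>"] \<eta> by (simp add: power2_eq_square field_simps)
            then have "\<bar>\<phi> x\<bar> * \<bar>?d x\<bar> \<le> B * (\<eta> + (?d x)\<^sup>2 / \<eta>)"
              using B \<eta> by (intro mult_mono) auto
            then have "norm (\<phi> x * ?d x) \<le> B * \<eta> + B / \<eta> * (?d x)\<^sup>2"
              by (simp add: abs_mult distrib_left)
            then show ?thesis using True B(1) \<eta> by (simp add: ennreal_leI flip: ennreal_mult ennreal_plus)
          next
            case False
            with K1[of x 0] K(3) show ?thesis by simp
          qed
        qed
        also have "\<dots> = ennreal (B * \<eta>) * ennreal (b - a) + ennreal (B / \<eta>) * (\<integral>\<^sup>+x. ennreal (indicator {a..b} x * (?d x)\<^sup>2) \<partial>lborel)"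
          using ab by (simp add: nn_integral_add nn_integral_cmult)
        also have "\<dots> \<le> ennreal (B * \<eta>) * ennreal (b - a) + ennreal (B / \<eta>) * ennreal (\<eta>\<^sup>2)"
          using N[OF n] h(1)[of n] by (intro add_left_mono mult_left_mono d(2)) auto
        also have "\<dots> = ennreal (B * \<eta> * (b - a + 1))"
          using B(1) \<eta> ab by (simp add: power2_eq_square distrib_left flip: ennreal_mult ennreal_plus)
        finally have "norm (\<integral>x. \<phi> x * ?d x \<partial>lborel) \<le> B * \<eta> * (b - a + 1)"
          using B(1) \<eta> ab by (subst (asm) ennreal_le_iff) auto
        also have "\<dots> \<le> (B + 1) * \<eta> * (b - a + 1)" using \<eta> ab by (intro mult_right_mono) auto
        also have "\<dots> = r / 2"
        proof -
          have "P * (r / (2 * P * Q)) * Q = r / 2" if "P \<noteq> 0" "Q \<noteq> 0" for P Q :: real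
            using that by (simp add: field_simps)
          from this[of "B + 1" "b - a + 1"] show ?thesis unfolding \<eta>_def using B(1) ab by simp
        qed
        finally show "norm ((\<integral>x. \<phi> x * ?d x \<partial>lborel) - 0) < r" using r by simp
      qed
    qed
    have "(\<lambda>n::nat. 0) \<longlonglongrightarrow> (\<integral>x. v x * deriv \<phi> x \<partial>lborel) + 0 + (\<integral>x. g x * \<phi> x \<partial>lborel)"
      using tendsto_add[OF tendsto_add[OF limA limB] tendsto_const[of "\<integral>x. g x * \<phi> x \<partial>lborel"]]
      unfolding ident .
    from LIMSEQ_unique[OF tendsto_const this]
    have "(\<integral>x. v x * deriv \<phi> x \<partial>lborel) + (\<integral>x. g x * \<phi> x \<partial>lborel) = 0" by simp
    moreover have "(LINT x:S|lebesgue. v x * deriv \<phi> x) = (\<integral>x. v x * deriv \<phi> x \<partial>lborel)"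
    proof -
      have "(\<lambda>x. indicator S x *\<^sub>R (v x * deriv \<phi> x)) = (\<lambda>x. v x * deriv \<phi> x)"
        using d0 K(2) by (auto simp: indicator_def fun_eq_iff)
      then show ?thesis unfolding set_lebesgue_integral_def by (simp add: integral_completion)
    qed
    moreover have "(LINT x:S|lebesgue. g x * \<phi> x) = (\<integral>x. g x * \<phi> x \<partial>lborel)"
    proof -
      have "(\<lambda>x. indicator S x *\<^sub>R (g x * \<phi> x)) = (\<lambda>x. g x * \<phi> x)"
        using K(2,3) by (auto simp: indicator_def fun_eq_iff)
      then show ?thesis unfolding set_lebesgue_integral_def by (simp add: integral_completion)
    qed
    ultimately show ?thesis by simp
  qed
  show ?thesis unfolding has_weak_deriv_on_def
    using loc[OF _ g] loc[OF _ L2_loc_continuous[OF cv]] main by blast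
qed

section \<open>Initial data as two travelling waves\<close>

text \<open>Borel representatives make compositions with translations and integrals over products measurable.\<close>

lemma L2_locu_representative:
  assumes v: "v \<in> L2_locu"
  shows "\<exists>g. L2_loc g \<and> (AE x in lebesgue. v x = g x)"
proof -
  have vm: "v \<in> borel_measurable lebesgue"
    and fin: "(SUP a. \<integral>\<^sup>+x\<in>{a-1..a+1}. ennreal ((v x)\<^sup>2) \<partial>lebesgue) < \<infinity>"
    using v by (auto simp: L2_locu_def)
  obtain g where g[measurable]: "g \<in> borel_measurable borel" and ae0: "AE x in lborel. v x = g x"
    using completion_ex_borel_measurable_real[OF vm] by auto
  have ae: "AE x in lebesgue. v x = g x" using ae0 by (rule AE_completion)
  have unit: "(\<integral>\<^sup>+x. ennreal ((g x)\<^sup>2) * indicator {a-1..a+1} x \<partial>lborel) < \<infinity>" for a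
  proof -
    have "(\<integral>\<^sup>+x. ennreal ((g x)\<^sup>2) * indicator {a-1..a+1} x \<partial>lborel) = (\<integral>\<^sup>+x. ennreal ((g x)\<^sup>2) * indicator {a-1..a+1} x \<partial>lebesgue)"
      by (rule nn_integral_completion[symmetric]) 
    also have "\<dots> = (\<integral>\<^sup>+x. ennreal ((v x)\<^sup>2) * indicator {a-1..a+1} x \<partial>lebesgue)"
      using ae by (intro nn_integral_cong_AE) auto
    also have "\<dots> \<le> (SUP a. \<integral>\<^sup>+x\<in>{a-1..a+1}. ennreal ((v x)\<^sup>2) \<partial>lebesgue)"
      by (rule SUP_upper) simp
    finally show ?thesis using fin by simp
  qed
  have steps: "(\<integral>\<^sup>+x. ennreal ((g x)\<^sup>2) * indicator {a..a + real n} x \<partial>lborel) < \<infinity>" for a n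
  proof (induction n)
    case 0
    have "(\<integral>\<^sup>+x. ennreal ((g x)\<^sup>2) * indicator {a..a + real 0} x \<partial>lborel) \<le> (\<integral>\<^sup>+x. ennreal ((g x)\<^sup>2) * indicator {a-1..a+1} x \<partial>lborel)"
      by (intro nn_integral_mono) (auto simp: indicator_def)
    then show ?case using unit[of a] by (rule order.strict_trans1)
  next
    case (Suc n)
    have "(\<integral>\<^sup>+x. ennreal ((g x)\<^sup>2) * indicator {a..a + real (Suc n)} x \<partial>lborel)
       \<le> (\<integral>\<^sup>+x. ennreal ((g x)\<^sup>2) * indicator {a..a + real n} x + ennreal ((g x)\<^sup>2) * indicator {a + real n - 1..a + real n + 1} x \<partial>lborel)"
      by (intro nn_integral_mono) (auto simp: indicator_def)
    also have "\<dots> = (\<integral>\<^sup>+x. ennreal ((g x)\<^sup>2) * indicator {a..a + real n} x \<partial>lborel) + (\<integral>\<^sup>+x. ennreal ((g x)\<^sup>2) * indicator {a + real n - 1..a + real n + 1} x \<partial>lborel)"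
      by (rule nn_integral_add) auto
    also have "\<dots> < \<infinity>" using Suc unit[of "a + real n"] by simp
    finally show ?case .
  qed
  have "set_integrable lborel {a..b} (\<lambda>x. (g x)\<^sup>2)" for a b
  proof -
    obtain n where n: "b - a \<le> real n" using real_arch_simple by blast
    have "(\<integral>\<^sup>+x. ennreal (norm (indicator {a..b} x *\<^sub>R (g x)\<^sup>2)) \<partial>lborel) \<le> (\<integral>\<^sup>+x. ennreal ((g x)\<^sup>2) * indicator {a..a + real n} x \<partial>lborel)"
      using n by (intro nn_integral_mono) (auto simp: indicator_def)
    then have "(\<integral>\<^sup>+x. ennreal (norm (indicator {a..b} x *\<^sub>R (g x)\<^sup>2)) \<partial>lborel) < \<infinity>"
      using steps by (rule order.strict_trans1)
    then show ?thesis unfolding set_integrable_def by (intro integrableI_bounded) auto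
  qed
  with g ae show ?thesis unfolding L2_loc_def by (intro exI[of _ g] conjI allI)
qed

lemma set_integral_representative:
  assumes g: "L2_loc g" and ae: "AE x in lebesgue. v x = g x" and v: "v \<in> borel_measurable lebesgue"
  shows "(LINT x:{a..b}|lebesgue. v x) = integral {a..b} g"
proof -
  note [measurable] = v L2_loc_measurable[OF g]
  have gm: "g \<in> borel_measurable lebesgue"
    by (rule measurable_completion) simp
  have "(LINT x:{a..b}|lebesgue. v x) = (LINT x:{a..b}|lebesgue. g x)"
    unfolding set_lebesgue_integral_def using ae by (intro integral_cong_AE borel_measurable_scaleR borel_measurable_indicator v gm) auto
  also have "\<dots> = integral {a..b} g"
    by (rule set_lebesgue_integral_eq_integral(2)[OF set_integrable_lebesgue_of_lborel[OF L2_loc_integrable[OF g]]])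
  finally show ?thesis .
qed

lemma primitive_exists:
  assumes g: "L2_loc g" shows "\<exists>U. primitive U g"
proof -
  note int = L2_loc_integrable_on[OF g]
  define U where "U y = (if y \<ge> 0 then integral {0..y} g else - integral {y..0} g)" for y
  have "U \<beta> - U \<alpha> = integral {\<alpha>..\<beta>} g" if "\<alpha> \<le> \<beta>" for \<alpha> \<beta>
  proof -
    consider "0 \<le> \<alpha>" | "\<beta> < 0" | "\<alpha> < 0" "0 \<le> \<beta>" using that by linarith
    then show ?thesis
    proof cases
      case 1
      then have "integral {0..\<alpha>} g + integral {\<alpha>..\<beta>} g = integral {0..\<beta>} g"
        using that by (intro Henstock_Kurzweil_Integration.integral_combine int) auto
      then show ?thesis using 1 that by (simp add: U_def)
    next
      case 2
      then have "integral {\<alpha>..\<beta>} g + integral {\<beta>..0} g = integral {\<alpha>..0} g"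
        using that by (intro Henstock_Kurzweil_Integration.integral_combine int) auto
      then show ?thesis using 2 that by (simp add: U_def)
    next
      case 3
      then have "integral {\<alpha>..0} g + integral {0..\<beta>} g = integral {\<alpha>..\<beta>} g"
        using that by (intro Henstock_Kurzweil_Integration.integral_combine int) auto
      then show ?thesis using 3 that by (simp add: U_def)
    qed
  qed
  then show ?thesis by (auto simp: primitive_def)
qed

text \<open>D'Alembert's formula for given initial data, split into the wave that moves to the left and the wave
that moves to the right, with Borel representatives \<open>p\<close> and \<open>q\<close> of their derivatives.\<close>

locale wave_data =
  fixes u0 u1 \<phi> \<psi> p q :: "real \<Rightarrow> real"
  assumes p: "L2_loc p" and q: "L2_loc q" and \<phi>: "primitive \<phi> p" and \<psi>: "primitive \<psi> q"
    and dalembert: "\<And>x t. t \<ge> 0 \<Longrightarrow>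
      (u0 (x - t) + u0 (x + t)) / 2 + (LINT z:{x - t..x + t}|lebesgue. u1 z) / 2 = \<phi> (x + t) + \<psi> (x - t)"

lemma wave_data_exists:
  assumes u0: "u0 \<in> H1_locu" and u1: "u1 \<in> L2_locu"
  shows "\<exists>\<phi> \<psi> p q. wave_data u0 u1 \<phi> \<psi> p q"
proof -
  obtain w where w: "w \<in> L2_locu" "has_weak_deriv_on u0 w UNIV" and c: "continuous_on UNIV u0"
    using u0 by (auto simp: H1_locu_def)
  obtain g where g: "L2_loc g" "AE x in lebesgue. w x = g x" using L2_locu_representative[OF w(1)] by blast
  obtain k where k: "L2_loc k" "AE x in lebesgue. u1 x = k x" using L2_locu_representative[OF u1] by blast
  obtain U where U: "primitive U k" using primitive_exists[OF k(1)] by blast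
  have g0: "primitive u0 g"
    unfolding primitive_def
  proof (intro allI impI)
    fix \<alpha> \<beta> :: real assume "\<alpha> \<le> \<beta>"
    from weak_deriv_imp_integral[OF w(2) open_UNIV c this]
    show "u0 \<beta> - u0 \<alpha> = integral {\<alpha>..\<beta>} g"
      using set_integral_representative[OF g] w(1) by (simp add: L2_locu_def)
  qed
  have "wave_data u0 u1 (\<lambda>x. (1/2) * u0 x + (1/2) * U x) (\<lambda>x. (1/2) * u0 x + (-1/2) * U x)
     (\<lambda>x. (1/2) * g x + (1/2) * k x) (\<lambda>x. (1/2) * g x + (-1/2) * k x)"
  proof
    fix x t :: real assume "t \<ge> 0"
    then have "U (x + t) - U (x - t) = integral {x - t..x + t} k" using U by (simp add: primitive_def)
    moreover have "(LINT z:{x - t..x + t}|lebesgue. u1 z) = integral {x - t..x + t} k"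
      using set_integral_representative[OF k] u1 by (simp add: L2_locu_def)
    ultimately show "(u0 (x - t) + u0 (x + t)) / 2 + (LINT z:{x - t..x + t}|lebesgue. u1 z) / 2 =
      (1/2) * u0 (x + t) + (1/2) * U (x + t) + ((1/2) * u0 (x - t) + (-1/2) * U (x - t))"
      by (simp add: field_simps)
  qed (intro L2_loc_add L2_loc_cmult primitive_add primitive_cmult g(1) k(1) U g0)+
  then show ?thesis by blast
qed

section \<open>Bounds and limits of the Duhamel term\<close>

lemma duhamel_slice_continuous:
  fixes f :: "real \<Rightarrow> real \<Rightarrow> real"
  assumes f: "continuous_on UNIV (\<lambda>p. f (fst p) (snd p))"
  shows "continuous_on {0..t} (\<lambda>\<tau>. integral {x - t + \<tau>..x + t - \<tau>} (\<lambda>z. f z \<tau>))"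
proof -
  obtain G where dG: "\<And>z \<tau>. ((\<lambda>z. G z \<tau>) has_real_derivative f z \<tau>) (at z)"
    and G: "continuous_on UNIV (\<lambda>p. G (fst p) (snd p))"
    using spatial_antiderivative[OF f] by blast
  have "continuous_on {0..t} (\<lambda>\<tau>. G (x + t - \<tau>) \<tau> - G (x - t + \<tau>) \<tau>)"
    by (intro continuous_intros continuous_on_slice[OF G])
  moreover have "G (x + t - \<tau>) \<tau> - G (x - t + \<tau>) \<tau> = integral {x - t + \<tau>..x + t - \<tau>} (\<lambda>z. f z \<tau>)"
    if "\<tau> \<in> {0..t}" for \<tau>
    using that dG
    by (intro integral_unique[symmetric] fundamental_theorem_of_calculus)
       (auto intro: has_field_derivative_at_within simp flip: has_real_derivative_iff_has_vector_derivative)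
  ultimately show ?thesis by (rule continuous_on_eq)
qed

lemma duhamel_slice_integrable:
  fixes f :: "real \<Rightarrow> real \<Rightarrow> real"
  assumes f: "continuous_on UNIV (\<lambda>p. f (fst p) (snd p))"
  shows "(\<lambda>\<tau>. integral {x - t + \<tau>..x + t - \<tau>} (\<lambda>z. f z \<tau>)) integrable_on {0..t}"
  by (rule integrable_continuous_real[OF duhamel_slice_continuous[OF f]])

lemma duhamel_mono:
  fixes f g :: "real \<Rightarrow> real \<Rightarrow> real"
  assumes f: "continuous_on UNIV (\<lambda>p. f (fst p) (snd p))" and g: "continuous_on UNIV (\<lambda>p. g (fst p) (snd p))"
    and le: "\<And>z \<tau>. 0 \<le> \<tau> \<Longrightarrow> \<bar>z - x\<bar> \<le> t - \<tau> \<Longrightarrow> f z \<tau> \<le> g z \<tau>"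
  shows "duhamel f x t \<le> duhamel g x t"
  unfolding duhamel_def
  by (intro divide_right_mono integral_le duhamel_slice_integrable f g integrable_continuous_real
        continuous_on_slice[OF f] continuous_on_slice[OF g] continuous_intros le) auto

lemma duhamel_cong:
  fixes f g :: "real \<Rightarrow> real \<Rightarrow> real"
  assumes "\<And>z \<tau>. 0 \<le> \<tau> \<Longrightarrow> \<bar>z - x\<bar> \<le> t - \<tau> \<Longrightarrow> f z \<tau> = g z \<tau>"
  shows "duhamel f x t = duhamel g x t"
  unfolding duhamel_def
  by (intro arg_cong[where f = "\<lambda>r. r / 2"] Henstock_Kurzweil_Integration.integral_cong assms) auto

lemma duhamel_zero_time: "duhamel f x 0 = 0"
  by (simp add: duhamel_def)

lemma duhamel_const_le:
  assumes "K \<ge> 0" "t \<ge> 0" shows "duhamel (\<lambda>_ _. K) x t \<le> K * t\<^sup>2"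
proof -
  have "integral {0..t} (\<lambda>\<tau>. integral {x - t + \<tau>..x + t - \<tau>} (\<lambda>z. K)) \<le> integral {0..t} (\<lambda>\<tau>. K * (2 * t))"
  proof (rule integral_le[OF duhamel_slice_integrable])
    fix \<tau> assume "\<tau> \<in> {0..t}"
    then show "integral {x - t + \<tau>..x + t - \<tau>} (\<lambda>z. K) \<le> K * (2 * t)"
      using assms by (simp add: mult_left_mono mult.commute[of _ K])
  qed auto
  then show ?thesis using assms by (simp add: duhamel_def power2_eq_square algebra_simps)
qed

lemma duhamel_nonneg:
  fixes f :: "real \<Rightarrow> real \<Rightarrow> real"
  assumes f: "continuous_on UNIV (\<lambda>p. f (fst p) (snd p))"
    and "\<And>z \<tau>. 0 \<le> \<tau> \<Longrightarrow> \<bar>z - x\<bar> \<le> t - \<tau> \<Longrightarrow> 0 \<le> f z \<tau>"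
  shows "0 \<le> duhamel f x t"
  using duhamel_mono[of "\<lambda>_ _. 0" f x t] assms by (simp add: duhamel_def)

lemma right_ray_bounds:
  fixes f :: "real \<Rightarrow> real \<Rightarrow> real"
  assumes f: "continuous_on UNIV (\<lambda>p. f (fst p) (snd p))" and t: "t \<ge> 0"
    and b: "\<And>z \<tau>. 0 \<le> \<tau> \<Longrightarrow> \<bar>z - x\<bar> \<le> t - \<tau> \<Longrightarrow> 0 \<le> f z \<tau> \<and> f z \<tau> \<le> K"
  shows "0 \<le> right_ray f x t" "right_ray f x t \<le> K * t"
proof -
  have i: "(\<lambda>\<tau>. f (x + t - \<tau>) \<tau>) integrable_on {0..t}"
    by (intro integrable_continuous_real continuous_on_slice[OF f] continuous_intros)
  show "0 \<le> right_ray f x t" unfolding right_ray_def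
    by (intro Henstock_Kurzweil_Integration.integral_nonneg i) (use b in auto)
  have "right_ray f x t \<le> integral {0..t} (\<lambda>_. K)" unfolding right_ray_def
    by (intro integral_le i) (use b in auto)
  then show "right_ray f x t \<le> K * t" using t by (simp add: mult.commute)
qed

lemma left_ray_bounds:
  fixes f :: "real \<Rightarrow> real \<Rightarrow> real"
  assumes f: "continuous_on UNIV (\<lambda>p. f (fst p) (snd p))" and t: "t \<ge> 0"
    and b: "\<And>z \<tau>. 0 \<le> \<tau> \<Longrightarrow> \<bar>z - x\<bar> \<le> t - \<tau> \<Longrightarrow> 0 \<le> f z \<tau> \<and> f z \<tau> \<le> K"
  shows "0 \<le> left_ray f x t" "left_ray f x t \<le> K * t"
proof -
  have f': "continuous_on UNIV (\<lambda>p. (\<lambda>z. f (- z)) (fst p) (snd p))"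
    by (auto intro!: continuous_on_slice[OF f] continuous_intros)
  have "0 \<le> f (- z) \<tau> \<and> f (- z) \<tau> \<le> K" if "0 \<le> \<tau>" "\<bar>z - (- x)\<bar> \<le> t - \<tau>" for z \<tau>
    by (rule b) (use that in auto)
  from right_ray_bounds[OF f' t this]
  show "0 \<le> left_ray f x t" "left_ray f x t \<le> K * t" unfolding left_ray_mirror by auto
qed

text \<open>The constant depends on the bound of the source and on the time only. This makes the nonlinear parts
of the iterates below equicontinuous.\<close>

lemma duhamel_lipschitz:
  fixes f :: "real \<Rightarrow> real \<Rightarrow> real"
  assumes f: "continuous_on UNIV (\<lambda>p. f (fst p) (snd p))"
    and b: "\<And>z \<tau>. 0 \<le> f z \<tau> \<and> f z \<tau> \<le> K"
    and t: "0 \<le> t" "t \<le> c" "0 \<le> t'" "t' \<le> c"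
  shows "\<bar>duhamel f x t - duhamel f x' t'\<bar> \<le> K * c * (\<bar>x - x'\<bar> + \<bar>t - t'\<bar>)"
proof -
  let ?X = "\<lambda>s. x' + s * (x - x')" and ?Y = "\<lambda>s. t' + s * (t - t')"
  let ?A = "\<lambda>s. right_ray f (?X s) (?Y s)" and ?B = "\<lambda>s. left_ray f (?X s) (?Y s)"
  let ?D = "\<lambda>s. (?A s * ((t - t') + (x - x')) + ?B s * ((t - t') - (x - x'))) / 2"
  have K: "K \<ge> 0" using b[of 0 0] by linarith
  have Y: "0 \<le> ?Y s" "?Y s \<le> c" if "s \<in> {0..1}" for s
  proof -
    have e: "?Y s = (1 - s) * t' + s * t" by (simp add: algebra_simps)
    show "0 \<le> ?Y s" unfolding e using that t by simp
    have "?Y s \<le> (1 - s) * c + s * c" unfolding e using that t by (intro add_mono mult_left_mono) auto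
    then show "?Y s \<le> c" by (simp add: algebra_simps)
  qed
  have d: "((\<lambda>s. duhamel f (?X s) (?Y s)) has_real_derivative ?D s) (at s within {0..1})" if s: "s \<in> {0..1}" for s
    by (rule duhamel_derivative_along[OF f]) (use s Y in \<open>auto intro!: derivative_eq_intros\<close>)
  have bound: "norm (?D s) \<le> K * c * (\<bar>x - x'\<bar> + \<bar>t - t'\<bar>)" if s: "s \<in> {0..1}" for s
  proof -
    have "0 \<le> ?A s" "?A s \<le> K * ?Y s" using right_ray_bounds[OF f Y(1)[OF s] b] by auto
    then have A: "\<bar>?A s\<bar> \<le> K * c" using mult_left_mono[OF Y(2)[OF s] K] by linarith
    have "0 \<le> ?B s" "?B s \<le> K * ?Y s" using left_ray_bounds[OF f Y(1)[OF s] b] by auto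
    then have B: "\<bar>?B s\<bar> \<le> K * c" using mult_left_mono[OF Y(2)[OF s] K] by linarith
    have "\<bar>?A s * ((t - t') + (x - x'))\<bar> \<le> K * c * (\<bar>x - x'\<bar> + \<bar>t - t'\<bar>)"
      unfolding abs_mult using A by (intro mult_mono) auto
    moreover have "\<bar>?B s * ((t - t') - (x - x'))\<bar> \<le> K * c * (\<bar>x - x'\<bar> + \<bar>t - t'\<bar>)"
      unfolding abs_mult using B by (intro mult_mono) auto
    moreover have "\<bar>(y + z) / 2\<bar> \<le> M" if "\<bar>y\<bar> \<le> M" "\<bar>z\<bar> \<le> M" for y z M :: real
      using that by (simp add: abs_le_iff)
    ultimately show ?thesis unfolding real_norm_def by blast
  qed
  have "norm (duhamel f (?X 1) (?Y 1) - duhamel f (?X 0) (?Y 0)) \<le> K * c * (\<bar>x - x'\<bar> + \<bar>t - t'\<bar>) * norm (1 - 0 :: real)"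
    by (rule field_differentiable_bound[of "{0..1}", OF _ d bound]) auto
  then show ?thesis by simp
qed

lemma duhamel_bounded_convergence:
  fixes f :: "nat \<Rightarrow> real \<Rightarrow> real \<Rightarrow> real"
  assumes fn: "\<And>n. continuous_on UNIV (\<lambda>p. f n (fst p) (snd p))"
    and b: "\<And>n z \<tau>. 0 \<le> f n z \<tau> \<and> f n z \<tau> \<le> K" and lim: "\<And>z \<tau>. (\<lambda>n. f n z \<tau>) \<longlonglongrightarrow> g z \<tau>"
  shows "(\<lambda>n. duhamel (f n) x t) \<longlonglongrightarrow> duhamel g x t"
proof -
  have K: "K \<ge> 0" using b[of 0 0 0] by linarith
  have inner: "(\<lambda>n. integral {x - t + \<tau>..x + t - \<tau>} (\<lambda>z. f n z \<tau>)) \<longlonglongrightarrow> integral {x - t + \<tau>..x + t - \<tau>} (\<lambda>z. g z \<tau>)" for \<tau>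
    by (rule dominated_convergence(2)[where h = "\<lambda>_. K"])
       (use b lim in \<open>auto intro!: integrable_continuous_real continuous_on_slice[OF fn] continuous_intros\<close>)
  have "(\<lambda>n. integral {0..t} (\<lambda>\<tau>. integral {x - t + \<tau>..x + t - \<tau>} (\<lambda>z. f n z \<tau>)))
     \<longlonglongrightarrow> integral {0..t} (\<lambda>\<tau>. integral {x - t + \<tau>..x + t - \<tau>} (\<lambda>z. g z \<tau>))"
  proof (rule dominated_convergence(2)[where h = "\<lambda>_. K * (2 * \<bar>t\<bar>)"])
    show "norm (integral {x - t + \<tau>..x + t - \<tau>} (\<lambda>z. f n z \<tau>)) \<le> K * (2 * \<bar>t\<bar>)" if \<tau>: "\<tau> \<in> {0..t}" for n \<tau>
    proof -
      have i: "(\<lambda>z. f n z \<tau>) integrable_on {x - t + \<tau>..x + t - \<tau>}"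
        by (intro integrable_continuous_real continuous_on_slice[OF fn] continuous_intros)
      have "0 \<le> integral {x - t + \<tau>..x + t - \<tau>} (\<lambda>z. f n z \<tau>)"
        by (intro Henstock_Kurzweil_Integration.integral_nonneg i) (use b in auto)
      moreover have "integral {x - t + \<tau>..x + t - \<tau>} (\<lambda>z. f n z \<tau>) \<le> integral {x - t + \<tau>..x + t - \<tau>} (\<lambda>z. K)"
        by (intro integral_le i) (use b in auto)
      moreover have "integral {x - t + \<tau>..x + t - \<tau>} (\<lambda>z. K) \<le> K * (2 * \<bar>t\<bar>)"
        using \<tau> K by (simp add: mult_left_mono mult.commute[of _ K])
      ultimately show ?thesis by simp
    qed
  qed (use inner in \<open>auto intro!: duhamel_slice_integrable fn\<close>)
  then show ?thesis unfolding duhamel_def by (intro tendsto_divide tendsto_const) auto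
qed

section \<open>The equation with truncated exponential\<close>

definition closed_cone :: "real \<Rightarrow> real \<Rightarrow> (real \<times> real) set" where
  "closed_cone a s = {(x, t). 0 \<le> t \<and> \<bar>x - a\<bar> \<le> s - t}"

lemma duhamel_lebesgue:
  fixes f :: "real \<Rightarrow> real \<Rightarrow> real"
  assumes f: "continuous_on UNIV (\<lambda>p. f (fst p) (snd p))"
  shows "(LINT \<tau>:{0..t}|lebesgue. (LINT z:{x - t + \<tau>..x + t - \<tau>}|lebesgue. f z \<tau>)) / 2 = duhamel f x t"
proof -
  have "(LINT z:{x - t + \<tau>..x + t - \<tau>}|lebesgue. f z \<tau>) = integral {x - t + \<tau>..x + t - \<tau>} (\<lambda>z. f z \<tau>)" for \<tau>
    by (intro set_lebesgue_integral_eq_integral(2) absolutely_integrable_continuous_real continuous_on_slice[OF f] continuous_intros)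
  moreover have "(LINT \<tau>:{0..t}|lebesgue. integral {x - t + \<tau>..x + t - \<tau>} (\<lambda>z. f z \<tau>)) = integral {0..t} (\<lambda>\<tau>. integral {x - t + \<tau>..x + t - \<tau>} (\<lambda>z. f z \<tau>))"
    by (intro set_lebesgue_integral_eq_integral(2) absolutely_integrable_continuous_real duhamel_slice_continuous[OF f])
  ultimately show ?thesis by (simp add: duhamel_def)
qed

lemma L2_norm_on_nonneg: "0 \<le> L2_norm_on S f"
  unfolding L2_norm_on_def set_lebesgue_integral_def
  by (intro real_sqrt_ge_zero Bochner_Integration.integral_nonneg) (auto simp: indicator_def)

text \<open>The three terms will be a contribution of each travelling wave and one of the Duhamel term.\<close>

lemma L2_norm_on_sum3_le:
  assumes m: "f1 \<in> borel_measurable borel" "f2 \<in> borel_measurable borel" "f3 \<in> borel_measurable borel"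
    and e: "e \<ge> 0"
    and le: "(\<integral>\<^sup>+x. ennreal (indicator {a..b} x * (f1 x)\<^sup>2) \<partial>lborel) \<le> ennreal (e\<^sup>2 / 9)"
       "(\<integral>\<^sup>+x. ennreal (indicator {a..b} x * (f2 x)\<^sup>2) \<partial>lborel) \<le> ennreal (e\<^sup>2 / 9)"
       "(\<integral>\<^sup>+x. ennreal (indicator {a..b} x * (f3 x)\<^sup>2) \<partial>lborel) \<le> ennreal (e\<^sup>2 / 9)"
    and S: "S \<subseteq> {a..b}" "S \<in> sets borel"
  shows "L2_norm_on S (\<lambda>x. f1 x + f2 x + f3 x) \<le> e"
proof (rule L2_norm_on_le[OF _ e _ S])
  note [measurable] = m
  show "(\<lambda>x. f1 x + f2 x + f3 x) \<in> borel_measurable borel" by measurable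
  have sq: "(r + s + t)\<^sup>2 \<le> 3 * r\<^sup>2 + 3 * s\<^sup>2 + 3 * t\<^sup>2" for r s t :: real
    using zero_le_power2[of "r - s"] zero_le_power2[of "s - t"] zero_le_power2[of "r - t"]
    by (simp add: power2_eq_square algebra_simps)
  let ?g = "\<lambda>f x. ennreal (indicator {a..b} x * (f x)\<^sup>2)"
  have "(\<integral>\<^sup>+x. ?g (\<lambda>x. f1 x + f2 x + f3 x) x \<partial>lborel) \<le> (\<integral>\<^sup>+x. 3 * ?g f1 x + 3 * ?g f2 x + 3 * ?g f3 x \<partial>lborel)"
  proof (rule nn_integral_mono)
    fix x
    have "ennreal (indicator {a..b} x * (f1 x + f2 x + f3 x)\<^sup>2) \<le>
      ennreal (3 * (indicator {a..b} x * (f1 x)\<^sup>2) + 3 * (indicator {a..b} x * (f2 x)\<^sup>2) + 3 * (indicator {a..b} x * (f3 x)\<^sup>2))"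
      using sq[of "f1 x" "f2 x" "f3 x"] by (intro ennreal_leI) (auto simp: indicator_def)
    also have "\<dots> = 3 * ?g f1 x + 3 * ?g f2 x + 3 * ?g f3 x"
      by (simp add: ennreal_plus ennreal_mult)
    finally show "?g (\<lambda>x. f1 x + f2 x + f3 x) x \<le> 3 * ?g f1 x + 3 * ?g f2 x + 3 * ?g f3 x" .
  qed
  also have "\<dots> = 3 * (\<integral>\<^sup>+x. ?g f1 x \<partial>lborel) + 3 * (\<integral>\<^sup>+x. ?g f2 x \<partial>lborel) + 3 * (\<integral>\<^sup>+x. ?g f3 x \<partial>lborel)"
    by (simp add: nn_integral_add nn_integral_cmult)
  also have "\<dots> \<le> 3 * ennreal (e\<^sup>2 / 9) + 3 * ennreal (e\<^sup>2 / 9) + 3 * ennreal (e\<^sup>2 / 9)"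
    by (intro add_mono mult_left_mono le) auto
  also have "\<dots> = ennreal (3 * (e\<^sup>2 / 9) + 3 * (e\<^sup>2 / 9) + 3 * (e\<^sup>2 / 9))"
  proof -
    have "3 * ennreal (e\<^sup>2 / 9) = ennreal (3 * (e\<^sup>2 / 9))"
      using ennreal_mult[of 3 "e\<^sup>2 / 9"] by simp
    then show ?thesis by (simp only: ennreal_plus[symmetric] zero_le_power2 divide_nonneg_nonneg
      zero_le_numeral mult_nonneg_nonneg add_nonneg_nonneg)
  qed
  also have "3 * (e\<^sup>2 / 9) + 3 * (e\<^sup>2 / 9) + 3 * (e\<^sup>2 / 9) = e\<^sup>2" by simp
  finally show "(\<integral>\<^sup>+x. ?g (\<lambda>x. f1 x + f2 x + f3 x) x \<partial>lborel) \<le> ennreal (e\<^sup>2)" .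
qed

lemma uniform_in_time:
  fixes g :: "real \<Rightarrow> real \<Rightarrow> real"
  assumes g: "continuous_on (UNIV \<times> {0..}) (\<lambda>p. g (fst p) (snd p))" and e: "e > 0" and t: "0 \<le> t" "t \<le> c"
  shows "\<exists>d>0. \<forall>x\<in>{a..b}. \<forall>\<tau>\<in>{0..c}. \<bar>\<tau> - t\<bar> < d \<longrightarrow> \<bar>g x \<tau> - g x t\<bar> \<le> e"
proof -
  have "uniformly_continuous_on ({a..b} \<times> {0..c}) (\<lambda>p. g (fst p) (snd p))"
    by (intro compact_uniformly_continuous continuous_on_subset[OF g] compact_Times) auto
  then obtain d where d: "d > 0" "\<And>P Q. P \<in> {a..b} \<times> {0..c} \<Longrightarrow> Q \<in> {a..b} \<times> {0..c} \<Longrightarrow> dist Q P < d \<Longrightarrow>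
      dist (g (fst Q) (snd Q)) (g (fst P) (snd P)) < e"
    using e unfolding uniformly_continuous_on_def by metis
  show ?thesis
  proof (intro exI[of _ d] conjI ballI impI d(1))
    fix x \<tau> assume "x \<in> {a..b}" "\<tau> \<in> {0..c}" "\<bar>\<tau> - t\<bar> < d"
    then show "\<bar>g x \<tau> - g x t\<bar> \<le> e"
      using d(2)[of "(x, t)" "(x, \<tau>)"] t by (simp add: dist_Pair_Pair dist_real_def)
  qed
qed

lemma nn_integral_uniform_bound:
  assumes "\<And>x. x \<in> {a..b::real} \<Longrightarrow> \<bar>f x\<bar> \<le> e" "a \<le> b" "e \<ge> 0"
  shows "(\<integral>\<^sup>+x. ennreal (indicator {a..b} x * (f x)\<^sup>2) \<partial>lborel) \<le> ennreal (e\<^sup>2 * (b - a))"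
proof -
  have "(\<integral>\<^sup>+x. ennreal (indicator {a..b} x * (f x)\<^sup>2) \<partial>lborel) \<le> (\<integral>\<^sup>+x. ennreal (e\<^sup>2) * indicator {a..b} x \<partial>lborel)"
  proof (rule nn_integral_mono)
    fix x
    show "ennreal (indicator {a..b} x * (f x)\<^sup>2) \<le> ennreal (e\<^sup>2) * indicator {a..b} x"
    proof (cases "x \<in> {a..b}")
      case True
      then have "(f x)\<^sup>2 \<le> e\<^sup>2" using assms(1)[OF True] assms(3) by (simp add: abs_le_square_iff[symmetric])
      with True show ?thesis by (simp add: ennreal_leI)
    qed simp
  qed
  also have "\<dots> = ennreal (e\<^sup>2) * ennreal (b - a)" using assms(2) by (simp add: nn_integral_cmult_indicator)
  also have "\<dots> = ennreal (e\<^sup>2 * (b - a))" using assms(2) by (simp add: ennreal_mult)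
  finally show ?thesis .
qed

context wave_data begin

definition lin :: "real \<Rightarrow> real \<Rightarrow> real" where "lin x t = \<phi> (x + t) + \<psi> (x - t)"

lemma \<phi>_continuous: "continuous_on UNIV \<phi>" by (rule primitive_continuous[OF p \<phi>])
lemma \<psi>_continuous: "continuous_on UNIV \<psi>" by (rule primitive_continuous[OF q \<psi>])

lemma lin_continuous: "continuous_on UNIV (\<lambda>p. lin (fst p) (snd p))"
  unfolding lin_def
  by (intro continuous_intros continuous_on_compose2[OF \<phi>_continuous] continuous_on_compose2[OF \<psi>_continuous]) auto

lemma lin_bounded:
  "\<exists>M. \<forall>x t. t \<ge> 0 \<longrightarrow> \<bar>x\<bar> + t \<le> R \<longrightarrow> \<bar>lin x t\<bar> \<le> M"
proof -
  have "compact ((\<lambda>p. lin (fst p) (snd p)) ` ({-R..R} \<times> {0..R}))"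
    by (intro compact_continuous_image continuous_on_subset[OF lin_continuous] compact_Times) auto
  then have "bounded ((\<lambda>p. lin (fst p) (snd p)) ` ({-R..R} \<times> {0..R}))" by (rule compact_imp_bounded)
  then obtain M where "\<forall>p\<in>{-R..R} \<times> {0..R}. \<bar>lin (fst p) (snd p)\<bar> \<le> M" unfolding bounded_iff by auto
  have "\<bar>lin x t\<bar> \<le> M" if "t \<ge> 0" "\<bar>x\<bar> + t \<le> R" for x t
  proof -
    have "(x, t) \<in> {-R..R} \<times> {0..R}" using that by (simp add: abs_le_iff) linarith
    with \<open>\<forall>p\<in>{-R..R} \<times> {0..R}. _\<close> show ?thesis by fastforce
  qed
  then show ?thesis by blast
qed

text \<open>Monotone iteration for the equation whose exponential is cut off at \<open>exp M\<close>. Replacing negative times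
by zero makes every iterate continuous on the whole plane.\<close>

fun picard :: "real \<Rightarrow> nat \<Rightarrow> real \<Rightarrow> real \<Rightarrow> real" where
  "picard M 0 x t = lin x t"
| "picard M (Suc n) x t = lin x t + duhamel (\<lambda>z \<tau>. exp (min (picard M n z \<tau>) M)) x (max t 0)"

lemma duhamel_continuous_extended:
  fixes f :: "real \<Rightarrow> real \<Rightarrow> real"
  assumes f: "continuous_on UNIV (\<lambda>p. f (fst p) (snd p))"
  shows "continuous_on UNIV (\<lambda>p. duhamel f (fst p) (max (snd p) 0))"
proof -
  have "continuous_on UNIV (\<lambda>p. (\<lambda>p. duhamel f (fst p) (snd p)) (fst p, max (snd p) 0))"
    by (rule continuous_on_compose2[OF duhamel_continuous[OF f]]) (auto intro!: continuous_intros)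
  then show ?thesis by simp
qed

lemma truncated_continuous:
  fixes v :: "real \<Rightarrow> real \<Rightarrow> real"
  assumes "continuous_on UNIV (\<lambda>p. v (fst p) (snd p))"
  shows "continuous_on UNIV (\<lambda>p. exp (min (v (fst p) (snd p)) M))"
  by (intro continuous_intros assms)

lemma picard_continuous: "continuous_on UNIV (\<lambda>p. picard M n (fst p) (snd p))"
proof (induction n)
  case 0
  then show ?case using lin_continuous by simp
next
  case (Suc n)
  then show ?case
    by (simp del: max_def) (intro continuous_intros lin_continuous duhamel_continuous_extended truncated_continuous)
qed

lemma picard_increasing: "picard M n x t \<le> picard M (Suc n) x t"
proof (induction n arbitrary: x t)
  case 0
  have "0 \<le> duhamel (\<lambda>z \<tau>. exp (min (picard M 0 z \<tau>) M)) x (max t 0)"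
    by (rule duhamel_nonneg[OF truncated_continuous[OF picard_continuous]]) auto
  then show ?case by simp
next
  case (Suc n)
  have "duhamel (\<lambda>z \<tau>. exp (min (picard M n z \<tau>) M)) x (max t 0) \<le> duhamel (\<lambda>z \<tau>. exp (min (picard M (Suc n) z \<tau>) M)) x (max t 0)"
  proof (rule duhamel_mono[OF truncated_continuous[OF picard_continuous] truncated_continuous[OF picard_continuous]])
    show "exp (min (picard M n z \<tau>) M) \<le> exp (min (picard M (Suc n) z \<tau>) M)" for z \<tau>
      unfolding exp_le_cancel_iff by (rule min.mono[OF Suc order.refl])
  qed
  then show ?case unfolding picard.simps(2)[of M "Suc n"] by (subst picard.simps(2)) simp
qed

lemma picard_bounded: "picard M n x t \<le> lin x t + exp M * (max t 0)\<^sup>2"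
proof (cases n)
  case (Suc m)
  have "duhamel (\<lambda>z \<tau>. exp (min (picard M m z \<tau>) M)) x (max t 0) \<le> duhamel (\<lambda>_ _. exp M) x (max t 0)"
    by (rule duhamel_mono[OF truncated_continuous[OF picard_continuous]]) auto
  also have "\<dots> \<le> exp M * (max t 0)\<^sup>2" by (rule duhamel_const_le) auto
  finally show ?thesis using Suc by simp
qed simp

text \<open>The convergence of the iteration is part of the notion, because it is the means of comparison with other
solutions.\<close>

definition truncated_solution :: "real \<Rightarrow> (real \<Rightarrow> real \<Rightarrow> real) \<Rightarrow> bool" where
  "truncated_solution M v \<longleftrightarrow> continuous_on UNIV (\<lambda>p. v (fst p) (snd p)) \<and>
     (\<forall>x t. t \<ge> 0 \<longrightarrow> v x t = lin x t + duhamel (\<lambda>z \<tau>. exp (min (v z \<tau>) M)) x t) \<and>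
     (\<forall>x t. (\<lambda>n. picard M n x t) \<longlonglongrightarrow> v x t)"

lemma truncated_solution_exists: "\<exists>v. truncated_solution M v"
proof -
  define v where "v x t = lim (\<lambda>n. picard M n x t)" for x t
  have lim: "(\<lambda>n. picard M n x t) \<longlonglongrightarrow> v x t" for x t
  proof -
    have "incseq (\<lambda>n. picard M n x t)" by (rule incseq_SucI) (rule picard_increasing)
    moreover have "picard M n x t \<le> lin x t + exp M * (max t 0)\<^sup>2" for n by (rule picard_bounded)
    ultimately obtain L where "(\<lambda>n. picard M n x t) \<longlonglongrightarrow> L" using incseq_convergent[of "\<lambda>n. picard M n x t"] by blast
    then show ?thesis unfolding v_def by (simp add: limI)
  qed
  let ?f = "\<lambda>n z \<tau>. exp (min (picard M n z \<tau>) M)"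
  have fc: "continuous_on UNIV (\<lambda>p. ?f n (fst p) (snd p))" for n
    by (rule truncated_continuous[OF picard_continuous])
  have eq: "v x t = lin x t + duhamel (\<lambda>z \<tau>. exp (min (v z \<tau>) M)) x (max t 0)" for x t
  proof -
    have "(\<lambda>n. duhamel (?f n) x (max t 0)) \<longlonglongrightarrow> duhamel (\<lambda>z \<tau>. exp (min (v z \<tau>) M)) x (max t 0)"
      by (rule duhamel_bounded_convergence[where K = "exp M"]) (auto intro!: fc tendsto_intros lim)
    then have "(\<lambda>n. picard M (Suc n) x t) \<longlonglongrightarrow> lin x t + duhamel (\<lambda>z \<tau>. exp (min (v z \<tau>) M)) x (max t 0)"
      unfolding picard.simps(2) by (intro tendsto_add tendsto_const)
    from LIMSEQ_unique[OF LIMSEQ_Suc[OF lim] this] show ?thesis .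
  qed
  \<comment> \<open>The nonlinear parts of the iterates are uniformly Lipschitz on time strips, hence so is their limit.\<close>
  define w where "w x t = v x t - lin x t" for x t
  have wlip: "\<bar>w x t - w x' t'\<bar> \<le> exp M * c * (\<bar>x - x'\<bar> + \<bar>t - t'\<bar>)" if c: "t \<le> c" "t' \<le> c" "0 \<le> c" for x t x' t' c
  proof -
    have "(\<lambda>n. \<bar>(picard M (Suc n) x t - lin x t) - (picard M (Suc n) x' t' - lin x' t')\<bar>) \<longlonglongrightarrow> \<bar>w x t - w x' t'\<bar>"
      unfolding w_def by (intro tendsto_intros LIMSEQ_Suc[OF lim])
    moreover have "\<bar>(picard M (Suc n) x t - lin x t) - (picard M (Suc n) x' t' - lin x' t')\<bar> \<le> exp M * c * (\<bar>x - x'\<bar> + \<bar>t - t'\<bar>)" for n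
    proof -
      have "\<bar>duhamel (?f n) x (max t 0) - duhamel (?f n) x' (max t' 0)\<bar> \<le> exp M * c * (\<bar>x - x'\<bar> + \<bar>max t 0 - max t' 0\<bar>)"
        using c by (intro duhamel_lipschitz fc) auto
      also have "\<dots> \<le> exp M * c * (\<bar>x - x'\<bar> + \<bar>t - t'\<bar>)"
        using c(3) by (intro mult_left_mono add_left_mono) auto
      finally show ?thesis by simp
    qed
    ultimately show ?thesis by (intro LIMSEQ_le_const2) auto
  qed
  have wc: "continuous_on UNIV (\<lambda>p. w (fst p) (snd p))"
  proof (rule continuous_at_imp_continuous_on, rule ballI)
    fix P :: "real \<times> real"
    define c where "c = \<bar>snd P\<bar> + 1"
    have "((\<lambda>Q. w (fst Q) (snd Q)) \<longlongrightarrow> w (fst P) (snd P)) (at P)"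
    proof (rule LIM_zero_cancel, rule Lim_null_comparison[where g = "\<lambda>Q. exp M * c * (\<bar>fst Q - fst P\<bar> + \<bar>snd Q - snd P\<bar>)"])
      have "eventually (\<lambda>Q. dist Q P < 1) (at P)" by (rule eventually_at[THEN iffD2]) (auto intro!: exI[of _ 1])
      then show "\<forall>\<^sub>F Q in at P. norm (w (fst Q) (snd Q) - w (fst P) (snd P)) \<le> exp M * c * (\<bar>fst Q - fst P\<bar> + \<bar>snd Q - snd P\<bar>)"
      proof eventually_elim
        case (elim Q)
        have "\<bar>snd Q - snd P\<bar> < 1" using elim dist_snd_le[of Q P] by (simp add: dist_real_def)
        then have "snd Q \<le> c" "snd P \<le> c" "0 \<le> c" by (auto simp: c_def)
        from wlip[OF this] show ?case using \<open>0 \<le> c\<close> by simp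
      qed
      have "((\<lambda>Q. exp M * c * (\<bar>fst Q - fst P\<bar> + \<bar>snd Q - snd P\<bar>)) \<longlongrightarrow> exp M * c * (\<bar>fst P - fst P\<bar> + \<bar>snd P - snd P\<bar>)) (at P)"
        by (intro tendsto_intros)
      then show "((\<lambda>Q. exp M * c * (\<bar>fst Q - fst P\<bar> + \<bar>snd Q - snd P\<bar>)) \<longlongrightarrow> 0) (at P)" by simp
    qed
    then show "isCont (\<lambda>p. w (fst p) (snd p)) P" by (simp add: isCont_def)
  qed
  have vc: "continuous_on UNIV (\<lambda>p. v (fst p) (snd p))"
    using continuous_on_add[OF lin_continuous wc] by (simp add: w_def)
  have "v x t = lin x t + duhamel (\<lambda>z \<tau>. exp (min (v z \<tau>) M)) x t" if "t \<ge> 0" for x t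
    using eq[of x t] that by (simp add: max_absorb1)
  with vc lim show ?thesis unfolding truncated_solution_def by blast
qed

text \<open>The iteration starts below \<open>w\<close>, and the truncated exponential of an iterate below \<open>w\<close> is below the
source of \<open>w\<close> on the whole cone.\<close>

lemma picard_le:
  fixes f w :: "real \<Rightarrow> real \<Rightarrow> real"
  assumes f: "continuous_on UNIV (\<lambda>p. f (fst p) (snd p))" "\<And>z \<tau>. 0 \<le> f z \<tau>"
    and w: "\<And>x t. (x, t) \<in> closed_cone a s \<Longrightarrow> w x t = lin x t + duhamel f x t \<and> f x t = exp (w x t)"
    and xt: "(x, t) \<in> closed_cone a s"
  shows "picard M n x t \<le> w x t"
  using xt
proof (induction n arbitrary: x t)
  case 0
  have "0 \<le> duhamel f x t" by (rule duhamel_nonneg[OF f(1)]) (rule f(2))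
  with w[OF 0] show ?case by simp
next
  case (Suc n)
  have t: "t \<ge> 0" using Suc.prems by (auto simp: closed_cone_def)
  have "duhamel (\<lambda>z \<tau>. exp (min (picard M n z \<tau>) M)) x t \<le> duhamel f x t"
  proof (rule duhamel_mono[OF truncated_continuous[OF picard_continuous] f(1)])
    fix z \<tau> assume "0 \<le> \<tau>" "\<bar>z - x\<bar> \<le> t - \<tau>"
    then have "(z, \<tau>) \<in> closed_cone a s" using Suc.prems by (auto simp: closed_cone_def)
    with Suc.IH[OF this] w[OF this] show "exp (min (picard M n z \<tau>) M) \<le> f z \<tau>" by simp
  qed
  with w[OF Suc.prems] t show ?case by (simp add: max_absorb1)
qed

end

section \<open>Regularity of solutions with bounded source\<close>

context wave_data begin

lemma L2_translation_small:
  assumes r: "L2_loc r" and e: "e > 0"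
  shows "\<exists>d>0. \<forall>h. \<bar>h\<bar> < d \<longrightarrow>
    (\<integral>\<^sup>+x. ennreal (indicator {a..b} x * (r (x + c + h) - r (x + c))\<^sup>2) \<partial>lborel) \<le> ennreal e"
  using translation_continuous_L2[OF L2_loc_shift[OF r, of c] e, of a b]
  by (simp add: ac_simps) (meson order.strict_trans2)

lemma time_tendsto_zero:
  fixes D :: "real \<Rightarrow> real"
  assumes "\<And>e. e > 0 \<Longrightarrow> \<exists>d>0. \<forall>\<tau>\<in>{0..<c}. \<tau> \<noteq> t \<longrightarrow> \<bar>\<tau> - t\<bar> < d \<longrightarrow> D \<tau> \<le> e" "\<And>\<tau>. 0 \<le> D \<tau>"
  shows "(D \<longlongrightarrow> 0) (at t within {0..<c})"
  unfolding Lim_within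
proof (intro allI impI)
  fix e :: real assume e: "0 < e"
  obtain d where "d > 0" "\<forall>\<tau>\<in>{0..<c}. \<tau> \<noteq> t \<longrightarrow> \<bar>\<tau> - t\<bar> < d \<longrightarrow> D \<tau> \<le> e / 2"
    using assms(1)[of "e/2"] e by auto
  then show "\<exists>d>0. \<forall>x\<in>{0..<c}. 0 < dist x t \<and> dist x t < d \<longrightarrow> dist (D x) 0 < e"
    using assms(2) e by (intro exI[of _ d]) (fastforce simp: dist_real_def)
qed

context
  fixes f :: "real \<Rightarrow> real \<Rightarrow> real"
  assumes f: "continuous_on UNIV (\<lambda>p. f (fst p) (snd p))"
begin

definition nonlin_dx :: "real \<Rightarrow> real \<Rightarrow> real" where
  "nonlin_dx x t = (right_ray f x t - left_ray f x t) / 2"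

definition nonlin_dt :: "real \<Rightarrow> real \<Rightarrow> real" where
  "nonlin_dt x t = (right_ray f x t + left_ray f x t) / 2"

lemma nonlin_dx_continuous: "continuous_on (UNIV \<times> {0..}) (\<lambda>p. nonlin_dx (fst p) (snd p))"
  unfolding nonlin_dx_def by (intro continuous_intros right_ray_continuous left_ray_continuous f) auto

lemma nonlin_dt_continuous: "continuous_on (UNIV \<times> {0..}) (\<lambda>p. nonlin_dt (fst p) (snd p))"
  unfolding nonlin_dt_def by (intro continuous_intros right_ray_continuous left_ray_continuous f) auto

lemma duhamel_space_derivative:
  assumes "t \<ge> 0" shows "((\<lambda>x. duhamel f x t) has_real_derivative nonlin_dx x t) (at x)"
proof -
  have "((\<lambda>h. duhamel f h t) has_real_derivative (right_ray f x t * (0 + 1) + left_ray f x t * (0 - 1)) / 2) (at x within UNIV)"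
    by (rule duhamel_derivative_along[OF f, of "\<lambda>h. h" 1 x UNIV "\<lambda>_. t" 0]) (use assms in auto)
  then show ?thesis by (simp add: nonlin_dx_def)
qed

lemma duhamel_time_derivative:
  assumes "t \<ge> 0" shows "((\<lambda>t. duhamel f x t) has_real_derivative nonlin_dt x t) (at t within {0..})"
proof -
  have "((\<lambda>h. duhamel f x h) has_real_derivative (right_ray f x t * (1 + 0) + left_ray f x t * (1 - 0)) / 2) (at t within {0..})"
    by (rule duhamel_derivative_along[OF f, of "\<lambda>_. x" 0 t "{0..}" "\<lambda>h. h" 1]) (use assms in auto)
  then show ?thesis by (simp add: nonlin_dt_def)
qed

lemma duhamel_time_difference_quotient:
  assumes b: "\<And>s. s \<in> closed_segment t \<tau> \<Longrightarrow> \<bar>nonlin_dt x s - nonlin_dt x t\<bar> \<le> e"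
    and t: "0 \<le> t" "0 \<le> \<tau>" "\<tau> \<noteq> t"
  shows "\<bar>(duhamel f x \<tau> - duhamel f x t) / (\<tau> - t) - nonlin_dt x t\<bar> \<le> e"
proof -
  have seg: "closed_segment t \<tau> \<subseteq> {0..}" using t by (auto simp: closed_segment_eq_real_ivl split: if_splits)
  let ?k = "\<lambda>s. duhamel f x s - s * nonlin_dt x t"
  have "norm (?k \<tau> - ?k t) \<le> e * norm (\<tau> - t)"
  proof (rule field_differentiable_bound[of "closed_segment t \<tau>"])
    fix s assume s: "s \<in> closed_segment t \<tau>"
    then have "s \<ge> 0" using seg by auto
    then show "(?k has_real_derivative (nonlin_dt x s - nonlin_dt x t)) (at s within closed_segment t \<tau>)"
      using has_field_derivative_subset[OF duhamel_time_derivative seg] by (auto intro!: derivative_eq_intros)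
    show "norm (nonlin_dt x s - nonlin_dt x t) \<le> e" using b[OF s] by simp
  qed auto
  moreover have "(duhamel f x \<tau> - duhamel f x t) / (\<tau> - t) - nonlin_dt x t = (?k \<tau> - ?k t) / (\<tau> - t)"
    using t by (simp add: field_simps)
  ultimately show ?thesis using t by (simp add: divide_le_eq)
qed

text \<open>The pieces have the required regularity for different reasons: the travelling waves by continuity of
translations and convergence of difference quotients in mean square, the Duhamel term because it is
continuously differentiable.\<close>

lemma solution_of_bounded_source:
  fixes v :: "real \<Rightarrow> real \<Rightarrow> real"
  assumes vc: "continuous_on UNIV (\<lambda>p. v (fst p) (snd p))"
    and v: "\<And>x t. t \<ge> 0 \<Longrightarrow> v x t = lin x t + duhamel f x t"
    and src: "\<And>x t. (x, t) \<in> closed_cone x0 t0 \<Longrightarrow> f x t = exp (v x t)"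
  shows "solution_on_cone u0 u1 v (\<lambda>x t. p (x + t) + q (x - t) + nonlin_dx x t)
    (\<lambda>x t. p (x + t) - q (x - t) + nonlin_dt x t) x0 t0"
proof -
  define vx where "vx x t = p (x + t) + q (x - t) + nonlin_dx x t" for x t
  define vt where "vt x t = p (x + t) - q (x - t) + nonlin_dt x t" for x t
  note [measurable] = L2_loc_measurable[OF p] L2_loc_measurable[OF q]
  have slice: "continuous_on UNIV (\<lambda>x. g x t)" if "continuous_on (UNIV \<times> {0..}) (\<lambda>p. g (fst p) (snd p))" "t \<ge> 0"
    for g :: "real \<Rightarrow> real \<Rightarrow> real" and t
  proof -
    have "continuous_on UNIV (\<lambda>x. (\<lambda>p. g (fst p) (snd p)) (x, t))"
      by (rule continuous_on_compose2[OF that(1)]) (use that(2) in \<open>auto intro!: continuous_intros\<close>)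
    then show ?thesis by simp
  qed
  have slice_v: "continuous_on UNIV (\<lambda>x. v x t)" for t
    by (rule continuous_on_slice[OF vc]) (auto intro!: continuous_intros)
  have pm: "L2_loc (\<lambda>x. p (x + t))" and qm: "L2_loc (\<lambda>x. q (x - t))" for t
    using L2_loc_shift[OF p, of t] L2_loc_shift[OF q, of "-t"] by simp_all
  have dxm: "L2_loc (\<lambda>x. nonlin_dx x t)" if "t \<ge> 0" for t
    using slice[OF nonlin_dx_continuous that] by (rule L2_loc_continuous)
  have dtm: "L2_loc (\<lambda>x. nonlin_dt x t)" if "t \<ge> 0" for t
    using slice[OF nonlin_dt_continuous that] by (rule L2_loc_continuous)
  have vxm: "L2_loc (\<lambda>x. vx x t)" if "t \<ge> 0" for t
    unfolding vx_def by (intro L2_loc_add pm qm dxm that)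
  have vtm: "L2_loc (\<lambda>x. vt x t)" if "t \<ge> 0" for t
    unfolding vt_def by (intro L2_loc_add L2_loc_diff pm qm dtm that)
  have prim: "primitive (\<lambda>x. v x t) (\<lambda>x. vx x t)" if t: "t \<ge> 0" for t
  proof -
    have "primitive (\<lambda>x. \<phi> (x + t) + \<psi> (x + (- t)) + duhamel f x t) (\<lambda>x. p (x + t) + q (x + (- t)) + nonlin_dx x t)"
      by (intro primitive_add L2_loc_add L2_loc_shift primitive_shift primitive_of_derivative duhamel_space_derivative p q \<phi> \<psi> dxm t)
    then show ?thesis using t by (simp add: v lin_def vx_def)
  qed
  define a b where "a = x0 - t0" and "b = x0 + t0"
  have sub: "ball x0 (t0 - s) \<subseteq> {a..b}" "ball x0 (t0 - s) \<in> sets borel" if "s \<ge> 0" for s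
    using that by (auto simp: a_def b_def dist_real_def)
  have sub': "ball x0 (t0 - max t s) \<subseteq> {a..b}" if "t \<in> {0..<t0}" for t s
    by (rule sub) (use that in auto)
  have bm: "(\<lambda>x. g x) \<in> borel_measurable borel" if "L2_loc g" for g using L2_loc_measurable[OF that] .
  have small: "\<exists>d>0. \<forall>\<tau>\<in>{0..t0}. \<bar>\<tau> - t\<bar> < d \<longrightarrow> (\<forall>s\<in>closed_segment t \<tau>. \<forall>x\<in>{a..b}. \<bar>g x s - g x t\<bar> \<le> e)"
    if gc: "continuous_on (UNIV \<times> {0..}) (\<lambda>p. g (fst p) (snd p))" and e: "e > 0" and t: "t \<in> {0..<t0}" for g :: "real \<Rightarrow> real \<Rightarrow> real" and e t
  proof -
    obtain d where d: "d > 0" "\<forall>x\<in>{a..b}. \<forall>\<tau>\<in>{0..t0}. \<bar>\<tau> - t\<bar> < d \<longrightarrow> \<bar>g x \<tau> - g x t\<bar> \<le> e"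
      using uniform_in_time[OF gc e, of t t0 a b] t by auto
    show ?thesis
    proof (intro exI[of _ d] conjI ballI impI d(1))
      fix \<tau> s x assume "\<tau> \<in> {0..t0}" "\<bar>\<tau> - t\<bar> < d" "s \<in> closed_segment t \<tau>" "x \<in> {a..b}"
      then show "\<bar>g x s - g x t\<bar> \<le> e"
        using d(2) t by (auto simp: closed_segment_eq_real_ivl split: if_splits)
    qed
  qed
  have unif: "(\<integral>\<^sup>+x. ennreal (indicator {a..b} x * (g x)\<^sup>2) \<partial>lborel) \<le> ennreal (e\<^sup>2 / 9)"
    if "\<And>x. x \<in> {a..b} \<Longrightarrow> \<bar>g x\<bar> \<le> e / (3 * (1 + sqrt (b - a)))" "e > 0" "t0 > 0" for g :: "real \<Rightarrow> real" and e
  proof -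
    have ab: "a \<le> b" using that(3) by (simp add: a_def b_def)
    have pos: "0 < 3 * (1 + sqrt (b - a))" using ab by (simp add: add_pos_nonneg)
    have "(\<integral>\<^sup>+x. ennreal (indicator {a..b} x * (g x)\<^sup>2) \<partial>lborel) \<le> ennreal ((e / (3 * (1 + sqrt (b - a))))\<^sup>2 * (b - a))"
      by (rule nn_integral_uniform_bound[OF that(1) ab]) (use pos that(2) in auto)
    also have "\<dots> \<le> ennreal (e\<^sup>2 / 9)"
    proof (rule ennreal_leI)
      have "(b - a) \<le> (1 + sqrt (b - a))\<^sup>2" using ab by (simp add: power2_eq_square algebra_simps)
      then have "e\<^sup>2 * (b - a) \<le> e\<^sup>2 * (1 + sqrt (b - a))\<^sup>2" by (intro mult_left_mono) auto
      moreover have "(e / (3 * (1 + sqrt (b - a))))\<^sup>2 * (b - a) = e\<^sup>2 * (b - a) / (9 * (1 + sqrt (b - a))\<^sup>2)"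
      proof -
        have "(e / (3 * k))\<^sup>2 * c = e\<^sup>2 * c / (9 * k\<^sup>2)" for k c :: real
          by (simp add: power_divide power_mult_distrib)
        then show ?thesis .
      qed
      moreover have "0 < (1 + sqrt (b - a))\<^sup>2" using pos by simp
      ultimately show "(e / (3 * (1 + sqrt (b - a))))\<^sup>2 * (b - a) \<le> e\<^sup>2 / 9"
        by (simp add: divide_le_eq mult_ac)
    qed
    finally show ?thesis .
  qed
  have scale: "0 < e / (3 * (1 + sqrt (b - a)))" if "e > 0" "t0 > 0" for e
    using that by (auto simp: a_def b_def intro!: divide_pos_pos add_pos_nonneg)
  have e9: "0 < e\<^sup>2 / 9" if "e > 0" for e :: real using that by simp
  \<comment> \<open>All four limits in the definition of a solution are sums of an L2 translation or difference
    quotient of p, one of q, and a uniformly small continuous function.\<close>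
  have lim_vt: "((\<lambda>\<tau>. L2_norm_on (ball x0 (t0 - max t \<tau>)) (\<lambda>x. (v x \<tau> - v x t) / (\<tau> - t) - vt x t)) \<longlongrightarrow> 0) (at t within {0..<t0})"
    if t: "t \<in> {0..<t0}" for t
  proof (rule time_tendsto_zero[OF _ L2_norm_on_nonneg])
    fix e :: real assume e: "e > 0"
    obtain d1 where d1: "d1 > 0" "\<And>h. h \<noteq> 0 \<Longrightarrow> \<bar>h\<bar> < d1 \<Longrightarrow>
      (\<integral>\<^sup>+x. ennreal (indicator {a..b} x * ((\<phi> (x + h + t) - \<phi> (x + t)) / h - p (x + t))\<^sup>2) \<partial>lborel) \<le> ennreal (e\<^sup>2 / 9)"
      using primitive_difference_quotient_L2[OF L2_loc_shift[OF p, of t] primitive_shift[OF \<phi> p, of t] e9[OF e], of a b] by auto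
    obtain d2 where d2: "d2 > 0" "\<And>h. h \<noteq> 0 \<Longrightarrow> \<bar>h\<bar> < d2 \<Longrightarrow>
      (\<integral>\<^sup>+x. ennreal (indicator {a..b} x * ((\<psi> (x + h + - t) - \<psi> (x + - t)) / h - q (x + - t))\<^sup>2) \<partial>lborel) \<le> ennreal (e\<^sup>2 / 9)"
      using primitive_difference_quotient_L2[OF L2_loc_shift[OF q, of "-t"] primitive_shift[OF \<psi> q, of "-t"] e9[OF e], of a b] by blast
    have t0: "t0 > 0" using t by auto
    obtain d3 where d3: "d3 > 0" "\<forall>\<tau>\<in>{0..t0}. \<bar>\<tau> - t\<bar> < d3 \<longrightarrow> (\<forall>s\<in>closed_segment t \<tau>. \<forall>x\<in>{a..b}. \<bar>nonlin_dt x s - nonlin_dt x t\<bar> \<le> e / (3 * (1 + sqrt (b - a))))"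
      using small[OF nonlin_dt_continuous scale[OF e t0] t] by auto
    show "\<exists>d>0. \<forall>\<tau>\<in>{0..<t0}. \<tau> \<noteq> t \<longrightarrow> \<bar>\<tau> - t\<bar> < d \<longrightarrow> L2_norm_on (ball x0 (t0 - max t \<tau>)) (\<lambda>x. (v x \<tau> - v x t) / (\<tau> - t) - vt x t) \<le> e"
    proof (intro exI[of _ "min d1 (min d2 d3)"] conjI ballI impI)
      fix \<tau> assume \<tau>: "\<tau> \<in> {0..<t0}" "\<tau> \<noteq> t" "\<bar>\<tau> - t\<bar> < min d1 (min d2 d3)"
      let ?f1 = "\<lambda>x. (\<phi> (x + \<tau>) - \<phi> (x + t)) / (\<tau> - t) - p (x + t)"
      let ?f2 = "\<lambda>x. (\<psi> (x - \<tau>) - \<psi> (x - t)) / (\<tau> - t) + q (x - t)"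
      let ?f3 = "\<lambda>x. (duhamel f x \<tau> - duhamel f x t) / (\<tau> - t) - nonlin_dt x t"
      have "(\<lambda>x. (v x \<tau> - v x t) / (\<tau> - t) - vt x t) = (\<lambda>x. ?f1 x + ?f2 x + ?f3 x)"
        using \<tau> t by (auto simp: v lin_def vt_def add_divide_distrib diff_divide_distrib)
      moreover have "L2_norm_on (ball x0 (t0 - max t \<tau>)) (\<lambda>x. ?f1 x + ?f2 x + ?f3 x) \<le> e"
      proof (rule L2_norm_on_sum3_le)
        have [measurable]: "\<phi> \<in> borel_measurable borel" "\<psi> \<in> borel_measurable borel"
          using borel_measurable_continuous_onI[OF \<phi>_continuous] borel_measurable_continuous_onI[OF \<psi>_continuous] by auto
        show "?f1 \<in> borel_measurable borel" "?f2 \<in> borel_measurable borel" by measurable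
        have cd: "(\<lambda>x. duhamel f x s) \<in> borel_measurable borel" if "s \<ge> 0" for s
          by (rule borel_measurable_continuous_onI) (rule slice[OF duhamel_continuous[OF f] that])
        show "?f3 \<in> borel_measurable borel"
          using cd[of \<tau>] cd[of t] bm[OF dtm[of t]] \<tau> t by auto
        show "(\<integral>\<^sup>+x. ennreal (indicator {a..b} x * (?f1 x)\<^sup>2) \<partial>lborel) \<le> ennreal (e\<^sup>2 / 9)"
          using d1(2)[of "\<tau> - t"] \<tau> by (simp add: add.assoc)
        have "?f2 x = - ((\<psi> (x + (t - \<tau>) + - t) - \<psi> (x + - t)) / (t - \<tau>) - q (x + - t))" for x
          using \<tau>(2) by (simp add: field_simps)
        then show "(\<integral>\<^sup>+x. ennreal (indicator {a..b} x * (?f2 x)\<^sup>2) \<partial>lborel) \<le> ennreal (e\<^sup>2 / 9)"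
          using d2(2)[of "t - \<tau>"] \<tau> by (simp only: power2_minus)
        show "(\<integral>\<^sup>+x. ennreal (indicator {a..b} x * (?f3 x)\<^sup>2) \<partial>lborel) \<le> ennreal (e\<^sup>2 / 9)"
          by (rule unif[OF duhamel_time_difference_quotient e t0]) (use d3(2) \<tau> t in auto)
      qed (use e in \<open>simp_all add: sub'[OF t]\<close>)
      ultimately show "L2_norm_on (ball x0 (t0 - max t \<tau>)) (\<lambda>x. (v x \<tau> - v x t) / (\<tau> - t) - vt x t) \<le> e" by simp
    qed (use d1(1) d2(1) d3(1) in auto)
  qed
  have cont: "((\<lambda>\<tau>. L2_norm_on (ball x0 (t0 - max t \<tau>)) (\<lambda>x. F x \<tau> - F x t)) \<longlongrightarrow> 0) (at t within {0..<t0})"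
    if t: "t \<in> {0..<t0}" and F: "\<And>x t. t \<ge> 0 \<Longrightarrow> F x t = P (x + t) + Q (x - t) + W x t"
      and PQ: "L2_loc P" "L2_loc Q" and W: "continuous_on (UNIV \<times> {0..}) (\<lambda>p. W (fst p) (snd p))" for t P Q W F
  proof (rule time_tendsto_zero[OF _ L2_norm_on_nonneg])
    note [measurable] = bm[OF PQ(1)] bm[OF PQ(2)]
    fix e :: real assume e: "e > 0"
    obtain d1 where d1: "d1 > 0" "\<And>h. \<bar>h\<bar> < d1 \<Longrightarrow>
      (\<integral>\<^sup>+x. ennreal (indicator {a..b} x * (P (x + t + h) - P (x + t))\<^sup>2) \<partial>lborel) \<le> ennreal (e\<^sup>2 / 9)"
      using L2_translation_small[OF PQ(1) e9[OF e], of a b t] by auto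
    obtain d2 where d2: "d2 > 0" "\<And>h. \<bar>h\<bar> < d2 \<Longrightarrow>
      (\<integral>\<^sup>+x. ennreal (indicator {a..b} x * (Q (x + - t + h) - Q (x + - t))\<^sup>2) \<partial>lborel) \<le> ennreal (e\<^sup>2 / 9)"
      using L2_translation_small[OF PQ(2) e9[OF e], of a b "-t"] by blast
    have t0: "t0 > 0" using t by auto
    obtain d3 where d3: "d3 > 0" "\<forall>\<tau>\<in>{0..t0}. \<bar>\<tau> - t\<bar> < d3 \<longrightarrow> (\<forall>s\<in>closed_segment t \<tau>. \<forall>x\<in>{a..b}. \<bar>W x s - W x t\<bar> \<le> e / (3 * (1 + sqrt (b - a))))"
      using small[OF W scale[OF e t0] t] by auto
    show "\<exists>d>0. \<forall>\<tau>\<in>{0..<t0}. \<tau> \<noteq> t \<longrightarrow> \<bar>\<tau> - t\<bar> < d \<longrightarrow> L2_norm_on (ball x0 (t0 - max t \<tau>)) (\<lambda>x. F x \<tau> - F x t) \<le> e"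
    proof (intro exI[of _ "min d1 (min d2 d3)"] conjI ballI impI)
      fix \<tau> assume \<tau>: "\<tau> \<in> {0..<t0}" "\<tau> \<noteq> t" "\<bar>\<tau> - t\<bar> < min d1 (min d2 d3)"
      have "(\<lambda>x. F x \<tau> - F x t) = (\<lambda>x. (P (x + \<tau>) - P (x + t)) + (Q (x - \<tau>) - Q (x - t)) + (W x \<tau> - W x t))"
        using \<tau> t by (auto simp: F)
      moreover have "L2_norm_on (ball x0 (t0 - max t \<tau>)) (\<lambda>x. (P (x + \<tau>) - P (x + t)) + (Q (x - \<tau>) - Q (x - t)) + (W x \<tau> - W x t)) \<le> e"
      proof (rule L2_norm_on_sum3_le)
        show "(\<lambda>x. P (x + \<tau>) - P (x + t)) \<in> borel_measurable borel" "(\<lambda>x. Q (x - \<tau>) - Q (x - t)) \<in> borel_measurable borel"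
          by measurable
        have cd: "(\<lambda>x. W x s) \<in> borel_measurable borel" if "s \<ge> 0" for s
          by (rule borel_measurable_continuous_onI) (rule slice[OF W that])
        show "(\<lambda>x. W x \<tau> - W x t) \<in> borel_measurable borel"
          using cd[of \<tau>] cd[of t] \<tau> t by auto
        show "(\<integral>\<^sup>+x. ennreal (indicator {a..b} x * (P (x + \<tau>) - P (x + t))\<^sup>2) \<partial>lborel) \<le> ennreal (e\<^sup>2 / 9)"
          using d1(2)[of "\<tau> - t"] \<tau> by simp
        show "(\<integral>\<^sup>+x. ennreal (indicator {a..b} x * (Q (x - \<tau>) - Q (x - t))\<^sup>2) \<partial>lborel) \<le> ennreal (e\<^sup>2 / 9)"
          using d2(2)[of "t - \<tau>"] \<tau> by (simp add: abs_minus_commute)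
        show "(\<integral>\<^sup>+x. ennreal (indicator {a..b} x * (W x \<tau> - W x t)\<^sup>2) \<partial>lborel) \<le> ennreal (e\<^sup>2 / 9)"
          by (rule unif[OF _ e t0]) (use d3(2) \<tau> t in auto)
      qed (use e in \<open>simp_all add: sub'[OF t]\<close>)
      ultimately show "L2_norm_on (ball x0 (t0 - max t \<tau>)) (\<lambda>x. F x \<tau> - F x t) \<le> e" by simp
    qed (use d1(1) d2(1) d3(1) in auto)
  qed
  have duh: "v x t = (u0 (x - t) + u0 (x + t)) / 2 + (LINT z:{x - t..x + t}|lebesgue. u1 z) / 2
      + (LINT \<tau>:{0..t}|lebesgue. (LINT z:{x - t + \<tau>..x + t - \<tau>}|lebesgue. exp (v z \<tau>))) / 2"
    if "(x, t) \<in> backward_cone x0 t0 1" for x t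
  proof -
    have t: "t \<ge> 0" "\<bar>x - x0\<bar> \<le> t0 - t" using that by (auto simp: backward_cone_def)
    have "duhamel f x t = duhamel (\<lambda>z \<tau>. exp (v z \<tau>)) x t"
      by (rule duhamel_cong, rule src) (use t in \<open>auto simp: closed_cone_def\<close>)
    also have "\<dots> = (LINT \<tau>:{0..t}|lebesgue. (LINT z:{x - t + \<tau>..x + t - \<tau>}|lebesgue. exp (v z \<tau>))) / 2"
      by (rule duhamel_lebesgue[symmetric]) (intro continuous_intros vc)
    finally show ?thesis using v[OF t(1), of x] dalembert[OF t(1), of x] by (simp add: lin_def)
  qed
  have "solution_on_cone u0 u1 v vx vt x0 t0"
    unfolding solution_on_cone_def
  proof (intro conjI ballI)
    fix t assume t: "t \<in> {0..<t0}"
    then have t': "t \<ge> 0" by simp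
    show "continuous_on (ball x0 (t0 - t)) (\<lambda>x. v x t)" by (rule continuous_on_subset[OF slice_v]) simp
    show "(\<lambda>x. v x t) \<in> L2_on (ball x0 (t0 - t))" by (intro L2_loc_imp_L2_on L2_loc_continuous slice_v)
    show "(\<lambda>x. vx x t) \<in> L2_on (ball x0 (t0 - t))" by (intro L2_loc_imp_L2_on vxm t')
    show "(\<lambda>x. vt x t) \<in> L2_on (ball x0 (t0 - t))" by (intro L2_loc_imp_L2_on vtm t')
    show "has_weak_deriv_on (\<lambda>x. v x t) (\<lambda>x. vx x t) (ball x0 (t0 - t))"
      by (intro primitive_has_weak_deriv vxm prim t' open_ball)
    show "((\<lambda>\<tau>. L2_norm_on (ball x0 (t0 - max t \<tau>)) (\<lambda>x. (v x \<tau> - v x t) / (\<tau> - t) - vt x t)) \<longlongrightarrow> 0) (at t within {0..<t0})"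
      by (rule lim_vt[OF t])
  next
    fix t F assume t: "t \<in> {0..<t0}" and "F \<in> {v, vx, vt}"
    then consider "F = v" | "F = vx" | "F = vt" by blast
    then show "((\<lambda>\<tau>. L2_norm_on (ball x0 (t0 - max t \<tau>)) (\<lambda>x. F x \<tau> - F x t)) \<longlongrightarrow> 0) (at t within {0..<t0})"
    proof cases
      case 1
      show ?thesis
        by (rule cont[OF t, of F \<phi> \<psi> "duhamel f"])
           (auto simp: 1 v lin_def intro!: L2_loc_continuous \<phi>_continuous \<psi>_continuous duhamel_continuous[OF f])
    next
      case 2
      show ?thesis
        by (rule cont[OF t, of F p q nonlin_dx]) (auto simp: 2 vx_def p q nonlin_dx_continuous)
    next
      case 3
      show ?thesis
        by (rule cont[OF t, of F p "\<lambda>x. (-1) * q x" nonlin_dt])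
           (auto simp: 3 vt_def p L2_loc_cmult[OF q, of "-1", simplified] nonlin_dt_continuous)
    qed
  next
    fix xt assume "xt \<in> backward_cone x0 t0 1"
    then show "case xt of (x, t) \<Rightarrow> v x t = (u0 (x - t) + u0 (x + t)) / 2 + (LINT z:{x - t..x + t}|lebesgue. u1 z) / 2
      + (LINT \<tau>:{0..t}|lebesgue. (LINT z:{x - t + \<tau>..x + t - \<tau>}|lebesgue. exp (v z \<tau>))) / 2"
      using duh by auto
  qed
  then show ?thesis unfolding vx_def[abs_def] vt_def[abs_def] .
qed

end

end

section \<open>Solutions on backward cones\<close>

lemma ball_subset_of_cone:
  fixes x0 x1 :: real
  assumes "\<bar>x1 - x0\<bar> \<le> t0 - t1" shows "ball x1 (t1 - t) \<subseteq> ball x0 (t0 - t)"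
  using assms by (auto simp: dist_real_def)

lemma L2_on_subset:
  assumes "f \<in> L2_on S" "S' \<subseteq> S" "S' \<in> sets lebesgue"
  shows "f \<in> L2_on S'"
  using assms set_integrable_subset[of lebesgue S "\<lambda>x. (f x)\<^sup>2" S'] set_borel_measurable_subset[of lebesgue S f S']
  by (auto simp: L2_on_def)

lemma L2_norm_on_mono:
  assumes f: "f \<in> L2_on S" and "S' \<subseteq> S" "S' \<in> sets lebesgue"
  shows "L2_norm_on S' f \<le> L2_norm_on S f"
  unfolding L2_norm_on_def
proof (rule real_sqrt_le_mono)
  have "set_integrable lebesgue S (\<lambda>x. (f x)\<^sup>2)" "set_integrable lebesgue S' (\<lambda>x. (f x)\<^sup>2)"
    using f L2_on_subset[OF assms] by (auto simp: L2_on_def)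
  then show "(LINT x:S'|lebesgue. (f x)\<^sup>2) \<le> (LINT x:S|lebesgue. (f x)\<^sup>2)"
    unfolding set_integrable_def set_lebesgue_integral_def using assms(2)
    by (intro integral_mono) (auto simp: indicator_def)
qed

lemma L2_on_linear:
  assumes f: "f \<in> L2_on S" and g: "g \<in> L2_on S"
  shows "(\<lambda>x. c * f x + d * g x) \<in> L2_on S"
proof -
  have fm: "(\<lambda>x. indicator S x * f x) \<in> borel_measurable lebesgue" and gm: "(\<lambda>x. indicator S x * g x) \<in> borel_measurable lebesgue"
    using f g by (auto simp: L2_on_def set_borel_measurable_def)
  have m: "(\<lambda>x. indicator S x * (c * f x + d * g x)) \<in> borel_measurable lebesgue"
  proof -
    have "(\<lambda>x. c * (indicator S x * f x) + d * (indicator S x * g x)) \<in> borel_measurable lebesgue"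
      by (intro borel_measurable_add borel_measurable_times[OF borel_measurable_const] fm gm)
    then show ?thesis by (simp add: algebra_simps)
  qed
  have m2: "(\<lambda>x. indicator S x * (c * f x + d * g x)\<^sup>2) \<in> borel_measurable lebesgue"
  proof -
    have "(\<lambda>x. (indicator S x * (c * f x + d * g x))\<^sup>2) \<in> borel_measurable lebesgue"
      using m by (rule borel_measurable_power)
    moreover have "(indicator S x * (c * f x + d * g x))\<^sup>2 = indicator S x * (c * f x + d * g x)\<^sup>2" for x
      by (simp add: indicator_def)
    ultimately show ?thesis by simp
  qed
  have "set_integrable lebesgue S (\<lambda>x. 2 * c\<^sup>2 * (f x)\<^sup>2 + 2 * d\<^sup>2 * (g x)\<^sup>2)"
    using f g by (intro set_integral_add) (auto simp: L2_on_def)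
  then have "set_integrable lebesgue S (\<lambda>x. (c * f x + d * g x)\<^sup>2)"
    unfolding set_integrable_def
  proof (rule Bochner_Integration.integrable_bound)
    show "AE x in lebesgue. norm (indicator S x *\<^sub>R (c * f x + d * g x)\<^sup>2) \<le> norm (indicator S x *\<^sub>R (2 * c\<^sup>2 * (f x)\<^sup>2 + 2 * d\<^sup>2 * (g x)\<^sup>2))"
    proof (rule AE_I2)
      fix x
      have "(c * f x + d * g x)\<^sup>2 \<le> 2 * c\<^sup>2 * (f x)\<^sup>2 + 2 * d\<^sup>2 * (g x)\<^sup>2"
        using zero_le_power2[of "c * f x - d * g x"] by (simp add: power2_eq_square algebra_simps)
      then show "norm (indicator S x *\<^sub>R (c * f x + d * g x)\<^sup>2) \<le> norm (indicator S x *\<^sub>R (2 * c\<^sup>2 * (f x)\<^sup>2 + 2 * d\<^sup>2 * (g x)\<^sup>2))"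
        by (auto simp: indicator_def)
    qed
  qed (use m2 in simp)
  with m show ?thesis by (simp add: L2_on_def set_borel_measurable_def)
qed

lemma has_weak_deriv_on_subset:
  assumes w: "has_weak_deriv_on v g S" and sub: "S' \<subseteq> S"
  shows "has_weak_deriv_on v g S'"
  unfolding has_weak_deriv_on_def
proof (intro conjI allI impI)
  show "set_integrable lebesgue K v" "set_integrable lebesgue K g" if "compact K \<and> K \<subseteq> S'" for K
    using w sub that unfolding has_weak_deriv_on_def by blast+
  fix \<phi> assume T: "test_function S' \<phi>"
  then obtain K where K: "compact K" "K \<subseteq> S'" "\<And>x. x \<notin> K \<Longrightarrow> \<phi> x = 0"
    unfolding test_function_def by blast
  have "test_function S \<phi>" using T sub unfolding test_function_def by blast
  then have "(LINT x:S|lebesgue. v x * deriv \<phi> x) = - (LINT x:S|lebesgue. g x * \<phi> x)"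
    using w unfolding has_weak_deriv_on_def by blast
  moreover have d0: "deriv \<phi> x = 0" if "x \<notin> K" for x
    by (rule deriv_zero_outside_support[OF K(1,3) that])
  then have "(LINT x:S'|lebesgue. v x * deriv \<phi> x) = (LINT x:S|lebesgue. v x * deriv \<phi> x)"
    unfolding set_lebesgue_integral_def using K(2) sub
    by (intro Bochner_Integration.integral_cong) (auto simp: indicator_def)
  moreover have "(LINT x:S'|lebesgue. g x * \<phi> x) = (LINT x:S|lebesgue. g x * \<phi> x)"
    unfolding set_lebesgue_integral_def using K(2,3) sub
    by (intro Bochner_Integration.integral_cong) (auto simp: indicator_def)
  ultimately show "(LINT x:S'|lebesgue. v x * deriv \<phi> x) = - (LINT x:S'|lebesgue. g x * \<phi> x)" by simp
qed

lemma solution_on_cone_slices: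
  assumes "solution_on_cone u0 u1 u ux ut x0 t0" "t \<in> {0..<t0}"
  shows "continuous_on (ball x0 (t0 - t)) (\<lambda>x. u x t)"
    "(\<lambda>x. u x t) \<in> L2_on (ball x0 (t0 - t))" "(\<lambda>x. ux x t) \<in> L2_on (ball x0 (t0 - t))"
    "(\<lambda>x. ut x t) \<in> L2_on (ball x0 (t0 - t))"
    "has_weak_deriv_on (\<lambda>x. u x t) (\<lambda>x. ux x t) (ball x0 (t0 - t))"
    "((\<lambda>\<tau>. L2_norm_on (ball x0 (t0 - max t \<tau>)) (\<lambda>x. (u x \<tau> - u x t) / (\<tau> - t) - ut x t)) \<longlongrightarrow> 0) (at t within {0..<t0})"
    "((\<lambda>\<tau>. L2_norm_on (ball x0 (t0 - max t \<tau>)) (\<lambda>x. u x \<tau> - u x t)) \<longlongrightarrow> 0) (at t within {0..<t0})"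
    "((\<lambda>\<tau>. L2_norm_on (ball x0 (t0 - max t \<tau>)) (\<lambda>x. ux x \<tau> - ux x t)) \<longlongrightarrow> 0) (at t within {0..<t0})"
    "((\<lambda>\<tau>. L2_norm_on (ball x0 (t0 - max t \<tau>)) (\<lambda>x. ut x \<tau> - ut x t)) \<longlongrightarrow> 0) (at t within {0..<t0})"
  using assms unfolding solution_on_cone_def by simp_all

lemma solution_on_cone_duhamel:
  assumes "solution_on_cone u0 u1 u ux ut x0 t0" "(x, t) \<in> backward_cone x0 t0 1"
  shows "u x t = (u0 (x - t) + u0 (x + t)) / 2 + (LINT z:{x - t..x + t}|lebesgue. u1 z) / 2
      + (LINT \<tau>:{0..t}|lebesgue. (LINT z:{x - t + \<tau>..x + t - \<tau>}|lebesgue. exp (u z \<tau>))) / 2"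
proof -
  have "case (x, t) of (x, t) \<Rightarrow> u x t = (u0 (x - t) + u0 (x + t)) / 2 + (LINT z:{x - t..x + t}|lebesgue. u1 z) / 2
      + (LINT \<tau>:{0..t}|lebesgue. (LINT z:{x - t + \<tau>..x + t - \<tau>}|lebesgue. exp (u z \<tau>))) / 2"
    using assms unfolding solution_on_cone_def by blast
  then show ?thesis by simp
qed

lemma solution_on_cone_L2_difference:
  assumes sol: "solution_on_cone u0 u1 u ux ut x0 t0" and t: "t \<in> {0..<t0}" "\<tau> \<in> {0..<t0}" and F: "F \<in> {u, ux, ut}"
  shows "(\<lambda>x. F x \<tau> - F x t) \<in> L2_on (ball x0 (t0 - max t \<tau>))"
    and "(\<lambda>x. (u x \<tau> - u x t) / (\<tau> - t) - ut x t) \<in> L2_on (ball x0 (t0 - max t \<tau>))"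
proof -
  have A: "(\<lambda>x. G x s) \<in> L2_on (ball x0 (t0 - max t \<tau>))" if "s \<in> {t, \<tau>}" "G \<in> {u, ux, ut}" for G s
  proof (rule L2_on_subset)
    show "(\<lambda>x. G x s) \<in> L2_on (ball x0 (t0 - s))"
      using solution_on_cone_slices(2-4)[OF sol, of s] that t by auto
    show "ball x0 (t0 - max t \<tau>) \<subseteq> ball x0 (t0 - s)" using that by auto
  qed auto
  show 1: "(\<lambda>x. F x \<tau> - F x t) \<in> L2_on (ball x0 (t0 - max t \<tau>))"
    using L2_on_linear[OF A[of \<tau> F] A[of t F], of 1 "-1"] F by simp
  have "(\<lambda>x. u x \<tau> - u x t) \<in> L2_on (ball x0 (t0 - max t \<tau>))"
    using L2_on_linear[OF A[of \<tau> u] A[of t u], of 1 "-1"] by simp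
  from L2_on_linear[OF this A[of t ut], of "1 / (\<tau> - t)" "-1"]
  show "(\<lambda>x. (u x \<tau> - u x t) / (\<tau> - t) - ut x t) \<in> L2_on (ball x0 (t0 - max t \<tau>))"
    by simp
qed

text \<open>Smaller cones have smaller time slices, so all norms decrease and all test functions remain available.\<close>

lemma solution_on_cone_restrict:
  assumes sol: "solution_on_cone u0 u1 u ux ut x0 t0" and le: "\<bar>x1 - x0\<bar> \<le> t0 - t1"
  shows "solution_on_cone u0 u1 u ux ut x1 t1"
proof -
  note sub = ball_subset_of_cone[OF le]
  have t10: "t1 \<le> t0" using le by linarith
  have squeeze: "((\<lambda>\<tau>. L2_norm_on (ball x1 (t1 - max t \<tau>)) (F \<tau>)) \<longlongrightarrow> 0) (at t within {0..<t1})"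
    if lim: "((\<lambda>\<tau>. L2_norm_on (ball x0 (t0 - max t \<tau>)) (F \<tau>)) \<longlongrightarrow> 0) (at t within {0..<t0})"
      and F: "\<And>\<tau>. \<tau> \<in> {0..<t0} \<Longrightarrow> F \<tau> \<in> L2_on (ball x0 (t0 - max t \<tau>))" for F :: "real \<Rightarrow> real \<Rightarrow> real" and t
  proof (rule tendsto_sandwich[OF _ _ tendsto_const])
    show "((\<lambda>\<tau>. L2_norm_on (ball x0 (t0 - max t \<tau>)) (F \<tau>)) \<longlongrightarrow> 0) (at t within {0..<t1})"
      by (rule tendsto_within_subset[OF lim]) (use t10 in auto)
    show "\<forall>\<^sub>F \<tau> in at t within {0..<t1}. L2_norm_on (ball x1 (t1 - max t \<tau>)) (F \<tau>) \<le> L2_norm_on (ball x0 (t0 - max t \<tau>)) (F \<tau>)"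
      unfolding eventually_at_filter using t10 by (intro always_eventually) (auto intro!: L2_norm_on_mono F sub)
    show "\<forall>\<^sub>F \<tau> in at t within {0..<t1}. 0 \<le> L2_norm_on (ball x1 (t1 - max t \<tau>)) (F \<tau>)"
      by (intro always_eventually allI L2_norm_on_nonneg)
  qed
  show ?thesis unfolding solution_on_cone_def
  proof (intro conjI ballI)
    fix t assume "t \<in> {0..<t1}"
    then have t: "t \<in> {0..<t0}" using t10 by auto
    note S = solution_on_cone_slices[OF sol t]
    show "continuous_on (ball x1 (t1 - t)) (\<lambda>x. u x t)" by (rule continuous_on_subset[OF S(1) sub])
    show "(\<lambda>x. u x t) \<in> L2_on (ball x1 (t1 - t))" by (rule L2_on_subset[OF S(2) sub]) simp
    show "(\<lambda>x. ux x t) \<in> L2_on (ball x1 (t1 - t))" by (rule L2_on_subset[OF S(3) sub]) simp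
    show "(\<lambda>x. ut x t) \<in> L2_on (ball x1 (t1 - t))" by (rule L2_on_subset[OF S(4) sub]) simp
    show "has_weak_deriv_on (\<lambda>x. u x t) (\<lambda>x. ux x t) (ball x1 (t1 - t))" by (rule has_weak_deriv_on_subset[OF S(5) sub])
    show "((\<lambda>\<tau>. L2_norm_on (ball x1 (t1 - max t \<tau>)) (\<lambda>x. (u x \<tau> - u x t) / (\<tau> - t) - ut x t)) \<longlongrightarrow> 0) (at t within {0..<t1})"
      by (rule squeeze[OF S(6)]) (rule solution_on_cone_L2_difference(2)[OF sol t, of _ u], auto)
  next
    fix t F assume "t \<in> {0..<t1}" and F: "F \<in> {u, ux, ut}"
    then have t: "t \<in> {0..<t0}" using t10 by auto
    have lim: "((\<lambda>\<tau>. L2_norm_on (ball x0 (t0 - max t \<tau>)) (\<lambda>x. F x \<tau> - F x t)) \<longlongrightarrow> 0) (at t within {0..<t0})"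
      using solution_on_cone_slices(7-9)[OF sol t] F by auto
    show "((\<lambda>\<tau>. L2_norm_on (ball x1 (t1 - max t \<tau>)) (\<lambda>x. F x \<tau> - F x t)) \<longlongrightarrow> 0) (at t within {0..<t1})"
      by (rule squeeze[OF lim]) (rule solution_on_cone_L2_difference(1)[OF sol t _ F])
  next
    fix xt assume xt: "xt \<in> backward_cone x1 t1 1"
    have "xt \<in> backward_cone x0 t0 1" using xt le by (auto simp: backward_cone_def)
    then show "case xt of (x, t) \<Rightarrow> u x t = (u0 (x - t) + u0 (x + t)) / 2 + (LINT z:{x - t..x + t}|lebesgue. u1 z) / 2
      + (LINT \<tau>:{0..t}|lebesgue. (LINT z:{x - t + \<tau>..x + t - \<tau>}|lebesgue. exp (u z \<tau>))) / 2"
      using solution_on_cone_duhamel[OF sol] by auto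
  qed
qed

definition open_cone :: "real \<Rightarrow> real \<Rightarrow> (real \<times> real) set" where
  "open_cone a s = {(x, t). 0 \<le> t \<and> \<bar>x - a\<bar> < s - t}"

text \<open>The one-dimensional Sobolev inequality: compare \<open>d y\<close> with \<open>d z\<close> and average over \<open>z\<close>.\<close>

lemma sup_norm_le_L2_norms:
  fixes d g :: "real \<Rightarrow> real"
  assumes d: "d \<in> L2_on {a..b}" and g: "g \<in> L2_on {a..b}" and ab: "a < b"
    and dg: "\<And>y z. a \<le> y \<Longrightarrow> y \<le> z \<Longrightarrow> z \<le> b \<Longrightarrow> d z - d y = (LINT x:{y..z}|lebesgue. g x)"
    and y: "y \<in> {a..b}"
  shows "\<bar>d y\<bar> \<le> L2_norm_on {a..b} d / sqrt (b - a) + sqrt (b - a) * L2_norm_on {a..b} g"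
proof -
  define I where "I = (LINT x:{a..b}|lebesgue. \<bar>g x\<bar>)"
  have gi: "set_integrable lebesgue {a..b} g" and di: "set_integrable lebesgue {a..b} d"
    using L2_on_integrable[OF g] L2_on_integrable[OF d] by auto
  have inc: "\<bar>d z - d y\<bar> \<le> I" if "a \<le> y" "y \<le> z" "z \<le> b" for y z
  proof -
    have gs: "set_integrable lebesgue {y..z} g" by (rule set_integrable_subset[OF gi]) (use that in auto)
    have "\<bar>d z - d y\<bar> \<le> (LINT x:{y..z}|lebesgue. \<bar>g x\<bar>)"
      unfolding dg[OF that] using set_integral_norm_bound[OF gs] by simp
    also have "\<dots> \<le> I"
      unfolding I_def set_lebesgue_integral_def
      using set_integrable_abs[OF gs] set_integrable_abs[OF gi] that
      by (intro integral_mono) (auto simp: set_integrable_def indicator_def)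
    finally show ?thesis .
  qed
  have near: "\<bar>d y\<bar> \<le> \<bar>d z\<bar> + I" if "z \<in> {a..b}" for z
    using inc[of y z] inc[of z y] that y by (cases "y \<le> z") (auto simp: abs_le_iff)
  have ic: "set_integrable lebesgue {a..b} (\<lambda>x. c)" for c :: real
    by (rule set_integrable_lebesgue_of_lborel[OF set_integrable_const_Icc])
  have cint: "(LINT z:{a..b}|lebesgue. c) = c * (b - a)" for c :: real
    using ab unfolding set_lebesgue_integral_def by simp
  have "\<bar>d y\<bar> * (b - a) = (LINT z:{a..b}|lebesgue. \<bar>d y\<bar>)" by (rule cint[symmetric])
  also have "\<dots> \<le> (LINT z:{a..b}|lebesgue. \<bar>d z\<bar> + I)"
    using near set_integrable_abs[OF di] by (intro set_integral_mono set_integral_add ic) auto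
  also have "\<dots> = (LINT z:{a..b}|lebesgue. \<bar>d z\<bar>) + I * (b - a)"
    using set_integrable_abs[OF di] ic by (subst set_integral_add) (auto simp: cint)
  also have "\<dots> \<le> sqrt (b - a) * L2_norm_on {a..b} d + sqrt (b - a) * L2_norm_on {a..b} g * (b - a)"
    using L2_on_abs_integral_le[OF d] L2_on_abs_integral_le[OF g] ab unfolding I_def
    by (intro add_mono mult_right_mono) auto
  finally have "\<bar>d y\<bar> \<le> (sqrt (b - a) * L2_norm_on {a..b} d + sqrt (b - a) * L2_norm_on {a..b} g * (b - a)) / (b - a)"
    using ab by (simp add: pos_le_divide_eq)
  also have "\<dots> = L2_norm_on {a..b} d * (sqrt (b - a) / (b - a)) + sqrt (b - a) * L2_norm_on {a..b} g"
    using ab by (simp add: add_divide_distrib)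
  also have "sqrt (b - a) / (b - a) = 1 / sqrt (b - a)"
    using ab by (simp add: real_div_sqrt divide_simps)
  finally show ?thesis by simp
qed

lemma time_tendstoD:
  fixes D :: "real \<Rightarrow> real"
  assumes "(D \<longlongrightarrow> 0) (at t within {0..<c})" "e > 0"
  shows "\<exists>d>0. \<forall>\<tau>\<in>{0..<c}. \<tau> \<noteq> t \<longrightarrow> \<bar>\<tau> - t\<bar> < d \<longrightarrow> D \<tau> < e"
proof -
  from assms[unfolded Lim_within] obtain d where d: "d > 0" "\<forall>x\<in>{0..<c}. 0 < dist x t \<and> dist x t < d \<longrightarrow> dist (D x) 0 < e"
    by blast
  show ?thesis
  proof (intro exI[of _ d] conjI ballI impI d(1))
    fix \<tau> assume "\<tau> \<in> {0..<c}" "\<tau> \<noteq> t" "\<bar>\<tau> - t\<bar> < d"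
    with d(2) have "dist (D \<tau>) 0 < e" by (simp add: dist_real_def)
    then show "D \<tau> < e" by (simp add: dist_real_def)
  qed
qed

text \<open>Continuity in time with values in the first-order Sobolev space gives, by the Sobolev inequality on a
short interval around a point, uniform continuity in time there; each time slice is continuous.\<close>

lemma solution_continuous_on_open_cone:
  assumes sol: "solution_on_cone u0 u1 u ux ut x0 t0"
  shows "continuous_on (open_cone x0 t0) (\<lambda>p. u (fst p) (snd p))"
  unfolding continuous_on_iff
proof (intro ballI allI impI)
  fix P and e :: real assume P: "P \<in> open_cone x0 t0" and e: "e > 0"
  obtain x t where Pxt: "P = (x, t)" by (cases P)
  have t: "0 \<le> t" "\<bar>x - x0\<bar> < t0 - t" using P by (auto simp: Pxt open_cone_def)
  define r where "r = (t0 - t - \<bar>x - x0\<bar>) / 4"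
  have r4: "4 * r = t0 - t - \<bar>x - x0\<bar>" by (simp add: r_def)
  have r: "r > 0" "\<bar>x - x0\<bar> + 4 * r = t0 - t" using t r4 by auto
  have tt: "t \<in> {0..<t0}" using t by auto
  note S = solution_on_cone_slices[OF sol tt]
  let ?N = "\<lambda>F \<tau>. L2_norm_on (ball x0 (t0 - max t \<tau>)) (\<lambda>x. F x \<tau> - F x t)"
  define k where "k = 1 / sqrt (2 * r) + sqrt (2 * r)"
  have k: "k > 0" using r by (simp add: k_def add_pos_pos)
  define \<eta> where "\<eta> = e / (4 * k)"
  have \<eta>: "\<eta> > 0" using e k by (simp add: \<eta>_def)
  obtain d1 where d1: "d1 > 0" "\<forall>\<tau>\<in>{0..<t0}. \<tau> \<noteq> t \<longrightarrow> \<bar>\<tau> - t\<bar> < d1 \<longrightarrow> ?N u \<tau> < \<eta>"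
    using time_tendstoD[OF S(7) \<eta>] by (elim exE conjE)
  obtain d2 where d2: "d2 > 0" "\<forall>\<tau>\<in>{0..<t0}. \<tau> \<noteq> t \<longrightarrow> \<bar>\<tau> - t\<bar> < d2 \<longrightarrow> ?N ux \<tau> < \<eta>"
    using time_tendstoD[OF S(8) \<eta>] by (elim exE conjE)
  have "x \<in> ball x0 (t0 - t)" using t by (auto simp: dist_real_def)
  from S(1)[unfolded continuous_on_iff, rule_format, OF this half_gt_zero[OF e]]
  obtain d3 where d3: "d3 > 0" "\<forall>y\<in>ball x0 (t0 - t). dist y x < d3 \<longrightarrow> dist (u y t) (u x t) < e / 2"
    by (elim exE conjE)
  define d where "d = min (min d1 d2) (min d3 r)"
  have d: "d > 0" "d \<le> d1" "d \<le> d2" "d \<le> d3" "d \<le> r" using d1 d2 d3 r by (auto simp: d_def)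
  show "\<exists>d>0. \<forall>Q\<in>open_cone x0 t0. dist Q P < d \<longrightarrow> dist (u (fst Q) (snd Q)) (u (fst P) (snd P)) < e"
  proof (intro exI[of _ d] conjI ballI impI d(1))
    fix Q assume Q: "Q \<in> open_cone x0 t0" "dist Q P < d"
    obtain y \<tau> where Qy: "Q = (y, \<tau>)" by (cases Q)
    have yx: "\<bar>y - x\<bar> < d" "\<bar>\<tau> - t\<bar> < d"
      using Q(2) dist_fst_le[of Q P] dist_snd_le[of Q P] by (auto simp: Qy Pxt dist_real_def)
    have \<tau>: "\<tau> \<in> {0..<t0}" using Q(1) by (auto simp: Qy open_cone_def)
    have ball: "{x - r..x + r} \<subseteq> ball x0 (t0 - max t \<tau>)"
      using yx(2) d(5) r by (auto simp: dist_real_def abs_le_iff abs_less_iff)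
    have ball1: "{x - r..x + r} \<subseteq> ball x0 (t0 - t)" "{x - r..x + r} \<subseteq> ball x0 (t0 - \<tau>)" using ball by auto
    have "\<bar>u y \<tau> - u y t\<bar> \<le> e / 2"
    proof (cases "\<tau> = t")
      case False
      note L = solution_on_cone_L2_difference(1)[OF sol tt \<tau>]
      note S' = solution_on_cone_slices[OF sol \<tau>]
      have "\<bar>u y \<tau> - u y t\<bar> \<le> L2_norm_on {x - r..x + r} (\<lambda>x. u x \<tau> - u x t) / sqrt (x + r - (x - r))
         + sqrt (x + r - (x - r)) * L2_norm_on {x - r..x + r} (\<lambda>x. ux x \<tau> - ux x t)"
      proof (rule sup_norm_le_L2_norms)
        show "(\<lambda>x. u x \<tau> - u x t) \<in> L2_on {x - r..x + r}" by (rule L2_on_subset[OF L ball]) auto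
        show "(\<lambda>x. ux x \<tau> - ux x t) \<in> L2_on {x - r..x + r}" by (rule L2_on_subset[OF L ball]) auto
        show "y \<in> {x - r..x + r}" using yx d by auto
        fix y z assume yz: "x - r \<le> y" "y \<le> z" "z \<le> x + r"
        then have I: "{y..z} \<subseteq> ball x0 (t0 - t)" "{y..z} \<subseteq> ball x0 (t0 - \<tau>)" using ball1 by auto
        have i: "set_integrable lebesgue {y..z} (\<lambda>x. ux x t)" "set_integrable lebesgue {y..z} (\<lambda>x. ux x \<tau>)"
          using S(5) S'(5) I unfolding has_weak_deriv_on_def by (meson compact_Icc)+
        show "(u z \<tau> - u z t) - (u y \<tau> - u y t) = (LINT x:{y..z}|lebesgue. ux x \<tau> - ux x t)"
          using weak_deriv_imp_integral[OF S(5) open_ball S(1) yz(2) I(1)]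
            weak_deriv_imp_integral[OF S'(5) open_ball S'(1) yz(2) I(2)] i
          by (simp add: set_integral_diff)
      qed (use r in auto)
      also have "\<dots> \<le> \<eta> / sqrt (2 * r) + sqrt (2 * r) * \<eta>"
      proof -
        have n1: "L2_norm_on {x - r..x + r} (\<lambda>x. u x \<tau> - u x t) \<le> \<eta>"
        proof (rule order.trans)
          show "L2_norm_on {x - r..x + r} (\<lambda>x. u x \<tau> - u x t) \<le> ?N u \<tau>"
            by (rule L2_norm_on_mono[OF L ball]) auto
          show "?N u \<tau> \<le> \<eta>" using d1(2) \<tau> False yx d by (intro less_imp_le) simp
        qed
        have n2: "L2_norm_on {x - r..x + r} (\<lambda>x. ux x \<tau> - ux x t) \<le> \<eta>"
        proof (rule order.trans)
          show "L2_norm_on {x - r..x + r} (\<lambda>x. ux x \<tau> - ux x t) \<le> ?N ux \<tau>"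
            by (rule L2_norm_on_mono[OF L ball]) auto
          show "?N ux \<tau> \<le> \<eta>" using d2(2) \<tau> False yx d by (intro less_imp_le) simp
        qed
        have "x + r - (x - r) = 2 * r" by simp
        then show ?thesis
          using r by (simp only:) (intro add_mono divide_right_mono mult_left_mono n1 n2, simp_all)
      qed
      also have "\<dots> = \<eta> * k" by (simp add: k_def algebra_simps)
      also have "\<dots> \<le> e / 2" using e k by (simp add: \<eta>_def)
      finally show ?thesis .
    qed (use e in simp)
    moreover have "\<bar>u y t - u x t\<bar> < e / 2" 
    proof -
      have "y \<in> {x - r..x + r}" using yx d by auto
      then have "y \<in> ball x0 (t0 - t)" using ball1(1) by blast
      moreover have "dist y x < d3" using yx d by (simp add: dist_real_def)
      ultimately show ?thesis using d3(2) by (simp add: dist_real_def)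
    qed
    ultimately show "dist (u (fst Q) (snd Q)) (u (fst P) (snd P)) < e"
      unfolding Qy Pxt dist_real_def fst_conv snd_conv by linarith
  qed
qed

section \<open>The blow-up time and the blow-up criterion\<close>

text \<open>One-sided derivatives at the ends of the interval suffice, as the Duhamel term has only those at time zero.\<close>

lemma increment_ge:
  fixes g :: "real \<Rightarrow> real"
  assumes "a \<le> b" "\<And>s. s \<in> {a..b} \<Longrightarrow> (g has_real_derivative g' s) (at s within {a..b})" "\<And>s. s \<in> {a..b} \<Longrightarrow> K \<le> g' s"
  shows "K * (b - a) \<le> g b - g a"
proof -
  have I: "(g' has_integral (g b - g a)) {a..b}"
  proof (rule fundamental_theorem_of_calculus[OF assms(1)])
    show "(g has_vector_derivative g' s) (at s within {a..b})" if "s \<in> {a..b}" for s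
      using assms(2)[OF that] by (simp only: has_real_derivative_iff_has_vector_derivative)
  qed
  have J: "((\<lambda>_. K) has_integral (K * (b - a))) {a..b}"
    using has_integral_const_real[of K a b] by (simp only: content_real[OF assms(1)] real_scaleR_def mult.commute[of "b - a"])
  show ?thesis by (rule has_integral_le[OF J I assms(3)])
qed

lemma duhamel_causal_mono:
  fixes f :: "real \<Rightarrow> real \<Rightarrow> real"
  assumes f: "continuous_on UNIV (\<lambda>p. f (fst p) (snd p))" and f0: "\<And>z \<tau>. 0 \<le> f z \<tau>"
    and t: "0 \<le> t" "\<bar>x - x'\<bar> \<le> t' - t"
  shows "duhamel f x t \<le> duhamel f x' t'"
proof -
  let ?X = "\<lambda>s. x + s * (x' - x)" and ?Y = "\<lambda>s. t + s * (t' - t)"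
  let ?A = "\<lambda>s. right_ray f (?X s) (?Y s)" and ?B = "\<lambda>s. left_ray f (?X s) (?Y s)"
  have Y: "0 \<le> ?Y s" if "s \<in> {0..1}" for s using that t by simp
  have A: "0 \<le> ?A s" if "s \<in> {0..1}" for s
    unfolding right_ray_def
    by (rule Henstock_Kurzweil_Integration.integral_nonneg[OF _ f0])
       (intro integrable_continuous_real continuous_on_slice[OF f] continuous_intros)
  have B: "0 \<le> ?B s" if "s \<in> {0..1}" for s
    unfolding left_ray_def
    by (rule Henstock_Kurzweil_Integration.integral_nonneg[OF _ f0])
       (intro integrable_continuous_real continuous_on_slice[OF f] continuous_intros)
  have "0 * (1 - 0) \<le> duhamel f (?X 1) (?Y 1) - duhamel f (?X 0) (?Y 0)"
  proof (rule increment_ge[where g = "\<lambda>s. duhamel f (?X s) (?Y s)"])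
    fix s :: real assume s: "s \<in> {0..1}"
    show "((\<lambda>s. duhamel f (?X s) (?Y s)) has_real_derivative
       (?A s * ((t' - t) + (x' - x)) + ?B s * ((t' - t) - (x' - x))) / 2) (at s within {0..1})"
    proof (rule duhamel_derivative_along[OF f _ _ Y s])
      show "(?X has_real_derivative x' - x) (at s within {0..1})" "(?Y has_real_derivative t' - t) (at s within {0..1})"
        by (auto intro!: derivative_eq_intros)
    qed
    have "0 \<le> ?A s * ((t' - t) + (x' - x))" using A[OF s] t by (intro mult_nonneg_nonneg) auto
    moreover have "0 \<le> ?B s * ((t' - t) - (x' - x))" using B[OF s] t by (intro mult_nonneg_nonneg) auto
    ultimately show "0 \<le> (?A s * ((t' - t) + (x' - x)) + ?B s * ((t' - t) - (x' - x))) / 2" by simp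
  qed simp
  then show ?thesis by simp
qed

lemma cone_retraction:
  assumes "0 \<le> s"
  obtains \<rho> :: "real \<times> real \<Rightarrow> real \<times> real"
  where "continuous_on UNIV \<rho>" "\<And>P. \<rho> P \<in> closed_cone a s" "\<And>P. P \<in> closed_cone a s \<Longrightarrow> \<rho> P = P"
proof
  define \<tau> :: "real \<times> real \<Rightarrow> real" where "\<tau> P = max 0 (min (snd P) s)" for P
  define \<rho> where "\<rho> P = (a + max (- (s - \<tau> P)) (min (fst P - a) (s - \<tau> P)), \<tau> P)" for P
  show "continuous_on UNIV \<rho>" unfolding \<rho>_def \<tau>_def by (intro continuous_intros)
  show "\<rho> P \<in> closed_cone a s" for P
  proof -
    have \<tau>: "0 \<le> \<tau> P" "\<tau> P \<le> s" using assms by (auto simp: \<tau>_def)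
    have "\<bar>max (- k) (min w k)\<bar> \<le> k" if "0 \<le> k" for k w :: real using that by (auto simp: abs_le_iff)
    from this[of "s - \<tau> P" "fst P - a"] \<tau> show ?thesis by (simp add: \<rho>_def closed_cone_def)
  qed
  show "\<rho> P = P" if "P \<in> closed_cone a s" for P
  proof -
    have P: "0 \<le> snd P" "\<bar>fst P - a\<bar> \<le> s - snd P" using that by (auto simp: closed_cone_def)
    then have "\<tau> P = snd P" by (auto simp: \<tau>_def)
    moreover have "max (- (s - snd P)) (min (fst P - a) (s - snd P)) = fst P - a" using P(2) by (auto simp: abs_le_iff)
    ultimately show ?thesis by (simp add: \<rho>_def)
  qed
qed

context wave_data begin

text \<open>A continuous extension \<open>f\<close> of \<open>exp u\<close> from a closed cone to the plane. The Duhamel term at a point of the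
cone only sees the values of \<open>f\<close> in the cone, so the calculus for sources on the plane applies to \<open>u\<close>.\<close>

definition cone_source :: "(real \<Rightarrow> real \<Rightarrow> real) \<Rightarrow> real \<Rightarrow> real \<Rightarrow> (real \<Rightarrow> real \<Rightarrow> real) \<Rightarrow> bool" where
  "cone_source u a s f \<longleftrightarrow> continuous_on UNIV (\<lambda>p. f (fst p) (snd p)) \<and> (\<forall>x t. 0 < f x t) \<and>
     (\<forall>x t. (x, t) \<in> closed_cone a s \<longrightarrow> f x t = exp (u x t)) \<and>
     (\<forall>x t. (x, t) \<in> closed_cone a s \<longrightarrow> u x t = lin x t + duhamel f x t)"

lemma cone_sourceD:
  assumes "cone_source u a s f"
  shows "continuous_on UNIV (\<lambda>p. f (fst p) (snd p))" "0 < f x t" "0 \<le> f x t"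
    "(x, t) \<in> closed_cone a s \<Longrightarrow> f x t = exp (u x t)"
    "(x, t) \<in> closed_cone a s \<Longrightarrow> u x t = lin x t + duhamel f x t"
  using assms unfolding cone_source_def by (simp_all add: less_imp_le)

text \<open>The extension is the composition of \<open>exp u\<close> with a retraction of the plane onto the closed cone.\<close>

lemma solution_cone_source:
  assumes sol: "solution_on_cone u0 u1 u ux ut a s'" and s: "s < s'"
  shows "\<exists>f. cone_source u a s f"
proof (cases "0 \<le> s")
  case False
  then have "closed_cone a s = {}" by (auto simp: closed_cone_def)
  then show ?thesis unfolding cone_source_def by (intro exI[of _ "\<lambda>_ _. 1"]) simp
next
  case True
  obtain \<rho> where \<rho>: "continuous_on UNIV \<rho>" "\<And>P. \<rho> P \<in> closed_cone a s" "\<And>P. P \<in> closed_cone a s \<Longrightarrow> \<rho> P = P"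
    using cone_retraction[OF True] by blast
  define f where "f x t = exp (u (fst (\<rho> (x, t))) (snd (\<rho> (x, t))))" for x t
  have sub: "closed_cone a s \<subseteq> open_cone a s'" using s by (auto simp: closed_cone_def open_cone_def)
  have "continuous_on UNIV (\<lambda>P. (\<lambda>p. u (fst p) (snd p)) (\<rho> P))"
    by (rule continuous_on_compose2[OF solution_continuous_on_open_cone[OF sol] \<rho>(1)]) (use \<rho>(2) sub in auto)
  then have fc: "continuous_on UNIV (\<lambda>p. f (fst p) (snd p))"
    unfolding f_def by (auto intro!: continuous_intros)
  have fu: "f x t = exp (u x t)" if "(x, t) \<in> closed_cone a s" for x t
    using \<rho>(3)[OF that] by (simp add: f_def)
  have "u x t = lin x t + duhamel f x t" if xt: "(x, t) \<in> closed_cone a s" for x t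
  proof -
    from xt have t: "0 \<le> t" "\<bar>x - a\<bar> \<le> s - t" by (auto simp: closed_cone_def)
    have "(x, t) \<in> backward_cone a s' 1" using t s by (auto simp: backward_cone_def)
    from solution_on_cone_duhamel[OF sol this]
    have "u x t = lin x t + (LINT \<tau>:{0..t}|lebesgue. (LINT z:{x - t + \<tau>..x + t - \<tau>}|lebesgue. exp (u z \<tau>))) / 2"
      unfolding dalembert[OF t(1)] lin_def .
    also have "(LINT \<tau>:{0..t}|lebesgue. (LINT z:{x - t + \<tau>..x + t - \<tau>}|lebesgue. exp (u z \<tau>)))
       = (LINT \<tau>:{0..t}|lebesgue. (LINT z:{x - t + \<tau>..x + t - \<tau>}|lebesgue. f z \<tau>))"
    proof (rule set_lebesgue_integral_cong)
      show "\<forall>\<tau>. \<tau> \<in> {0..t} \<longrightarrow> (LINT z:{x - t + \<tau>..x + t - \<tau>}|lebesgue. exp (u z \<tau>)) = (LINT z:{x - t + \<tau>..x + t - \<tau>}|lebesgue. f z \<tau>)"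
      proof (intro allI impI, rule set_lebesgue_integral_cong)
        fix \<tau> assume "\<tau> \<in> {0..t}"
        then show "\<forall>z. z \<in> {x - t + \<tau>..x + t - \<tau>} \<longrightarrow> exp (u z \<tau>) = f z \<tau>"
          using t by (auto intro!: fu[symmetric] simp: closed_cone_def abs_le_iff)
      qed simp
    qed simp
    also have "\<dots> / 2 = duhamel f x t" by (rule duhamel_lebesgue[OF fc])
    finally show ?thesis .
  qed
  moreover have "0 < f x t" for x t by (simp add: f_def)
  ultimately show ?thesis using fc fu unfolding cone_source_def by blast
qed

lemma truncated_solution_on_cone:
  assumes v: "truncated_solution M v" and le: "\<And>x t. (x, t) \<in> closed_cone a s \<Longrightarrow> v x t \<le> M"
  shows "\<exists>vx vt. solution_on_cone u0 u1 v vx vt a s"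
proof -
  have vc: "continuous_on UNIV (\<lambda>p. v (fst p) (snd p))"
    and eq: "\<And>x t. t \<ge> 0 \<Longrightarrow> v x t = lin x t + duhamel (\<lambda>z \<tau>. exp (min (v z \<tau>) M)) x t"
    using v by (simp_all add: truncated_solution_def)
  show ?thesis
    by (intro exI, rule solution_of_bounded_source[OF truncated_continuous[OF vc] vc eq]) (use le in \<open>auto simp: min_absorb1\<close>)
qed

text \<open>At time zero every truncated solution equals the initial value. With the cut-off above this value it
stays below the cut-off on a small cone and solves the original equation there.\<close>

lemma local_existence: "(a, 0) \<in> max_domain u0 u1"
proof -
  define M where "M = lin a 0 + 1"
  obtain v where v: "truncated_solution M v" using truncated_solution_exists by blast
  then have vc: "continuous_on UNIV (\<lambda>p. v (fst p) (snd p))" by (simp add: truncated_solution_def)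
  have va: "v a 0 = lin a 0" using v by (simp add: truncated_solution_def duhamel_zero_time)
  obtain d where d: "d > 0" "\<forall>P\<in>UNIV. dist P (a, 0) < d \<longrightarrow> dist (v (fst P) (snd P)) (v a 0) < 1"
    using vc[unfolded continuous_on_iff, rule_format, OF UNIV_I zero_less_one, of "(a, 0)"]
    unfolding fst_conv snd_conv by (elim exE conjE) (rule that)
  have "v x t \<le> M" if "(x, t) \<in> closed_cone a (d / 2)" for x t
  proof -
    have "0 \<le> t" "\<bar>x - a\<bar> \<le> d / 2 - t" using that by (auto simp: closed_cone_def)
    moreover have "dist (x, t) (a, 0) \<le> \<bar>x - a\<bar> + \<bar>t\<bar>"
      using sqrt_sum_squares_le_sum_abs[of "x - a" t] by (simp add: dist_Pair_Pair dist_real_def)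
    ultimately have "dist (x, t) (a, 0) < d" using d(1) by linarith
    with d(2) have "dist (v (fst (x, t)) (snd (x, t))) (v a 0) < 1" by blast
    then show ?thesis by (simp add: va M_def dist_real_def abs_less_iff)
  qed
  then have "\<exists>vx vt. solution_on_cone u0 u1 v vx vt a (d / 2)" by (rule truncated_solution_on_cone[OF v])
  moreover have "0 < d / 2" using d(1) by simp
  ultimately show ?thesis unfolding max_domain_def by blast
qed

text \<open>A cone with apex slightly above \<open>(x, t)\<close> contains a cone with apex slightly above \<open>(x', t')\<close>.\<close>

lemma max_domain_restrict:
  assumes "(x, t) \<in> max_domain u0 u1" "0 \<le> t'" "\<bar>x' - x\<bar> \<le> t - t'"
  shows "(x', t') \<in> max_domain u0 u1"
proof -
  obtain t2 v vx vt where "t2 > t" "solution_on_cone u0 u1 v vx vt x t2"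
    using assms(1) by (auto simp: max_domain_def)
  note t2 = this
  have "solution_on_cone u0 u1 v vx vt x' (t2 - \<bar>x' - x\<bar>)"
    by (rule solution_on_cone_restrict[OF t2(2)]) simp
  moreover have "t2 - \<bar>x' - x\<bar> > t'" using assms(3) t2(1) by linarith
  ultimately show ?thesis using assms(2) by (auto simp: max_domain_def)
qed

end

locale blowup = wave_data +
  fixes u ux ut :: "real \<Rightarrow> real \<Rightarrow> real" and T :: "real \<Rightarrow> real"
  assumes maximal: "maximal_solution u0 u1 u ux ut"
    and nonglobal: "max_domain u0 u1 \<noteq> UNIV \<times> {0..}"
    and T: "T = blowup_time u0 u1"
begin

text \<open>A single point outside the domain forces all cones to be finite: a cone of large height over any base
point would contain it.\<close>

lemma lifespan_bounded: "\<exists>B. \<forall>t. (x, t) \<in> max_domain u0 u1 \<longrightarrow> t < B"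
proof -
  have "max_domain u0 u1 \<subseteq> UNIV \<times> {0..}" by (auto simp: max_domain_def)
  then obtain y s where ys: "s \<ge> 0" "(y, s) \<notin> max_domain u0 u1" using nonglobal by blast
  have "t < s + \<bar>y - x\<bar>" if "(x, t) \<in> max_domain u0 u1" for t
    using max_domain_restrict[OF that ys(1), of y] ys(2) by linarith
  then show ?thesis by blast
qed

lemma max_domain_iff: "(x, t) \<in> max_domain u0 u1 \<longleftrightarrow> 0 \<le> t \<and> t < T x"
proof -
  let ?S = "{t. (x, t) \<in> max_domain u0 u1}"
  have bdd: "bdd_above ?S" using lifespan_bounded[of x] by (auto simp: bdd_above_def intro: less_imp_le)
  have ne: "?S \<noteq> {}" using local_existence by blast
  have Tx: "T x = Sup ?S" by (simp add: T blowup_time_def)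
  show ?thesis
  proof
    assume xt: "(x, t) \<in> max_domain u0 u1"
    then obtain t2 v vx vt where t2: "t2 > t" "0 \<le> t" "solution_on_cone u0 u1 v vx vt x t2"
      by (auto simp: max_domain_def)
    then have "(x, (t + t2) / 2) \<in> max_domain u0 u1"
      unfolding max_domain_def by (auto intro!: exI[of _ t2])
    then have "(t + t2) / 2 \<le> T x" unfolding Tx by (intro cSup_upper bdd) simp
    then show "0 \<le> t \<and> t < T x" using t2 by simp
  next
    assume t: "0 \<le> t \<and> t < T x"
    then obtain s where s: "(x, s) \<in> max_domain u0 u1" "t < s"
      using less_cSup_iff[OF ne bdd] by (auto simp: Tx)
    show "(x, t) \<in> max_domain u0 u1" by (rule max_domain_restrict[OF s(1)]) (use t s(2) in auto)
  qed
qed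

lemma T_pos: "0 < T x"
  using local_existence[of x] by (simp add: max_domain_iff)

lemma T_lipschitz: "\<bar>T x - T y\<bar> \<le> \<bar>x - y\<bar>"
proof -
  have "T y \<ge> T x - \<bar>y - x\<bar>" for x y
  proof (rule ccontr)
    assume "\<not> T y \<ge> T x - \<bar>y - x\<bar>"
    then have lt: "T y + \<bar>y - x\<bar> < T x" by simp
    define t where "t = T y + \<bar>y - x\<bar>"
    have xt: "(x, t) \<in> max_domain u0 u1" using lt T_pos[of y] by (simp add: max_domain_iff t_def)
    have "(y, T y) \<in> max_domain u0 u1"
      by (rule max_domain_restrict[OF xt]) (use T_pos[of y] in \<open>auto simp: t_def\<close>)
    then show False by (simp add: max_domain_iff)
  qed
  from this[of x y] this[of y x] show ?thesis by linarith
qed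

lemma solution_below:
  assumes "s < T a" obtains s' where "s < s'" "s' < T a" "0 < s'" "solution_on_cone u0 u1 u ux ut a s'"
proof -
  obtain s' where s': "max s 0 < s'" "s' < T a" using dense[of "max s 0" "T a"] assms T_pos[of a] by auto
  then have "(a, s') \<in> max_domain u0 u1" by (simp add: max_domain_iff)
  then have "solution_on_cone u0 u1 u ux ut a s'"
    using maximal s' unfolding maximal_solution_def by fastforce
  then show thesis using that s' by auto
qed

lemma source_below: "s < T a \<Longrightarrow> \<exists>f. cone_source u a s f"
  by (rule solution_below[of s a]) (auto intro: solution_cone_source)

text \<open>The nonlinear part of the solution, called \<open>F\<close> in the introduction.\<close>

definition nl :: "real \<Rightarrow> real \<Rightarrow> real" where "nl x t = u x t - lin x t"

lemma nl_causal_mono: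
  assumes "0 \<le> t" "\<bar>x - x'\<bar> \<le> t' - t" "t' < T x'"
  shows "nl x t \<le> nl x' t'"
proof -
  obtain f where "cone_source u x' t' f" using source_below[OF assms(3)] by blast
  note f = cone_sourceD[OF this]
  have "(x, t) \<in> closed_cone x' t'" "(x', t') \<in> closed_cone x' t'" using assms by (auto simp: closed_cone_def)
  then have "nl x t = duhamel f x t" "nl x' t' = duhamel f x' t'" using f(5) by (auto simp: nl_def)
  moreover have "duhamel f x t \<le> duhamel f x' t'"
    by (rule duhamel_causal_mono[OF f(1) f(3) assms(1,2)])
  ultimately show ?thesis by simp
qed

text \<open>The blow-up criterion. A bound on the axis of the cone is a bound on the entire open cone by causal
monotonicity, and then the truncated solution continues \<open>u\<close> past the apex. The taller cone is compared with
the open cone by shrinking it with the factor \<open>\<kappa>\<close> towards \<open>(a, 0)\<close>.\<close>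

lemma nl_unbounded: "\<exists>t\<in>{0..<T a}. nl a t > B"
proof (rule ccontr)
  assume "\<not> (\<exists>t\<in>{0..<T a}. nl a t > B)"
  then have B: "nl a t \<le> B" if "t \<in> {0..<T a}" for t using that by (auto simp: not_less)
  obtain L where L: "\<forall>x t. t \<ge> 0 \<longrightarrow> \<bar>x\<bar> + t \<le> \<bar>a\<bar> + T a \<longrightarrow> \<bar>lin x t\<bar> \<le> L"
    using lin_bounded by blast
  define M where "M = B + L + 1"
  obtain v where v: "truncated_solution M v" using truncated_solution_exists by blast
  then have vc: "continuous_on UNIV (\<lambda>p. v (fst p) (snd p))"
    and vlim: "\<And>x t. (\<lambda>n. picard M n x t) \<longlonglongrightarrow> v x t" by (simp_all add: truncated_solution_def)
  have inside: "v x t \<le> M - 1" if xt: "(x, t) \<in> open_cone a (T a)" for x t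
  proof -
    have t: "0 \<le> t" "\<bar>x - a\<bar> + t < T a" using xt by (auto simp: open_cone_def)
    define s where "s = \<bar>x - a\<bar> + t"
    have "s < T a" using t by (simp add: s_def)
    then obtain f where "cone_source u a s f" using source_below by blast
    note f = cone_sourceD[OF this]
    have xs: "(x, t) \<in> closed_cone a s" using t by (auto simp: closed_cone_def s_def)
    have "picard M n x t \<le> u x t" for n
      by (rule picard_le[OF f(1) f(3) _ xs]) (use f in auto)
    then have "v x t \<le> u x t" using LIMSEQ_le_const2[OF vlim] by blast
    also have "u x t = lin x t + nl x t" by (simp add: nl_def)
    also have "nl x t \<le> nl a s" using t by (intro nl_causal_mono) (auto simp: s_def)
    also have "nl a s \<le> B" using t by (intro B) (auto simp: s_def)
    also have "lin x t \<le> L"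
    proof -
      have "\<bar>x\<bar> + t \<le> \<bar>a\<bar> + T a" using t by linarith
      with L t have "\<bar>lin x t\<bar> \<le> L" by blast
      then show ?thesis by simp
    qed
    finally show ?thesis by (simp add: M_def)
  qed
  \<comment> \<open>By continuity the bound survives on a slightly taller cone.\<close>
  let ?K = "{a - (T a + 1)..a + (T a + 1)} \<times> {0..T a + 1}"
  have "uniformly_continuous_on ?K (\<lambda>p. v (fst p) (snd p))"
    by (intro compact_uniformly_continuous continuous_on_subset[OF vc] compact_Times) auto
  from this[unfolded uniformly_continuous_on_def, rule_format, OF zero_less_one]
  obtain d where d: "d > 0" "\<forall>P\<in>?K. \<forall>Q\<in>?K. dist Q P < d \<longrightarrow> dist (v (fst Q) (snd Q)) (v (fst P) (snd P)) < 1"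
    by (elim exE conjE)
  define \<epsilon> where "\<epsilon> = min (min 1 (T a)) (d / 3)"
  have \<epsilon>: "0 < \<epsilon>" "\<epsilon> \<le> 1" "\<epsilon> \<le> T a" "\<epsilon> \<le> d / 3" using d(1) T_pos[of a] by (auto simp: \<epsilon>_def)
  define \<kappa> where "\<kappa> = (T a - \<epsilon>) / (T a + \<epsilon>)"
  have Tp: "T a + \<epsilon> > 0" using \<epsilon> T_pos[of a] by simp
  have \<kappa>: "0 \<le> \<kappa>" "\<kappa> \<le> 1" "\<kappa> * (T a + \<epsilon>) = T a - \<epsilon>" using \<epsilon> Tp by (auto simp: \<kappa>_def)
  have "v x t \<le> M" if xt: "(x, t) \<in> closed_cone a (T a + \<epsilon>)" for x t
  proof -
    have t: "0 \<le> t" "\<bar>x - a\<bar> + t \<le> T a + \<epsilon>" using xt by (auto simp: closed_cone_def)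
    define y s where "y = a + \<kappa> * (x - a)" and "s = \<kappa> * t"
    have s: "0 \<le> s" "\<bar>y - a\<bar> + s \<le> T a - \<epsilon>"
    proof -
      show "0 \<le> s" using \<kappa> t by (simp add: s_def)
      have "\<bar>y - a\<bar> + s = \<kappa> * (\<bar>x - a\<bar> + t)" using \<kappa>(1) by (simp add: y_def s_def abs_mult distrib_left)
      also have "\<dots> \<le> \<kappa> * (T a + \<epsilon>)" using \<kappa>(1) t by (intro mult_left_mono) auto
      finally show "\<bar>y - a\<bar> + s \<le> T a - \<epsilon>" using \<kappa>(3) by simp
    qed
    have "(y, s) \<in> open_cone a (T a)" using s \<epsilon> by (auto simp: open_cone_def)
    from inside[OF this] have vy: "v y s \<le> M - 1" .
    have "dist (x, t) (y, s) \<le> \<bar>x - y\<bar> + \<bar>t - s\<bar>"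
      using sqrt_sum_squares_le_sum_abs[of "x - y" "t - s"] by (simp add: dist_Pair_Pair dist_real_def)
    also have "\<dots> = (1 - \<kappa>) * (\<bar>x - a\<bar> + t)"
    proof -
      have "x - y = (1 - \<kappa>) * (x - a)" "t - s = (1 - \<kappa>) * t" by (simp_all add: y_def s_def algebra_simps)
      then show ?thesis using \<kappa>(2) t(1) by (simp only: abs_mult) (simp add: algebra_simps)
    qed
    also have "\<dots> \<le> (1 - \<kappa>) * (T a + \<epsilon>)" using \<kappa>(2) t by (intro mult_left_mono) auto
    also have "\<dots> = 2 * \<epsilon>" using \<kappa>(3) by (simp add: algebra_simps)
    also have "\<dots> < d" using \<epsilon> d(1) by linarith
    finally have dd: "dist (x, t) (y, s) < d" .
    have "(x, t) \<in> ?K" "(y, s) \<in> ?K" using t s \<epsilon> T_pos[of a] by (auto simp: abs_le_iff)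
    with d(2) dd have "dist (v (fst (x, t)) (snd (x, t))) (v (fst (y, s)) (snd (y, s))) < 1" by blast
    with vy show ?thesis by (simp add: dist_real_def abs_less_iff)
  qed
  then have "\<exists>vx vt. solution_on_cone u0 u1 v vx vt a (T a + \<epsilon>)" by (rule truncated_solution_on_cone[OF v])
  moreover have "0 \<le> T a" "T a < T a + \<epsilon>" using \<epsilon>(1) T_pos[of a] by auto
  ultimately have "(a, T a) \<in> max_domain u0 u1" unfolding max_domain_def by blast
  then show False by (simp add: max_domain_iff)
qed

end

section \<open>Rates of growth at the blow-up time\<close>

context blowup begin

lemma nl_eq_duhamel:
  assumes "cone_source u a s f" "(x, t) \<in> closed_cone a s"
  shows "nl x t = duhamel f x t"
  using cone_sourceD(5)[OF assms] by (simp add: nl_def)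

lemma source_eq_exp_nl:
  assumes "cone_source u a s f" "(x, t) \<in> closed_cone a s"
  shows "f x t = exp (lin x t) * exp (nl x t)"
  using cone_sourceD(4)[OF assms] by (simp add: nl_def flip: exp_add)

text \<open>On the diamond between \<open>(x, t)\<close> and \<open>(x, t + r)\<close> the source is at least \<open>exp (nl x t - L)\<close>, by causal
monotonicity. The diamond has area \<open>r\<^sup>2 / 2\<close>, and the Duhamel term takes half of the integral. In the proof
\<open>nl\<close> is increased along the upper left edge of the diamond, where each right ray crosses the diamond
for a time \<open>r / 2\<close>.\<close>

lemma diamond_growth:
  assumes L: "\<And>x t. t \<ge> 0 \<Longrightarrow> \<bar>x\<bar> + t \<le> R \<Longrightarrow> \<bar>lin x t\<bar> \<le> L"
    and t: "0 \<le> t" "0 < r" "t + r < T x" and R: "\<bar>x\<bar> + T x \<le> R"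
  shows "nl x t + exp (nl x t - L) * r\<^sup>2 / 4 \<le> nl x (t + r)"
proof -
  obtain f where src: "cone_source u x (t + r) f" using source_below[OF t(3)] by blast
  note f = cone_sourceD[OF src]
  define K where "K = exp (nl x t - L)"
  \<comment> \<open>Every point of the diamond between (x, t) and (x, t + r) lies in the causal future of (x, t).\<close>
  have low: "K \<le> f z \<tau>" if z: "\<bar>z - x\<bar> \<le> \<tau> - t" "\<bar>z - x\<bar> \<le> t + r - \<tau>" for z \<tau>
  proof -
    have \<tau>: "0 \<le> \<tau>" using z t by linarith
    have "(z, \<tau>) \<in> closed_cone x (t + r)" using z \<tau> by (auto simp: closed_cone_def)
    then have "f z \<tau> = exp (lin z \<tau> + nl z \<tau>)" using source_eq_exp_nl[OF src] by (simp add: exp_add)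
    moreover have "\<tau> < T z" using T_lipschitz[of x z] z t by linarith
    then have "nl x t \<le> nl z \<tau>" using z t by (intro nl_causal_mono) auto
    moreover have "\<bar>lin z \<tau>\<bar> \<le> L" by (rule L[OF \<tau>]) (use z t R in linarith)
    ultimately show ?thesis by (simp add: K_def)
  qed
  have A: "K * (r / 2) \<le> right_ray f (x - r / 2 + h) (t + r / 2 + h)" if h: "h \<in> {0..r / 2}" for h
  proof -
    let ?g = "\<lambda>\<tau>. f (x - r / 2 + h + (t + r / 2 + h) - \<tau>) \<tau>"
    have int: "?g integrable_on {c..d}" for c d
      by (intro integrable_continuous_real continuous_on_slice[OF f(1)] continuous_intros)
    have "integral {t + h..t + r / 2 + h} (\<lambda>_. K) \<le> integral {t + h..t + r / 2 + h} ?g"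
    proof (rule integral_le[OF _ int])
      fix \<tau> assume \<tau>: "\<tau> \<in> {t + h..t + r / 2 + h}"
      have e: "x - r / 2 + h + (t + r / 2 + h) - \<tau> - x = t + 2 * h - \<tau>" by simp
      show "K \<le> ?g \<tau>" by (rule low; unfold e) (use h \<tau> t in \<open>auto simp: abs_le_iff\<close>)
    qed auto
    also have "\<dots> \<le> integral {0..t + r / 2 + h} ?g"
      by (rule integral_subset_le[OF _ int int]) (use h t f(3) in auto)
    finally show ?thesis using t by (simp add: right_ray_def mult.commute)
  qed
  have incr: "K * (r / 2) * (r / 2 - 0) \<le> duhamel f (x - r / 2 + r / 2) (t + r / 2 + r / 2) - duhamel f (x - r / 2 + 0) (t + r / 2 + 0)"
  proof (rule increment_ge[where g = "\<lambda>h. duhamel f (x - r / 2 + h) (t + r / 2 + h)"])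
    fix h assume h: "h \<in> {0..r / 2}"
    have "((\<lambda>h. duhamel f (x - r / 2 + h) (t + r / 2 + h)) has_real_derivative
       (right_ray f (x - r / 2 + h) (t + r / 2 + h) * (1 + 1) + left_ray f (x - r / 2 + h) (t + r / 2 + h) * (1 - 1)) / 2)
       (at h within {0..r / 2})"
    proof (rule duhamel_derivative_along[OF f(1) _ _ _ h])
      show "((\<lambda>h. x - r / 2 + h) has_real_derivative 1) (at h within {0..r / 2})"
        "((\<lambda>h. t + r / 2 + h) has_real_derivative 1) (at h within {0..r / 2})"
        by (auto intro!: derivative_eq_intros)
    qed (use t in auto)
    then show "((\<lambda>h. duhamel f (x - r / 2 + h) (t + r / 2 + h)) has_real_derivative
       right_ray f (x - r / 2 + h) (t + r / 2 + h)) (at h within {0..r / 2})" by simp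
    show "K * (r / 2) \<le> right_ray f (x - r / 2 + h) (t + r / 2 + h)" by (rule A[OF h])
  qed (use t in auto)
  have "K * r\<^sup>2 / 4 \<le> duhamel f x (t + r) - duhamel f (x - r / 2) (t + r / 2)"
  proof -
    have "K * (r / 2) * (r / 2 - 0) = K * r\<^sup>2 / 4" by (simp add: power2_eq_square)
    moreover have "x - r / 2 + r / 2 = x" "t + r / 2 + r / 2 = t + r" "x - r / 2 + 0 = x - r / 2" "t + r / 2 + 0 = t + r / 2" by simp_all
    ultimately show ?thesis using incr by (simp only:)
  qed
  moreover have "duhamel f x t \<le> duhamel f (x - r / 2) (t + r / 2)"
    by (rule duhamel_causal_mono[OF f(1) f(3)]) (use t in auto)
  moreover have "nl x t = duhamel f x t" "nl x (t + r) = duhamel f x (t + r)"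
    using t by (auto intro!: nl_eq_duhamel[OF src] simp: closed_cone_def)
  ultimately show ?thesis unfolding K_def[symmetric] by linarith
qed

lemma exp_3_ge: "(8::real) \<le> exp 3"
proof -
  have "(2::real) ^ 3 \<le> exp 1 ^ 3" using exp_ge_add_one_self[of 1] by (intro power_mono) auto
  then show ?thesis by (simp flip: exp_of_nat_mult)
qed

text \<open>The threshold 12 makes \<open>nl\<close> increase by at least 3 during the time \<open>r\<close>. As \<open>exp 3\<close> exceeds 4, the
hypothesis is reproduced at the new point with \<open>r / 2\<close>, and the total time stays below \<open>2 * r\<close>.\<close>

lemma iterated_growth:
  assumes L: "\<And>x t. t \<ge> 0 \<Longrightarrow> \<bar>x\<bar> + t \<le> R \<Longrightarrow> \<bar>lin x t\<bar> \<le> L" and R: "\<bar>x\<bar> + T x \<le> R"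
    and "0 \<le> t" "0 < r" "t + 2 * r < T x" "12 * exp L \<le> exp (nl x t) * r\<^sup>2"
  shows "nl x t + 3 * real k \<le> nl x (t + 2 * r)"
  using assms(3-6)
proof (induction k arbitrary: t r)
  case 0
  then show ?case by (simp, intro nl_causal_mono) auto
next
  case (Suc k)
  have "3 \<le> exp (nl x t - L) * r\<^sup>2 / 4"
    using Suc.prems(4) by (simp add: exp_diff field_simps)
  with diamond_growth[OF L Suc.prems(1,2) _ R] Suc.prems(2,3) have step: "nl x t + 3 \<le> nl x (t + r)" by simp
  have "12 * exp L \<le> exp (nl x t) * r\<^sup>2" by (rule Suc.prems(4))
  also have "\<dots> \<le> exp (nl x t) * exp 3 * (r / 2)\<^sup>2"
  proof -
    have "4 * (exp (nl x t) * r\<^sup>2) \<le> exp 3 * (exp (nl x t) * r\<^sup>2)"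
      using exp_3_ge by (intro mult_right_mono) auto
    then show ?thesis by (simp add: power_divide mult_ac)
  qed
  also have "\<dots> = exp (nl x t + 3) * (r / 2)\<^sup>2" by (simp add: exp_add)
  also have "\<dots> \<le> exp (nl x (t + r)) * (r / 2)\<^sup>2" using step by (intro mult_right_mono) auto
  finally have "nl x (t + r) + 3 * real k \<le> nl x (t + r + 2 * (r / 2))"
    using Suc.prems by (intro Suc.IH) auto
  with step show ?case by (simp add: algebra_simps)
qed

text \<open>If the threshold of the previous lemma were reached with \<open>r = (T x - t) / 4\<close>, then \<open>nl\<close> would be infinite
at a time before \<open>T x\<close>.\<close>

lemma upper_rate:
  assumes L: "\<And>x t. t \<ge> 0 \<Longrightarrow> \<bar>x\<bar> + t \<le> R \<Longrightarrow> \<bar>lin x t\<bar> \<le> L" and R: "\<bar>x\<bar> + T x \<le> R"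
    and t: "0 \<le> t" "t < T x"
  shows "exp (u x t) \<le> 192 * exp (2 * L) / (T x - t)\<^sup>2"
proof -
  define r where "r = (T x - t) / 4"
  have r4: "4 * r = T x - t" by (simp add: r_def)
  have r: "0 < r" "t + 2 * r < T x" using t r4 by linarith+
  have "\<not> 12 * exp L \<le> exp (nl x t) * r\<^sup>2"
  proof
    assume *: "12 * exp L \<le> exp (nl x t) * r\<^sup>2"
    obtain k where "nl x (t + 2 * r) - nl x t < real k" using reals_Archimedean2 by blast
    with iterated_growth[OF L R t(1) r *, of k] show False by simp
  qed
  then have "exp (nl x t) * (T x - t)\<^sup>2 \<le> 192 * exp L"
    by (simp add: r_def power_divide)
  then have nl: "exp (nl x t) \<le> 192 * exp L / (T x - t)\<^sup>2"
    using t by (simp add: pos_le_divide_eq)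
  have "\<bar>lin x t\<bar> \<le> L" by (rule L) (use t R in auto)
  then have "exp (lin x t) \<le> exp L" by simp
  then have "exp (lin x t) * exp (nl x t) \<le> exp L * (192 * exp L / (T x - t)\<^sup>2)"
    using nl by (intro mult_mono) auto
  moreover have "exp (lin x t) * exp (nl x t) = exp (u x t)" by (simp add: nl_def flip: exp_add)
  moreover have "exp L * (192 * exp L / (T x - t)\<^sup>2) = 192 * exp (2 * L) / (T x - t)\<^sup>2"
    unfolding mult_2 exp_add by simp
  ultimately show ?thesis by (simp only:)
qed

text \<open>Along the characteristic through \<open>(x, t)\<close> on which \<open>x + t\<close> is constant, the right ray has derivative \<open>f\<close> and the
Duhamel term has the left ray as its derivative. The product rule leaves \<open>f * exp (- duhamel f)\<close>, the exponential
of the linear part, minus a nonnegative term.\<close>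

lemma right_ray_le_exp:
  assumes L: "\<And>x t. t \<ge> 0 \<Longrightarrow> \<bar>x\<bar> + t \<le> R \<Longrightarrow> \<bar>lin x t\<bar> \<le> L"
    and src: "cone_source u a s f" and R: "\<bar>a\<bar> + s \<le> R" and xt: "(x, t) \<in> closed_cone a s"
  shows "right_ray f x t * exp (- duhamel f x t) \<le> exp L * t"
proof -
  note f = cone_sourceD[OF src]
  have t: "0 \<le> t" using xt by (auto simp: closed_cone_def)
  define c where "c = x + t"
  let ?A = "\<lambda>h. right_ray f (c - h) h" and ?B = "\<lambda>h. left_ray f (c - h) h" and ?F = "\<lambda>h. duhamel f (c - h) h"
  have "- exp L * (t - 0) \<le> - (?A t * exp (- ?F t)) - - (?A 0 * exp (- ?F 0))"
  proof (rule increment_ge[where g = "\<lambda>h. - (?A h * exp (- ?F h))"])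
    fix h assume h: "h \<in> {0..t}"
    have dA: "(?A has_real_derivative f (c - h) h) (at h within {0..t})"
      using right_ray_derivative[OF f(1), of h c] h by (auto elim: has_field_derivative_subset)
    have "(?F has_real_derivative (?A h * (1 + -1) + ?B h * (1 - -1)) / 2) (at h within {0..t})"
    proof (rule duhamel_derivative_along[OF f(1) _ _ _ h])
      show "((\<lambda>h. c - h) has_real_derivative -1) (at h within {0..t})" "((\<lambda>h. h) has_real_derivative 1) (at h within {0..t})"
        by (auto intro!: derivative_eq_intros)
    qed auto
    then have dF: "(?F has_real_derivative ?B h) (at h within {0..t})" by simp
    show "((\<lambda>h. - (?A h * exp (- ?F h))) has_real_derivative
       - (f (c - h) h * exp (- ?F h) + ?A h * (exp (- ?F h) * (- ?B h)))) (at h within {0..t})"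
      by (rule derivative_eq_intros dA dF refl)+ (simp add: algebra_simps)
    have cone: "(c - h, h) \<in> closed_cone a s" using xt h by (auto simp: closed_cone_def c_def abs_le_iff)
    have "0 \<le> ?A h" "0 \<le> ?B h" unfolding right_ray_def left_ray_def
      by (rule Henstock_Kurzweil_Integration.integral_nonneg[OF _ f(3)],
          intro integrable_continuous_real continuous_on_slice[OF f(1)] continuous_intros)+
    then have "0 \<le> ?A h * (exp (- ?F h) * ?B h)" by simp
    moreover have "f (c - h) h * exp (- ?F h) = exp (lin (c - h) h)"
      using source_eq_exp_nl[OF src cone] nl_eq_duhamel[OF src cone] by (simp flip: exp_add)
    moreover have "\<bar>lin (c - h) h\<bar> \<le> L"
      by (rule L) (use cone R in \<open>auto simp: closed_cone_def abs_le_iff abs_if split: if_splits\<close>)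
    then have "exp (lin (c - h) h) \<le> exp L" by simp
    ultimately show "- exp L \<le> - (f (c - h) h * exp (- ?F h) + ?A h * (exp (- ?F h) * (- ?B h)))"
      unfolding mult_minus_right by linarith
  qed (rule t)
  moreover have "?A 0 = 0" by (simp add: right_ray_def)
  ultimately show ?thesis by (simp add: c_def)
qed

lemma left_ray_le_exp:
  assumes L: "\<And>x t. t \<ge> 0 \<Longrightarrow> \<bar>x\<bar> + t \<le> R \<Longrightarrow> \<bar>lin x t\<bar> \<le> L"
    and src: "cone_source u a s f" and R: "\<bar>a\<bar> + s \<le> R" and xt: "(x, t) \<in> closed_cone a s"
  shows "left_ray f x t * exp (- duhamel f x t) \<le> exp L * t"
proof -
  note f = cone_sourceD[OF src]
  have t: "0 \<le> t" using xt by (auto simp: closed_cone_def)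
  define c where "c = x - t"
  let ?A = "\<lambda>h. right_ray f (c + h) h" and ?B = "\<lambda>h. left_ray f (c + h) h" and ?F = "\<lambda>h. duhamel f (c + h) h"
  have "- exp L * (t - 0) \<le> - (?B t * exp (- ?F t)) - - (?B 0 * exp (- ?F 0))"
  proof (rule increment_ge[where g = "\<lambda>h. - (?B h * exp (- ?F h))"])
    fix h assume h: "h \<in> {0..t}"
    have dB: "(?B has_real_derivative f (c + h) h) (at h within {0..t})"
      using left_ray_derivative[OF f(1), of h c] h by (auto elim: has_field_derivative_subset)
    have "(?F has_real_derivative (?A h * (1 + 1) + ?B h * (1 - 1)) / 2) (at h within {0..t})"
    proof (rule duhamel_derivative_along[OF f(1) _ _ _ h])
      show "((\<lambda>h. c + h) has_real_derivative 1) (at h within {0..t})" "((\<lambda>h. h) has_real_derivative 1) (at h within {0..t})"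
        by (auto intro!: derivative_eq_intros)
    qed auto
    then have dF: "(?F has_real_derivative ?A h) (at h within {0..t})" by simp
    show "((\<lambda>h. - (?B h * exp (- ?F h))) has_real_derivative
       - (f (c + h) h * exp (- ?F h) + ?B h * (exp (- ?F h) * (- ?A h)))) (at h within {0..t})"
      by (rule derivative_eq_intros dB dF refl)+ (simp add: algebra_simps)
    have cone: "(c + h, h) \<in> closed_cone a s" using xt h by (auto simp: closed_cone_def c_def abs_le_iff)
    have "0 \<le> ?A h" "0 \<le> ?B h" unfolding right_ray_def left_ray_def
      by (rule Henstock_Kurzweil_Integration.integral_nonneg[OF _ f(3)],
          intro integrable_continuous_real continuous_on_slice[OF f(1)] continuous_intros)+
    then have "0 \<le> ?B h * (exp (- ?F h) * ?A h)" by simp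
    moreover have "f (c + h) h * exp (- ?F h) = exp (lin (c + h) h)"
      using source_eq_exp_nl[OF src cone] nl_eq_duhamel[OF src cone] by (simp flip: exp_add)
    moreover have "\<bar>lin (c + h) h\<bar> \<le> L"
      by (rule L) (use cone R in \<open>auto simp: closed_cone_def abs_le_iff abs_if split: if_splits\<close>)
    then have "exp (lin (c + h) h) \<le> exp L" by simp
    ultimately show "- exp L \<le> - (f (c + h) h * exp (- ?F h) + ?B h * (exp (- ?F h) * (- ?A h)))"
      unfolding mult_minus_right by linarith
  qed (rule t)
  moreover have "?B 0 = 0" by (simp add: left_ray_def)
  ultimately show ?thesis by (simp add: c_def)
qed

text \<open>The time derivative of the Duhamel term is the mean of the two rays, which are at most a multiple of
its exponential.\<close>

lemma exp_neg_nl_increment: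
  assumes L: "\<And>x t. t \<ge> 0 \<Longrightarrow> \<bar>x\<bar> + t \<le> R \<Longrightarrow> \<bar>lin x t\<bar> \<le> L" and R: "\<bar>x\<bar> + T x \<le> R"
    and t: "0 \<le> t" "t \<le> s" "s < T x"
  shows "exp (- nl x t) \<le> exp (- nl x s) + exp L * R * (s - t)"
proof -
  obtain f where src: "cone_source u x s f" using source_below[OF t(3)] by blast
  note f = cone_sourceD[OF src]
  let ?F = "\<lambda>h. duhamel f x h"
  have R': "\<bar>x\<bar> + s \<le> R" using R t by simp
  have "- (exp L * R) * (s - t) \<le> exp (- ?F s) - exp (- ?F t)"
  proof (rule increment_ge[where g = "\<lambda>h. exp (- ?F h)", OF t(2)])
    fix h assume h: "h \<in> {t..s}"
    have "(?F has_real_derivative (right_ray f x h * (1 + 0) + left_ray f x h * (1 - 0)) / 2) (at h within {t..s})"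
    proof (rule duhamel_derivative_along[OF f(1) _ _ _ h])
      show "((\<lambda>h. x) has_real_derivative 0) (at h within {t..s})" "((\<lambda>h. h) has_real_derivative 1) (at h within {t..s})"
        by (auto intro!: derivative_eq_intros)
    qed (use t in auto)
    then have dF: "(?F has_real_derivative (right_ray f x h + left_ray f x h) / 2) (at h within {t..s})" by simp
    show "((\<lambda>h. exp (- ?F h)) has_real_derivative exp (- ?F h) * (- ((right_ray f x h + left_ray f x h) / 2))) (at h within {t..s})"
      by (rule derivative_eq_intros dF refl)+
    have cone: "(x, h) \<in> closed_cone x s" using h t by (auto simp: closed_cone_def)
    have hR: "exp L * h \<le> exp L * R" using h R' t by (intro mult_left_mono) auto
    have "right_ray f x h * exp (- ?F h) \<le> exp L * R" "left_ray f x h * exp (- ?F h) \<le> exp L * R"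
      using order.trans[OF right_ray_le_exp[OF L src R' cone] hR] order.trans[OF left_ray_le_exp[OF L src R' cone] hR] by simp_all
    moreover have "exp (- ?F h) * (- ((right_ray f x h + left_ray f x h) / 2))
        = - ((right_ray f x h * exp (- ?F h) + left_ray f x h * exp (- ?F h)) / 2)"
      by (simp add: algebra_simps)
    moreover have "- y \<le> - ((a + b) / 2)" if "a \<le> y" "b \<le> y" for a b y :: real using that by simp
    ultimately show "- (exp L * R) \<le> exp (- ?F h) * (- ((right_ray f x h + left_ray f x h) / 2))"
      by presburger
  qed
  moreover have "nl x t = ?F t" "nl x s = ?F s"
    using t by (auto intro!: nl_eq_duhamel[OF src] simp: closed_cone_def)
  ultimately show ?thesis by simp
qed

text \<open>In the preceding inequality let \<open>s\<close> tend to the blow-up time, where \<open>nl\<close> is unbounded.\<close>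

lemma lower_rate:
  assumes L: "\<And>x t. t \<ge> 0 \<Longrightarrow> \<bar>x\<bar> + t \<le> R \<Longrightarrow> \<bar>lin x t\<bar> \<le> L" and R: "\<bar>x\<bar> + T x \<le> R"
    and t: "0 \<le> t" "t < T x"
  shows "exp (- u x t) \<le> exp (2 * L) * R * (T x - t)"
proof -
  have R0: "0 < R" using R T_pos[of x] by linarith
  have "exp (- nl x t) \<le> exp L * R * (T x - t)"
  proof (rule ccontr)
    assume "\<not> ?thesis"
    then have \<eta>: "0 < exp (- nl x t) - exp L * R * (T x - t)" (is "0 < ?\<eta>") by simp
    obtain s where s: "s \<in> {0..<T x}" "nl x s > max (- ln ?\<eta>) (nl x t)"
      using nl_unbounded[of x "max (- ln ?\<eta>) (nl x t)"] by (elim bexE) (rule that)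
    have "t \<le> s"
    proof (rule ccontr)
      assume "\<not> t \<le> s"
      then have "nl x s \<le> nl x t" using s t by (intro nl_causal_mono) auto
      with s show False by simp
    qed
    have "exp (- nl x s) < exp (ln ?\<eta>)" using s(2) by simp
    also have "exp (ln ?\<eta>) = ?\<eta>" using \<eta> by (rule exp_ln)
    finally have "exp (- nl x s) < ?\<eta>" .
    moreover have "exp (- nl x t) \<le> exp (- nl x s) + exp L * R * (s - t)"
      by (rule exp_neg_nl_increment[OF L R t(1) \<open>t \<le> s\<close>]) (use s in auto)
    moreover have "exp L * R * (s - t) \<le> exp L * R * (T x - t)"
      using s R0 by (intro mult_left_mono) auto
    ultimately show False by simp
  qed
  moreover have "\<bar>lin x t\<bar> \<le> L" by (rule L) (use t R in auto)
  then have "exp (- lin x t) \<le> exp L" by simp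
  ultimately have "exp (- lin x t) * exp (- nl x t) \<le> exp L * (exp L * R * (T x - t))"
    by (intro mult_mono) auto
  moreover have "exp (- lin x t) * exp (- nl x t) = exp (- u x t)" by (simp add: nl_def flip: exp_add)
  moreover have "exp L * (exp L * R * (T x - t)) = exp (2 * L) * R * (T x - t)"
    unfolding mult_2 exp_add by (simp only: mult.assoc)
  ultimately show ?thesis by simp
qed

end

section \<open>Restarting the solution from a later time\<close>

context blowup begin

text \<open>The definition of a solution determines its time derivative only as a limit of difference quotients in
mean square. The same quotients converge to the time derivative of d'Alembert's and Duhamel's formulas,
so both have the same integral.\<close>

lemma time_derivative_integral:
  assumes src: "cone_source u a s f" and s: "s < T a" and t: "0 \<le> t" "t < s"
    and J: "\<alpha> \<le> \<beta>" "{\<alpha>..\<beta>} \<subseteq> ball a (s - t)"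
  shows "(LINT x:{\<alpha>..\<beta>}|lebesgue. ut x t) =
    (\<phi> (\<beta> + t) - \<phi> (\<alpha> + t)) - (\<psi> (\<beta> - t) - \<psi> (\<alpha> - t)) + integral {\<alpha>..\<beta>} (\<lambda>x. nonlin_dt f x t)"
proof -
  note f = cone_sourceD[OF src]
  define v where "v x t = lin x t + duhamel f x (max t 0)" for x t
  define vt where "vt x t = p (x + t) - q (x - t) + nonlin_dt f x t" for x t
  have tt: "t \<in> {0..<s}" using t by simp
  have vc: "continuous_on UNIV (\<lambda>p. v (fst p) (snd p))"
    unfolding v_def by (intro continuous_intros lin_continuous duhamel_continuous_extended f(1))
  have uv: "u x t = v x t" if "(x, t) \<in> closed_cone a s" for x t
    using f(5)[OF that] that by (simp add: v_def closed_cone_def max_absorb1)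
  have solv: "solution_on_cone u0 u1 v (\<lambda>x t. p (x + t) + q (x - t) + nonlin_dx f x t) vt a s"
    unfolding vt_def by (rule solution_of_bounded_source[OF f(1) vc]) (use f(4) uv in \<open>auto simp: v_def max_absorb1\<close>)
  obtain s' where s': "s < s'" "solution_on_cone u0 u1 u ux ut a s'"
    using solution_below[OF s] by blast
  have solu: "solution_on_cone u0 u1 u ux ut a s"
    by (rule solution_on_cone_restrict[OF s'(2)]) (use s' in simp)
  have utI: "set_integrable lebesgue {\<alpha>..\<beta>} (\<lambda>x. ut x t)"
    by (rule L2_on_integrable[OF L2_on_subset[OF solution_on_cone_slices(4)[OF solu tt] J(2)]]) auto
  have vtI: "set_integrable lebesgue {\<alpha>..\<beta>} (\<lambda>x. vt x t)"
    by (rule L2_on_integrable[OF L2_on_subset[OF solution_on_cone_slices(4)[OF solv tt] J(2)]]) auto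
  \<comment> \<open>Both are L2 limits of the same difference quotients.\<close>
  have eq: "(LINT x:{\<alpha>..\<beta>}|lebesgue. ut x t) = (LINT x:{\<alpha>..\<beta>}|lebesgue. vt x t)"
  proof -
    have close: "\<bar>(LINT x:{\<alpha>..\<beta>}|lebesgue. vt x t) - (LINT x:{\<alpha>..\<beta>}|lebesgue. ut x t)\<bar> \<le> 2 * sqrt (\<beta> - \<alpha>) * e" if e: "e > 0" for e
    proof -
      let ?D1 = "\<lambda>\<tau> x. (u x \<tau> - u x t) / (\<tau> - t) - ut x t" and ?D2 = "\<lambda>\<tau> x. (v x \<tau> - v x t) / (\<tau> - t) - vt x t"
      obtain d1 where d1: "d1 > 0" "\<forall>\<tau>\<in>{0..<s}. \<tau> \<noteq> t \<longrightarrow> \<bar>\<tau> - t\<bar> < d1 \<longrightarrow> L2_norm_on (ball a (s - max t \<tau>)) (?D1 \<tau>) < e"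
        using time_tendstoD[OF solution_on_cone_slices(6)[OF solu tt] e] by (elim exE conjE) (rule that)
      obtain d2 where d2: "d2 > 0" "\<forall>\<tau>\<in>{0..<s}. \<tau> \<noteq> t \<longrightarrow> \<bar>\<tau> - t\<bar> < d2 \<longrightarrow> L2_norm_on (ball a (s - max t \<tau>)) (?D2 \<tau>) < e"
        using time_tendstoD[OF solution_on_cone_slices(6)[OF solv tt] e] by (elim exE conjE) (rule that)
      have "\<alpha> \<in> {\<alpha>..\<beta>}" "\<beta> \<in> {\<alpha>..\<beta>}" using J(1) by auto
      then have "\<alpha> \<in> ball a (s - t)" "\<beta> \<in> ball a (s - t)" using J(2) by blast+
      then have ab: "a - (s - t) < \<alpha>" "\<beta> < a + (s - t)" by (auto simp: dist_real_def)
      define g where "g = min (\<alpha> - (a - (s - t))) (a + (s - t) - \<beta>)"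
      have g: "g > 0" "a - (s - t) + g \<le> \<alpha>" "\<beta> \<le> a + (s - t) - g" using ab by (auto simp: g_def)
      define m where "m = min (min d1 d2) (min g (s - t))"
      have m: "0 < m" "m \<le> d1" "m \<le> d2" "m \<le> g" "m \<le> s - t" using d1(1) d2(1) g t by (auto simp: m_def)
      define \<tau> where "\<tau> = t + m / 2"
      have \<tau>: "t < \<tau>" "\<tau> - t < d1" "\<tau> - t < d2" "\<tau> - t < g" "\<tau> < s" using m by (auto simp: \<tau>_def)
      have \<tau>s: "\<tau> \<in> {0..<s}" using \<tau> t by auto
      have mx: "max t \<tau> = \<tau>" using \<tau> by simp
      have sub: "{\<alpha>..\<beta>} \<subseteq> ball a (s - max t \<tau>)"
        unfolding mx using \<tau> g by (auto simp: dist_real_def abs_less_iff)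
      have D1: "?D1 \<tau> \<in> L2_on {\<alpha>..\<beta>}"
        by (rule L2_on_subset[OF solution_on_cone_L2_difference(2)[OF solu tt \<tau>s, of u] sub]) auto
      have D2: "?D2 \<tau> \<in> L2_on {\<alpha>..\<beta>}"
        by (rule L2_on_subset[OF solution_on_cone_L2_difference(2)[OF solv tt \<tau>s, of v] sub]) auto
      have le: "\<bar>LINT x:{\<alpha>..\<beta>}|lebesgue. D x\<bar> \<le> sqrt (\<beta> - \<alpha>) * e"
        if D: "D \<in> L2_on {\<alpha>..\<beta>}" and n: "L2_norm_on {\<alpha>..\<beta>} D \<le> e" for D
      proof -
        have Di: "set_integrable lebesgue {\<alpha>..\<beta>} D" by (rule L2_on_integrable[OF D]) auto
        have "\<bar>LINT x:{\<alpha>..\<beta>}|lebesgue. D x\<bar> \<le> (LINT x:{\<alpha>..\<beta>}|lebesgue. \<bar>D x\<bar>)"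
          using set_integral_norm_bound[OF Di] by simp
        also have "\<dots> \<le> sqrt (\<beta> - \<alpha>) * L2_norm_on {\<alpha>..\<beta>} D"
          using L2_on_abs_integral_le[OF D] J(1) by simp
        also have "\<dots> \<le> sqrt (\<beta> - \<alpha>) * e" using n J(1) by (intro mult_left_mono) auto
        finally show ?thesis .
      qed
      have n1: "L2_norm_on {\<alpha>..\<beta>} (?D1 \<tau>) \<le> e"
      proof (rule order.trans)
        show "L2_norm_on {\<alpha>..\<beta>} (?D1 \<tau>) \<le> L2_norm_on (ball a (s - max t \<tau>)) (?D1 \<tau>)"
          by (rule L2_norm_on_mono[OF solution_on_cone_L2_difference(2)[OF solu tt \<tau>s, of u] sub]) auto
        show "L2_norm_on (ball a (s - max t \<tau>)) (?D1 \<tau>) \<le> e" by (rule less_imp_le[OF d1(2)[rule_format, OF \<tau>s]]) (use \<tau> in auto)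
      qed
      have n2: "L2_norm_on {\<alpha>..\<beta>} (?D2 \<tau>) \<le> e"
      proof (rule order.trans)
        show "L2_norm_on {\<alpha>..\<beta>} (?D2 \<tau>) \<le> L2_norm_on (ball a (s - max t \<tau>)) (?D2 \<tau>)"
          by (rule L2_norm_on_mono[OF solution_on_cone_L2_difference(2)[OF solv tt \<tau>s, of v] sub]) auto
        show "L2_norm_on (ball a (s - max t \<tau>)) (?D2 \<tau>) \<le> e" by (rule less_imp_le[OF d2(2)[rule_format, OF \<tau>s]]) (use \<tau> in auto)
      qed
      have i1: "set_integrable lebesgue {\<alpha>..\<beta>} (?D1 \<tau>)" and i2: "set_integrable lebesgue {\<alpha>..\<beta>} (?D2 \<tau>)"
        using L2_on_integrable[OF D1] L2_on_integrable[OF D2] by auto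
      have "(LINT x:{\<alpha>..\<beta>}|lebesgue. vt x t) - (LINT x:{\<alpha>..\<beta>}|lebesgue. ut x t) = (LINT x:{\<alpha>..\<beta>}|lebesgue. vt x t - ut x t)"
        using utI vtI by (simp add: set_integral_diff)
      also have "\<dots> = (LINT x:{\<alpha>..\<beta>}|lebesgue. ?D1 \<tau> x - ?D2 \<tau> x)"
      proof (rule set_lebesgue_integral_cong)
        show "\<forall>x. x \<in> {\<alpha>..\<beta>} \<longrightarrow> vt x t - ut x t = ?D1 \<tau> x - ?D2 \<tau> x"
        proof (intro allI impI)
          fix x assume "x \<in> {\<alpha>..\<beta>}"
          then have "x \<in> ball a (s - \<tau>)" using sub unfolding mx by blast
          then have "(x, \<tau>) \<in> closed_cone a s" "(x, t) \<in> closed_cone a s"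
            using \<tau> t by (auto simp: closed_cone_def dist_real_def)
          then show "vt x t - ut x t = ?D1 \<tau> x - ?D2 \<tau> x" using uv by simp
        qed
      qed simp
      also have "\<dots> = (LINT x:{\<alpha>..\<beta>}|lebesgue. ?D1 \<tau> x) - (LINT x:{\<alpha>..\<beta>}|lebesgue. ?D2 \<tau> x)"
        using i1 i2 by (rule set_integral_diff(2))
      finally show ?thesis using le[OF D1 n1] le[OF D2 n2] by simp
    qed
    have "\<bar>(LINT x:{\<alpha>..\<beta>}|lebesgue. vt x t) - (LINT x:{\<alpha>..\<beta>}|lebesgue. ut x t)\<bar> \<le> 0"
    proof (rule field_le_epsilon)
      fix r :: real assume r: "r > 0"
      have w: "0 < 2 * sqrt (\<beta> - \<alpha>) + 1" using J(1) by (simp add: add_nonneg_pos)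
      have "2 * sqrt (\<beta> - \<alpha>) * (r / (2 * sqrt (\<beta> - \<alpha>) + 1)) \<le> r"
        using w r J(1) by (simp add: pos_divide_le_eq mult.commute mult_left_mono)
      with close[of "r / (2 * sqrt (\<beta> - \<alpha>) + 1)"] w r
      show "\<bar>(LINT x:{\<alpha>..\<beta>}|lebesgue. vt x t) - (LINT x:{\<alpha>..\<beta>}|lebesgue. ut x t)\<bar> \<le> 0 + r" by simp
    qed
    then show ?thesis by simp
  qed
  have c: "continuous_on UNIV (\<lambda>x. nonlin_dt f x t)"
  proof -
    have "continuous_on UNIV (\<lambda>x. (\<lambda>p. nonlin_dt f (fst p) (snd p)) (x, t))"
      by (rule continuous_on_compose2[OF nonlin_dt_continuous[OF f(1)]]) (use t in \<open>auto intro!: continuous_intros\<close>)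
    then show ?thesis by simp
  qed
  have P: "primitive (\<lambda>x. \<phi> (x + t)) (\<lambda>x. p (x + t))" "L2_loc (\<lambda>x. p (x + t))"
    and Q: "primitive (\<lambda>x. \<psi> (x + - t)) (\<lambda>x. q (x + - t))" "L2_loc (\<lambda>x. q (x + - t))"
    by (intro primitive_shift L2_loc_shift \<phi> \<psi> p q)+
  have vtm: "L2_loc (\<lambda>x. p (x + t) - q (x + - t) + nonlin_dt f x t)"
    by (intro L2_loc_add L2_loc_diff P Q L2_loc_continuous c)
  have "(LINT x:{\<alpha>..\<beta>}|lebesgue. vt x t) = integral {\<alpha>..\<beta>} (\<lambda>x. p (x + t) - q (x + - t) + nonlin_dt f x t)"
    using set_lebesgue_integral_eq_integral(2)[OF set_integrable_lebesgue_of_lborel[OF L2_loc_integrable[OF vtm]]]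
    by (simp add: vt_def)
  also have "\<dots> = integral {\<alpha>..\<beta>} (\<lambda>x. p (x + t)) - integral {\<alpha>..\<beta>} (\<lambda>x. q (x + - t)) + integral {\<alpha>..\<beta>} (\<lambda>x. nonlin_dt f x t)"
    using L2_loc_integrable_on[OF P(2)] L2_loc_integrable_on[OF Q(2)] L2_loc_integrable_on[OF L2_loc_continuous[OF c]]
    by (simp only: Henstock_Kurzweil_Integration.integral_add Henstock_Kurzweil_Integration.integral_diff integrable_diff)
  finally show ?thesis using eq P(1) Q(1) J(1) by (simp add: primitive_def)
qed

text \<open>The part of the ray before time \<open>t\<close> is itself a right ray, which ends at \<open>(y + 2 * h, t)\<close>.\<close>

lemma right_ray_step:
  assumes f: "continuous_on UNIV (\<lambda>p. f (fst p) (snd p))" and th: "0 \<le> t" "0 \<le> h"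
    and P: "\<And>\<tau>. \<tau> \<in> {t..t + h} \<Longrightarrow> f (y + 2 * h + t - \<tau>) \<tau> \<le> P"
  shows "right_ray f (y + h) (t + h) \<le> right_ray f (y + 2 * h) t + h * P"
proof -
  let ?g = "\<lambda>\<tau>. f (y + 2 * h + t - \<tau>) \<tau>"
  have int: "?g integrable_on {c..d}" for c d
    by (intro integrable_continuous_real continuous_on_slice[OF f] continuous_intros)
  have "integral {0..t} ?g + integral {t..t + h} ?g = integral {0..t + h} ?g"
    by (rule Henstock_Kurzweil_Integration.integral_combine[OF _ _ int]) (use th in auto)
  moreover have "integral {t..t + h} ?g \<le> integral {t..t + h} (\<lambda>_. P)"
    by (rule integral_le[OF int _ P]) auto
  moreover have "right_ray f (y + h) (t + h) = integral {0..t + h} ?g"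
    unfolding right_ray_def by (intro Henstock_Kurzweil_Integration.integral_cong arg_cong2[where f = f]) auto
  ultimately show ?thesis using th by (simp add: right_ray_def)
qed

text \<open>Duhamel's formula from time \<open>t\<close> on, with the source replaced by its upper bound. The Duhamel term is
followed along the characteristic from \<open>(y, t)\<close> to the apex; there its derivative is a right ray, which
splits into its part before time \<open>t\<close> and a part of length at most \<open>\<sigma>\<close>. The former, together with the
increment of the wave moving to the left, is expressed by \<open>u\<close> and its time derivative at time \<open>t\<close>.\<close>

lemma restart_bound:
  assumes src: "cone_source u a s f" and s: "s < T a" and t: "0 \<le> t" "t < s" and \<sigma>: "0 \<le> \<sigma>"
    and J: "{y..y + 2 * \<sigma>} \<subseteq> ball a (s - t)" and top: "(y + \<sigma>, t + \<sigma>) \<in> closed_cone a s"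
    and P: "\<And>z \<tau>. t \<le> \<tau> \<Longrightarrow> \<bar>z - (y + \<sigma>)\<bar> \<le> t + \<sigma> - \<tau> \<Longrightarrow> f z \<tau> \<le> P"
  shows "u (y + \<sigma>) (t + \<sigma>) \<le> (u y t + u (y + 2 * \<sigma>) t) / 2 + (LINT x:{y..y + 2 * \<sigma>}|lebesgue. ut x t) / 2 + \<sigma>\<^sup>2 * P"
proof -
  note f = cone_sourceD[OF src]
  have P0: "0 < P" using P[of "t + \<sigma>" "y + \<sigma>"] f(2)[of "y + \<sigma>" "t + \<sigma>"] \<sigma> by simp
  have slice: "continuous_on UNIV (\<lambda>x. right_ray f x t)"
  proof -
    have "continuous_on UNIV (\<lambda>x. (\<lambda>p. right_ray f (fst p) (snd p)) (x, t))"
      by (rule continuous_on_compose2[OF right_ray_continuous[OF f(1)]]) (use t in \<open>auto intro!: continuous_intros\<close>)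
    then show ?thesis by simp
  qed
  obtain W where W: "\<And>z. (W has_real_derivative right_ray f z t) (at z)"
  proof -
    have "continuous_on UNIV (\<lambda>p::real\<times>real. right_ray f (fst p) t)"
      by (rule continuous_on_compose2[OF slice]) (auto intro!: continuous_intros)
    then show thesis
    proof (rule spatial_antiderivative)
      fix G :: "real \<Rightarrow> real \<Rightarrow> real"
      assume "\<And>z \<tau>. ((\<lambda>z. G z \<tau>) has_real_derivative right_ray f z t) (at z)"
      then show thesis by (rule that)
    qed
  qed
  have incr: "- (\<sigma> * P) * (\<sigma> - 0) \<le> (W (y + 2 * \<sigma>) / 2 - duhamel f (y + \<sigma>) (t + \<sigma>)) - (W (y + 2 * 0) / 2 - duhamel f (y + 0) (t + 0))"
  proof (rule increment_ge[where g = "\<lambda>h. W (y + 2 * h) / 2 - duhamel f (y + h) (t + h)", OF \<sigma>])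
    fix h assume h: "h \<in> {0..\<sigma>}"
    have "((\<lambda>h. duhamel f (y + h) (t + h)) has_real_derivative
       (right_ray f (y + h) (t + h) * (1 + 1) + left_ray f (y + h) (t + h) * (1 - 1)) / 2) (at h within {0..\<sigma>})"
    proof (rule duhamel_derivative_along[OF f(1) _ _ _ h])
      show "((\<lambda>h. y + h) has_real_derivative 1) (at h within {0..\<sigma>})" "((\<lambda>h. t + h) has_real_derivative 1) (at h within {0..\<sigma>})"
        by (auto intro!: derivative_eq_intros)
    qed (use t in auto)
    then have d1: "((\<lambda>h. duhamel f (y + h) (t + h)) has_real_derivative right_ray f (y + h) (t + h)) (at h within {0..\<sigma>})" by simp
    have d2: "((\<lambda>h. W (y + 2 * h)) has_real_derivative right_ray f (y + 2 * h) t * 2) (at h within {0..\<sigma>})"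
      by (rule DERIV_chain2[OF W]) (auto intro!: derivative_eq_intros)
    have d3: "((\<lambda>h. W (y + 2 * h) / 2) has_real_derivative right_ray f (y + 2 * h) t * 2 / 2) (at h within {0..\<sigma>})"
      by (rule DERIV_cdivide[OF d2])
    show "((\<lambda>h. W (y + 2 * h) / 2 - duhamel f (y + h) (t + h)) has_real_derivative
       right_ray f (y + 2 * h) t * 2 / 2 - right_ray f (y + h) (t + h)) (at h within {0..\<sigma>})"
      by (rule DERIV_diff[OF d3 d1])
    have "right_ray f (y + h) (t + h) \<le> right_ray f (y + 2 * h) t + h * P"
      by (rule right_ray_step[OF f(1) t(1)]) (use h in \<open>auto intro!: P simp: abs_le_iff\<close>)
    moreover have "h * P \<le> \<sigma> * P" using h P0 by (intro mult_right_mono) auto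
    ultimately show "- (\<sigma> * P) \<le> right_ray f (y + 2 * h) t * 2 / 2 - right_ray f (y + h) (t + h)" by simp
  qed
  have growth: "duhamel f (y + \<sigma>) (t + \<sigma>) - duhamel f y t \<le> (W (y + 2 * \<sigma>) - W y) / 2 + \<sigma>\<^sup>2 * P"
  proof -
    have "- (\<sigma> * P) * (\<sigma> - 0) = - (\<sigma>\<^sup>2 * P)" by (simp add: power2_eq_square)
    then have "- (\<sigma>\<^sup>2 * P) \<le> (W (y + 2 * \<sigma>) / 2 - duhamel f (y + \<sigma>) (t + \<sigma>)) - (W y / 2 - duhamel f y t)"
      using incr by (simp only: mult_zero_right add_0_right)
    then show ?thesis unfolding diff_divide_distrib by linarith
  qed
  have yy: "y \<le> y + 2 * \<sigma>" using \<sigma> by simp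
  have Wint: "W (y + 2 * \<sigma>) - W y = integral {y..y + 2 * \<sigma>} (\<lambda>x. nonlin_dt f x t) + (duhamel f (y + 2 * \<sigma>) t - duhamel f y t)"
  proof -
    have 1: "((\<lambda>x. right_ray f x t) has_integral (W (y + 2 * \<sigma>) - W y)) {y..y + 2 * \<sigma>}"
      by (rule fundamental_theorem_of_calculus[OF yy])
         (rule has_field_derivative_at_within[OF W, unfolded has_real_derivative_iff_has_vector_derivative])
    have 2: "((\<lambda>x. nonlin_dx f x t) has_integral (duhamel f (y + 2 * \<sigma>) t - duhamel f y t)) {y..y + 2 * \<sigma>}"
      by (rule fundamental_theorem_of_calculus[OF yy])
         (rule has_field_derivative_at_within[OF duhamel_space_derivative[OF f(1) t(1)], unfolded has_real_derivative_iff_has_vector_derivative])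
    have "nonlin_dt f x t = right_ray f x t - nonlin_dx f x t" for x
      by (simp add: nonlin_dt_def[OF f(1)] nonlin_dx_def[OF f(1)] field_simps)
    then have "integral {y..y + 2 * \<sigma>} (\<lambda>x. nonlin_dt f x t) = (W (y + 2 * \<sigma>) - W y) - (duhamel f (y + 2 * \<sigma>) t - duhamel f y t)"
      using integral_unique[OF has_integral_diff[OF 1 2]] by simp
    then show ?thesis by simp
  qed
  have yc: "(y, t) \<in> closed_cone a s" "(y + 2 * \<sigma>, t) \<in> closed_cone a s"
  proof -
    have "y \<in> {y..y + 2 * \<sigma>}" "y + 2 * \<sigma> \<in> {y..y + 2 * \<sigma>}" using \<sigma> by auto
    then have "y \<in> ball a (s - t)" "y + 2 * \<sigma> \<in> ball a (s - t)" using J by blast+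
    then show "(y, t) \<in> closed_cone a s" "(y + 2 * \<sigma>, t) \<in> closed_cone a s"
      using t by (auto simp: closed_cone_def dist_real_def)
  qed
  have e1: "y + \<sigma> + (t + \<sigma>) = y + 2 * \<sigma> + t" and e2: "y + \<sigma> - (t + \<sigma>) = y - t" by simp_all
  have "u (y + \<sigma>) (t + \<sigma>) = \<phi> (y + 2 * \<sigma> + t) + \<psi> (y - t) + duhamel f (y + \<sigma>) (t + \<sigma>)"
    using f(5)[OF top] unfolding lin_def e1 e2 .
  moreover have "u y t = \<phi> (y + t) + \<psi> (y - t) + duhamel f y t"
    "u (y + 2 * \<sigma>) t = \<phi> (y + 2 * \<sigma> + t) + \<psi> (y + 2 * \<sigma> - t) + duhamel f (y + 2 * \<sigma>) t"
    using f(5)[OF yc(1)] f(5)[OF yc(2)] by (simp_all add: lin_def)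
  moreover note time_derivative_integral[OF src s t yy J] Wint growth
  ultimately show ?thesis by argo
qed

end

section \<open>The local energy near a blow-up point\<close>

context blowup begin

text \<open>By the bound on the integral of \<open>exp u\<close>, somewhere on the section \<open>u\<close> is at most \<open>l\<close>; the other two bounds
allow \<open>u\<close> to exceed \<open>l\<close> by at most 1/4 on the section and half the integral of the time derivative to be at
most 1/8. This gives \<open>l + 3/8\<close> for the free wave. The margin of one is not used up, because the
product of \<open>(T a - t)\<^sup>2\<close> and the level \<open>P\<close> is less than one.\<close>

lemma small_energy_bound:
  assumes ts: "0 \<le> t" "t < s" "s < T a" and half: "(T a - t) / 2 \<le> s - t"
    and E: "(LINT x:{a - (s - t)..a + (s - t)}|lebesgue. (ut x t)\<^sup>2) \<le> 1 / (32 * (T a - t))"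
      "(LINT x:{a - (s - t)..a + (s - t)}|lebesgue. (ux x t)\<^sup>2) \<le> 1 / (32 * (T a - t))"
      "(LINT x:{a - (s - t)..a + (s - t)}|lebesgue. exp (u x t)) \<le> 1 / (32 * (T a - t))"
  shows "u a s \<le> ln (1 / (32 * (T a - t)\<^sup>2)) + 11 / 8"
proof -
  define \<delta> where "\<delta> = T a - t"
  define \<rho> where "\<rho> = s - t"
  define J where "J = {a - \<rho>..a + \<rho>}"
  define l where "l = ln (1 / (32 * \<delta>\<^sup>2))"
  define P where "P = exp (l + 11 / 8)"
  have \<delta>: "\<delta> > 0" using ts by (simp add: \<delta>_def)
  have \<rho>: "\<rho> > 0" "\<rho> \<le> \<delta>" "\<delta> \<le> 2 * \<rho>" using ts half by (auto simp: \<delta>_def \<rho>_def)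
  have expl: "exp l = 1 / (32 * \<delta>\<^sup>2)" unfolding l_def using \<delta> by (intro exp_ln) simp
  obtain s2 where s2: "s < s2" "s2 < T a" "solution_on_cone u0 u1 u ux ut a s2"
    using solution_below[OF ts(3)] by blast
  obtain f where src: "cone_source u a s2 f" using source_below[OF s2(2)] by blast
  note f = cone_sourceD[OF src]
  have tt: "t \<in> {0..<s2}" using ts s2 by simp
  note S = solution_on_cone_slices[OF s2(3) tt]
  have Jball: "J \<subseteq> ball a (s2 - t)" using s2(1) by (auto simp: J_def \<rho>_def dist_real_def abs_less_iff)
  have Jcone: "(x, t) \<in> closed_cone a s2" if "x \<in> J" for x
    using that s2(1) ts by (auto simp: J_def \<rho>_def closed_cone_def abs_le_iff)
  have fu: "f x t = exp (u x t)" if "x \<in> J" for x using f(4)[OF Jcone[OF that]] .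
  have Jm: "J \<in> lmeasurable" "measure lebesgue J = 2 * \<rho>" using \<rho>(1) by (auto simp: J_def)
  have root: "sqrt (2 * \<rho>) * sqrt (1 / (32 * \<delta>)) \<le> 1 / 4"
  proof -
    have "2 * \<rho> * (1 / (32 * \<delta>)) \<le> 1 / 16" using \<rho> \<delta> by (simp add: field_simps)
    then have "sqrt (2 * \<rho> * (1 / (32 * \<delta>))) \<le> sqrt ((1 / 4)\<^sup>2)" by (intro real_sqrt_le_mono) (simp add: power2_eq_square)
    then show ?thesis by (simp only: real_sqrt_mult real_sqrt_abs)
  qed
  have L1: "(LINT x:J|lebesgue. \<bar>g x\<bar>) \<le> 1 / 4"
    if g: "g \<in> L2_on J" and le: "(LINT x:J|lebesgue. (g x)\<^sup>2) \<le> 1 / (32 * \<delta>)" for g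
  proof -
    have "(LINT x:J|lebesgue. \<bar>g x\<bar>) \<le> sqrt (2 * \<rho>) * L2_norm_on J g"
      using L2_on_abs_integral_le[OF g Jm(1)] by (simp only: Jm(2))
    also have "\<dots> \<le> sqrt (2 * \<rho>) * sqrt (1 / (32 * \<delta>))"
      unfolding L2_norm_on_def using le \<rho> by (intro mult_left_mono real_sqrt_le_mono) auto
    also note root
    finally show ?thesis .
  qed
  have utJ: "(\<lambda>x. ut x t) \<in> L2_on J" by (rule L2_on_subset[OF S(4) Jball]) (simp add: J_def)
  have uxJ: "(\<lambda>x. ux x t) \<in> L2_on J" by (rule L2_on_subset[OF S(3) Jball]) (simp add: J_def)
  have sub: "\<bar>LINT x:{y..z}|lebesgue. g x\<bar> \<le> 1 / 4"
    if g: "g \<in> L2_on J" and le: "(LINT x:J|lebesgue. (g x)\<^sup>2) \<le> 1 / (32 * \<delta>)" and yz: "{y..z} \<subseteq> J" for g y z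
  proof -
    have i: "set_integrable lebesgue J g" by (rule L2_on_integrable[OF g Jm(1)])
    have i': "set_integrable lebesgue {y..z} g" by (rule set_integrable_subset[OF i _ yz]) simp
    have "\<bar>LINT x:{y..z}|lebesgue. g x\<bar> \<le> (LINT x:{y..z}|lebesgue. \<bar>g x\<bar>)"
      using set_integral_norm_bound[OF i'] by simp
    also have "\<dots> \<le> (LINT x:J|lebesgue. \<bar>g x\<bar>)"
      unfolding set_lebesgue_integral_def using set_integrable_abs[OF i] set_integrable_abs[OF i'] yz
      by (intro integral_mono) (auto simp: set_integrable_def indicator_def)
    also have "\<dots> \<le> 1 / 4" by (rule L1[OF g le])
    finally show ?thesis .
  qed
  have Eut: "(LINT x:J|lebesgue. (ut x t)\<^sup>2) \<le> 1 / (32 * \<delta>)" and Eux: "(LINT x:J|lebesgue. (ux x t)\<^sup>2) \<le> 1 / (32 * \<delta>)"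
    and Eu: "(LINT x:J|lebesgue. exp (u x t)) \<le> 1 / (32 * \<delta>)"
    using E by (simp_all only: J_def \<rho>_def \<delta>_def)
  have uc: "continuous_on J (\<lambda>x. u x t)" by (rule continuous_on_subset[OF S(1) Jball])
  obtain x1 where x1: "x1 \<in> J" "\<And>x. x \<in> J \<Longrightarrow> u x1 t \<le> u x t"
    using continuous_attains_inf[OF _ _ uc] \<rho>(1) by (auto simp: J_def)
  have ux1: "u x1 t \<le> l"
  proof -
    have i: "set_integrable lebesgue J (\<lambda>x. exp (u x t))"
      unfolding J_def by (rule absolutely_integrable_continuous_real) (intro continuous_intros uc[unfolded J_def])
    have ic: "set_integrable lebesgue J (\<lambda>x. exp (u x1 t))"
      unfolding J_def by (rule set_integrable_lebesgue_of_lborel[OF set_integrable_const_Icc])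
    have "exp (u x1 t) * (2 * \<rho>) = (LINT x:J|lebesgue. exp (u x1 t))"
      unfolding set_lebesgue_integral_def using Jm \<rho>(1) by (simp add: fmeasurable_def)
    also have "\<dots> \<le> (LINT x:J|lebesgue. exp (u x t))"
      by (rule set_integral_mono[OF ic i]) (simp add: x1(2))
    also note Eu
    finally have "exp (u x1 t) * (2 * \<rho>) \<le> 1 / (32 * \<delta>)" .
    moreover have "exp (u x1 t) * \<delta> \<le> exp (u x1 t) * (2 * \<rho>)" using \<rho> by (intro mult_left_mono) auto
    ultimately have "exp (u x1 t) * \<delta> \<le> 1 / (32 * \<delta>)" by linarith
    then have "exp (u x1 t) \<le> exp l" unfolding expl using \<delta> by (simp add: field_simps power2_eq_square)
    then show ?thesis by simp
  qed
  have uJ: "u x t \<le> l + 1 / 4" if x: "x \<in> J" for x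
  proof -
    have seg: "\<bar>u z t - u y t\<bar> \<le> 1 / 4" if "y \<in> J" "z \<in> J" "y \<le> z" for y z
    proof -
      have yz: "{y..z} \<subseteq> J" using that by (auto simp: J_def)
      then have "u z t - u y t = (LINT x:{y..z}|lebesgue. ux x t)"
        using Jball by (intro weak_deriv_imp_integral[OF S(5) open_ball S(1) that(3)]) auto
      with sub[OF uxJ Eux yz] show ?thesis by simp
    qed
    have "\<bar>u x t - u x1 t\<bar> \<le> 1 / 4"
      using seg[OF x x1(1)] seg[OF x1(1) x] by (cases "x \<le> x1") (auto simp: abs_minus_commute)
    with ux1 show ?thesis by linarith
  qed
  have P0: "P > 0" and P: "\<delta>\<^sup>2 * P < 1"
  proof -
    show "P > 0" by (simp add: P_def)
    have "exp (11 / 8 :: real) \<le> exp 1 * exp 1" by (simp flip: exp_add)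
    also have "\<dots> \<le> 3 * 3" using exp_le by (intro mult_mono) auto
    finally have e: "exp (11 / 8 :: real) \<le> 9" by simp
    have "\<delta>\<^sup>2 * P = \<delta>\<^sup>2 * exp l * exp (11 / 8)" by (simp add: P_def exp_add)
    also have "\<delta>\<^sup>2 * exp l = 1 / 32" unfolding expl using \<delta> by simp
    finally show "\<delta>\<^sup>2 * P < 1" using e by simp
  qed
  \<comment> \<open>If the source reached the level P inside the cone, consider an earliest such point.\<close>
  define Bad where "Bad = ({a - \<rho>..a + \<rho>} \<times> {t..s}) \<inter> {w. \<bar>fst w - a\<bar> \<le> s - snd w} \<inter> {w. P \<le> f (fst w) (snd w)}"
  have "Bad = {}"
  proof (rule ccontr)
    assume ne: "Bad \<noteq> {}"
    have cpt: "compact Bad"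
    proof -
      have "closed {w::real\<times>real. \<bar>fst w - a\<bar> \<le> s - snd w}"
        by (intro closed_Collect_le continuous_intros)
      moreover have "closed {w::real\<times>real. P \<le> f (fst w) (snd w)}"
        by (intro closed_Collect_le continuous_intros f(1))
      ultimately show ?thesis unfolding Bad_def by (intro compact_Int_closed compact_Times) auto
    qed
    have "continuous_on Bad snd" by (intro continuous_intros)
    then obtain w where w0: "w \<in> Bad" "\<forall>w'\<in>Bad. snd w \<le> snd w'"
      using continuous_attains_inf[OF cpt ne] by blast
    have w: "w \<in> Bad" "snd w \<le> snd w'" if "w' \<in> Bad" for w' using w0 that by auto
    obtain xs \<tau>s where wx: "w = (xs, \<tau>s)" by (cases w)
    have xs: "t \<le> \<tau>s" "\<tau>s \<le> s" "\<bar>xs - a\<bar> \<le> s - \<tau>s" "P \<le> f xs \<tau>s" using w0(1) by (auto simp: Bad_def wx)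
    have inBad: "(z, \<tau>) \<in> Bad" if "t \<le> \<tau>" "\<bar>z - a\<bar> \<le> s - \<tau>" "P \<le> f z \<tau>" for z \<tau>
      using that by (auto simp: Bad_def \<rho>_def abs_le_iff)
    have before: "f z \<tau> \<le> P" if z: "t \<le> \<tau>" "\<tau> \<le> \<tau>s" "\<bar>z - a\<bar> \<le> s - \<tau>" for z \<tau>
    proof (rule ccontr)
      assume "\<not> f z \<tau> \<le> P"
      then have gt: "P < f z \<tau>" by simp
      then have \<tau>: "\<tau> = \<tau>s" using w(2)[OF inBad[OF z(1,3)]] z(2) by (simp add: wx)
      show False
      proof (cases "\<tau> = t")
        case True
        have zJ: "z \<in> J" using z(3) by (auto simp: J_def \<rho>_def True abs_le_iff)
        have "f z t = exp (u z t)" by (rule fu[OF zJ])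
        also have "\<dots> < P" unfolding P_def using uJ[OF zJ] by simp
        finally show False using gt True by simp
      next
        case False
        have "continuous_on UNIV (\<lambda>r. f z r)" by (rule continuous_on_slice[OF f(1)]) (auto intro!: continuous_intros)
        then have "isCont (\<lambda>r. f z r) \<tau>" by (simp add: continuous_on_eq_continuous_at)
        then have "eventually (\<lambda>r. P < f z r) (at \<tau>)" using gt by (intro order_tendstoD(1)) (auto simp: isCont_def)
        then obtain d where d: "d > 0" "\<forall>r. r \<noteq> \<tau> \<and> dist r \<tau> < d \<longrightarrow> P < f z r"
          unfolding eventually_at by auto
        define r where "r = max t (\<tau> - d / 2)"
        have r: "t \<le> r" "r < \<tau>" "dist r \<tau> < d" using False z d(1) by (auto simp: r_def dist_real_def)
        have "P < f z r" using d(2) r by auto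
        then have "\<tau>s \<le> r" using w(2)[OF inBad[of r z]] r z by (auto simp: wx)
        with r \<tau> show False by simp
      qed
    qed
    define \<sigma> where "\<sigma> = \<tau>s - t"
    have \<sigma>: "0 \<le> \<sigma>" "\<sigma> \<le> \<delta>" using xs ts by (auto simp: \<sigma>_def \<delta>_def)
    have yJ: "{xs - \<sigma>..xs - \<sigma> + 2 * \<sigma>} \<subseteq> J" using xs by (auto simp: J_def \<rho>_def \<sigma>_def abs_le_iff)
    have ends: "xs - \<sigma> \<in> J" "xs - \<sigma> + 2 * \<sigma> \<in> J" using yJ \<sigma> by auto
    have "u (xs - \<sigma> + \<sigma>) (t + \<sigma>) \<le> (u (xs - \<sigma>) t + u (xs - \<sigma> + 2 * \<sigma>) t) / 2
       + (LINT x:{xs - \<sigma>..xs - \<sigma> + 2 * \<sigma>}|lebesgue. ut x t) / 2 + \<sigma>\<^sup>2 * P"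
    proof (rule restart_bound[OF src s2(2) ts(1) _ \<sigma>(1)])
      show "t < s2" using ts s2 by simp
      show "{xs - \<sigma>..xs - \<sigma> + 2 * \<sigma>} \<subseteq> ball a (s2 - t)" using yJ Jball by blast
      show "(xs - \<sigma> + \<sigma>, t + \<sigma>) \<in> closed_cone a s2" using xs ts s2 by (auto simp: closed_cone_def \<sigma>_def)
      fix z \<tau> assume "t \<le> \<tau>" "\<bar>z - (xs - \<sigma> + \<sigma>)\<bar> \<le> t + \<sigma> - \<tau>"
      then show "f z \<tau> \<le> P" using xs by (intro before) (auto simp: \<sigma>_def)
    qed
    also have "\<dots> \<le> (l + 1 / 4) + (1 / 4) / 2 + \<sigma>\<^sup>2 * P"
      using uJ[OF ends(1)] uJ[OF ends(2)] abs_le_D1[OF sub[OF utJ Eut yJ]]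
      by (intro add_mono order.refl) simp_all
    also have "\<sigma>\<^sup>2 * P \<le> \<delta>\<^sup>2 * P" using \<sigma> P0 by (intro mult_right_mono power_mono) auto
    finally have "u xs \<tau>s < l + 11 / 8" using P by (simp add: \<sigma>_def)
    then have "exp (u xs \<tau>s) < P" by (simp add: P_def)
    moreover have "f xs \<tau>s = exp (u xs \<tau>s)" by (rule f(4)) (use xs ts s2 in \<open>auto simp: closed_cone_def\<close>)
    ultimately show False using xs(4) by simp
  qed
  have "f a s = exp (u a s)" by (rule f(4)) (use ts s2 in \<open>auto simp: closed_cone_def\<close>)
  moreover have "\<not> P \<le> f a s"
  proof
    assume "P \<le> f a s"
    then have "(a, s) \<in> Bad" using ts \<rho> by (auto simp: Bad_def)
    with \<open>Bad = {}\<close> show False by simp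
  qed
  ultimately have "exp (u a s) \<le> exp (l + 11 / 8)" by (simp add: P_def)
  then show ?thesis by (simp add: l_def \<delta>_def)
qed

text \<open>The bound for small energy is uniform in \<open>s\<close> up to the blow-up time, so it contradicts the blow-up criterion.\<close>

lemma energy_lower_bound:
  assumes t: "t \<in> {0..<T a}"
  shows "ennreal (1 / (T a - t)) *
      (\<integral>\<^sup>+x\<in>cone_section T a t. ennreal ((ut x t)\<^sup>2 + (ux x t)\<^sup>2 + exp (u x t)) \<partial>lebesgue)
    \<ge> ennreal ((1 / 32) / (T a - t)\<^sup>2)"
proof (rule ccontr)
  define \<delta> where "\<delta> = T a - t"
  let ?g = "\<lambda>x. (ut x t)\<^sup>2 + (ux x t)\<^sup>2 + exp (u x t)"
  let ?E = "\<integral>\<^sup>+x\<in>cone_section T a t. ennreal (?g x) \<partial>lebesgue"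
  assume "\<not> ?thesis"
  then have lt: "ennreal (1 / \<delta>) * ?E < ennreal ((1 / 32) / \<delta>\<^sup>2)" by (simp add: \<delta>_def not_le)
  have \<delta>: "\<delta> > 0" using t by (simp add: \<delta>_def)
  have E: "?E \<le> ennreal (1 / (32 * \<delta>))"
  proof (rule ccontr)
    assume "\<not> ?E \<le> ennreal (1 / (32 * \<delta>))"
    then have "ennreal (1 / \<delta>) * ennreal (1 / (32 * \<delta>)) \<le> ennreal (1 / \<delta>) * ?E" by (intro mult_left_mono) auto
    moreover have "ennreal (1 / \<delta>) * ennreal (1 / (32 * \<delta>)) = ennreal ((1 / 32) / \<delta>\<^sup>2)"
      using \<delta> by (subst ennreal_mult[symmetric]) (auto simp: power2_eq_square)
    ultimately show False using lt by simp
  qed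
  define B where "B = ln (1 / (32 * \<delta>\<^sup>2)) + 11 / 8"
  have bound: "u a s \<le> B" if s: "t + \<delta> / 2 \<le> s" "s < T a" for s
  proof -
    let ?J = "{a - (s - t)..a + (s - t)}"
    have ts: "0 \<le> t" "t < s" using t s \<delta> by auto
    obtain s2 where s2: "s < s2" "s2 < T a" "solution_on_cone u0 u1 u ux ut a s2"
      using solution_below[OF s(2)] by blast
    have tt: "t \<in> {0..<s2}" using ts s2 by simp
    note S = solution_on_cone_slices[OF s2(3) tt]
    have Jball: "?J \<subseteq> ball a (s2 - t)" using s2(1) by (auto simp: dist_real_def abs_less_iff)
    have Jsec: "?J \<subseteq> cone_section T a t" using s by (auto simp: cone_section_def)
    have le: "(LINT x:?J|lebesgue. h x) \<le> 1 / (32 * \<delta>)"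
      if h: "set_integrable lebesgue ?J h" "\<And>x. 0 \<le> h x" "\<And>x. h x \<le> ?g x" for h
    proof -
      have "ennreal (LINT x:?J|lebesgue. h x) = (\<integral>\<^sup>+x. ennreal (indicator ?J x *\<^sub>R h x) \<partial>lebesgue)"
        unfolding set_lebesgue_integral_def using h(1,2)
        by (intro nn_integral_eq_integral[symmetric]) (auto simp: set_integrable_def)
      also have "\<dots> \<le> ?E"
      proof (rule nn_integral_mono)
        fix x
        show "ennreal (indicator ?J x *\<^sub>R h x) \<le> ennreal (?g x) * indicator (cone_section T a t) x"
        proof (cases "x \<in> ?J")
          case True
          then have "x \<in> cone_section T a t" using Jsec by blast
          with True ennreal_leI[OF h(3)[of x]] show ?thesis
            by (simp only: indicator_simps scaleR_one mult_1_right)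
        qed simp
      qed
      also note E
      finally show ?thesis using \<delta> by (subst (asm) ennreal_le_iff) auto
    qed
    have "u a s \<le> ln (1 / (32 * (T a - t)\<^sup>2)) + 11 / 8"
    proof (rule small_energy_bound[OF ts s(2)])
      show "(T a - t) / 2 \<le> s - t" using s(1) unfolding \<delta>_def by argo
      show "(LINT x:?J|lebesgue. (ut x t)\<^sup>2) \<le> 1 / (32 * (T a - t))"
        unfolding \<delta>_def[symmetric] by (rule le) (use L2_on_subset[OF S(4) Jball] in \<open>auto simp: L2_on_def\<close>)
      show "(LINT x:?J|lebesgue. (ux x t)\<^sup>2) \<le> 1 / (32 * (T a - t))"
        unfolding \<delta>_def[symmetric] by (rule le) (use L2_on_subset[OF S(3) Jball] in \<open>auto simp: L2_on_def\<close>)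
      show "(LINT x:?J|lebesgue. exp (u x t)) \<le> 1 / (32 * (T a - t))"
        unfolding \<delta>_def[symmetric]
        by (rule le) (auto intro!: absolutely_integrable_continuous_real continuous_intros continuous_on_subset[OF S(1) Jball])
    qed
    then show ?thesis by (simp add: B_def \<delta>_def)
  qed
  obtain L where L: "\<forall>x t. t \<ge> 0 \<longrightarrow> \<bar>x\<bar> + t \<le> \<bar>a\<bar> + T a \<longrightarrow> \<bar>lin x t\<bar> \<le> L" using lin_bounded by blast
  obtain s0 where s0: "s0 \<in> {0..<T a}" "nl a s0 > B + L" using nl_unbounded by blast
  define s where "s = max s0 (t + \<delta> / 2)"
  have "t + \<delta> / 2 < T a" using \<delta> unfolding \<delta>_def by argo
  then have s: "t + \<delta> / 2 \<le> s" "s < T a" "s0 \<le> s" "0 \<le> s" using s0(1) by (auto simp: s_def)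
  have "nl a s0 \<le> nl a s" using s0 s by (intro nl_causal_mono) auto
  moreover have "nl a s = u a s - lin a s" by (simp add: nl_def)
  moreover have "u a s \<le> B" by (rule bound[OF s(1,2)])
  moreover have "\<bar>lin a s\<bar> \<le> L" using L s by simp
  ultimately show False using s0(2) by linarith
qed

end

text \<open>A point of the graph at horizontal distance \<open>h\<close> from \<open>a\<close> is at most \<open>h\<close> lower than \<open>(a, T a)\<close>, so either its
horizontal or its vertical distance from \<open>(a, t)\<close> is at least half of \<open>T a - t\<close>.\<close>

lemma infdist_graph_bounds:
  assumes lip: "\<And>x y. \<bar>T x - T y\<bar> \<le> \<bar>x - y\<bar>" and t: "t \<le> T a"
  shows "(T a - t) / 2 \<le> infdist (a, t) (blowup_graph T)" "infdist (a, t) (blowup_graph T) \<le> T a - t"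
proof -
  have ne: "blowup_graph T \<noteq> {}" by (auto simp: blowup_graph_def)
  show "(T a - t) / 2 \<le> infdist (a, t) (blowup_graph T)"
    unfolding infdist_notempty[OF ne]
  proof (rule cINF_greatest[OF ne])
    fix z assume "z \<in> blowup_graph T"
    then obtain x where z: "z = (x, T x)" by (auto simp: blowup_graph_def)
    have "\<bar>a - x\<bar> \<le> dist (a, t) z" "\<bar>t - T x\<bar> \<le> dist (a, t) z"
      using dist_fst_le[of "(a, t)" z] dist_snd_le[of "(a, t)" z] by (auto simp: z dist_real_def)
    moreover have "T a - T x \<le> \<bar>a - x\<bar>" "T x - t \<le> \<bar>t - T x\<bar>" using lip[of a x] by auto
    ultimately show "(T a - t) / 2 \<le> dist (a, t) z" by simp
  qed
  have "infdist (a, t) (blowup_graph T) \<le> dist (a, t) (a, T a)"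
    by (rule infdist_le) (auto simp: blowup_graph_def)
  then show "infdist (a, t) (blowup_graph T) \<le> T a - t" using t by (simp add: dist_Pair_Pair dist_real_def)
qed

section \<open>The blow-up estimates\<close>

theorem theorem1:
  fixes u0 u1 T :: "real \<Rightarrow> real" and u ux ut :: "real \<Rightarrow> real \<Rightarrow> real"
    and \<Gamma> :: "(real \<times> real) set"
  assumes u0: "u0 \<in> H1_locu"
    and u1: "u1 \<in> L2_locu"
    and u: "blowup_solution u0 u1 u ux ut"
    and T: "T = blowup_time u0 u1"
    and \<Gamma>: "\<Gamma> = blowup_graph T"
  shows
    "(\<forall>R>0. \<exists>C1>0. \<exists>C2>0. \<exists>C3>0. \<forall>a. (a, T a) \<in> D_R R \<longrightarrow>
        (\<forall>y s. \<bar>y\<bar> < 1 \<and> s \<ge> - ln (T a) \<longrightarrow>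
           sim_w T u a y s \<le> - 2 * ln (1 - \<bar>y\<bar>) + C1) \<and>
        (\<forall>t\<in>{0..<T a}.
           exp (u a t) \<le> C2 / (infdist (a, t) \<Gamma>)\<^sup>2 \<and>
           C2 / (infdist (a, t) \<Gamma>)\<^sup>2 \<le> C3 / (T a - t)\<^sup>2))
     \<and>
     (\<forall>R>0. \<exists>C1>0. \<exists>C2>0. \<forall>a. (a, T a) \<in> D_R R \<longrightarrow>
        (\<forall>t\<in>{0..<T a}.
           ennreal (1 / (T a - t)) *
               (\<integral>\<^sup>+x\<in>cone_section T a t. ennreal (exp (- u x t)) \<partial>lebesgue)
             \<le> ennreal (C1 * sqrt (infdist (a, t) \<Gamma>)) \<and>
           C1 * sqrt (infdist (a, t) \<Gamma>) \<le> C2 * sqrt (T a - t)))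
     \<and>
     (u0 \<in> W1_inf \<and> u1 \<in> L_inf \<longrightarrow>
       (\<forall>R>0. \<exists>C1>0. \<exists>C2>0. \<forall>a. (a, T a) \<in> D_R R \<longrightarrow>
          (\<forall>t\<in>{0..<T a}.
             exp (u a t) \<ge> C1 / infdist (a, t) \<Gamma> \<and>
             C1 / infdist (a, t) \<Gamma> \<ge> C2 / (T a - t))))
     \<and>
     (\<exists>\<epsilon>0>0. \<forall>a. \<forall>t\<in>{0..<T a}.
        ennreal (1 / (T a - t)) *
            (\<integral>\<^sup>+x\<in>cone_section T a t.
               ennreal ((ut x t)\<^sup>2 + (ux x t)\<^sup>2 + exp (u x t)) \<partial>lebesgue)
          \<ge> ennreal (\<epsilon>0 / (T a - t)\<^sup>2))"
proof -
  obtain \<phi> \<psi> p q where "wave_data u0 u1 \<phi> \<psi> p q"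
    using wave_data_exists[OF u0 u1] by (elim exE) (rule that)
  then interpret blowup u0 u1 \<phi> \<psi> p q u ux ut T
    using u T by (auto simp: blowup_def blowup_axioms_def blowup_solution_def)
  have d: "(T a - t) / 2 \<le> infdist (a, t) \<Gamma>" "infdist (a, t) \<Gamma> \<le> T a - t" if "t \<in> {0..<T a}" for a t
    unfolding \<Gamma> using that by (intro infdist_graph_bounds T_lipschitz; simp)+
  have near: "\<bar>x\<bar> + T x \<le> 3 * R \<and> t < T x \<and> T x - t \<le> 2 * (T a - t)"
    if "(a, T a) \<in> D_R R" "0 \<le> t" "\<bar>x - a\<bar> < T a - t" for R a x t
    using that T_lipschitz[of a x] by (auto simp: D_R_def abs_if split: if_splits)
  have upper: "\<forall>R>0. \<exists>C1>0. \<exists>C2>0. \<exists>C3>0. \<forall>a. (a, T a) \<in> D_R R \<longrightarrow>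
        (\<forall>y s. \<bar>y\<bar> < 1 \<and> s \<ge> - ln (T a) \<longrightarrow> sim_w T u a y s \<le> - 2 * ln (1 - \<bar>y\<bar>) + C1) \<and>
        (\<forall>t\<in>{0..<T a}. exp (u a t) \<le> C2 / (infdist (a, t) \<Gamma>)\<^sup>2 \<and>
           C2 / (infdist (a, t) \<Gamma>)\<^sup>2 \<le> C3 / (T a - t)\<^sup>2)"
  proof (intro allI impI)
    fix R :: real assume "R > 0"
    obtain L where L0: "\<forall>x t. t \<ge> 0 \<longrightarrow> \<bar>x\<bar> + t \<le> 3 * R \<longrightarrow> \<bar>lin x t\<bar> \<le> L" using lin_bounded by blast
    have L: "\<bar>lin x t\<bar> \<le> L" if "t \<ge> 0" "\<bar>x\<bar> + t \<le> 3 * R" for x t using L0 that by blast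
    define C where "C = 192 * exp (2 * L)"
    have C: "C > 0" by (simp add: C_def)
    have rate: "exp (u x t) \<le> C / (T x - t)\<^sup>2" if "(a, T a) \<in> D_R R" "0 \<le> t" "\<bar>x - a\<bar> < T a - t" for a x t
      unfolding C_def using near[OF that] that(2) by (intro upper_rate[OF L]) auto
    have w: "sim_w T u a y s \<le> - 2 * ln (1 - \<bar>y\<bar>) + (\<bar>ln C\<bar> + 1)"
      if a: "(a, T a) \<in> D_R R" and y: "\<bar>y\<bar> < 1" and s: "s \<ge> - ln (T a)" for a y s
    proof -
      define \<delta> where "\<delta> = exp (- s)"
      define t where "t = T a - \<delta>"
      define x where "x = a + y * \<delta>"
      have \<delta>: "\<delta> > 0" "T a - t = \<delta>" by (simp_all add: \<delta>_def t_def)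
      have "exp (- s) \<le> exp (ln (T a))" using s by simp
      then have t0: "0 \<le> t" using T_pos[of a] by (simp add: t_def \<delta>_def)
      have xa: "\<bar>x - a\<bar> = \<bar>y\<bar> * \<delta>" using \<delta>(1) by (simp add: x_def abs_mult)
      also have "\<dots> < 1 * \<delta>" using y \<delta>(1) by (intro mult_strict_right_mono) auto
      finally have xa': "\<bar>x - a\<bar> < T a - t" using \<delta>(2) by simp
      have pos: "0 < \<delta> * (1 - \<bar>y\<bar>)" using \<delta>(1) y by simp
      have "T a - T x \<le> \<bar>x - a\<bar>" using T_lipschitz[of a x] by linarith
      then have low: "\<delta> * (1 - \<bar>y\<bar>) \<le> T x - t" using xa \<delta>(2) by (simp add: algebra_simps)
      have "exp (u x t) \<le> C / (T x - t)\<^sup>2" by (rule rate[OF a t0 xa'])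
      also have "\<dots> \<le> C / (\<delta> * (1 - \<bar>y\<bar>))\<^sup>2"
        using C pos low by (intro divide_left_mono power_mono mult_pos_pos) auto
      finally have "ln (exp (u x t)) \<le> ln (C / (\<delta> * (1 - \<bar>y\<bar>))\<^sup>2)"
        by (intro ln_mono) auto
      also have "\<dots> = ln C - 2 * (ln \<delta> + ln (1 - \<bar>y\<bar>))"
        using C pos \<delta>(1) y by (simp add: ln_div ln_realpow ln_mult)
      finally have "u x t + 2 * ln \<delta> \<le> - 2 * ln (1 - \<bar>y\<bar>) + ln C" by simp
      moreover have "sim_w T u a y s = u x t + 2 * ln \<delta>"
        by (simp add: sim_w_def Let_def x_def t_def \<delta>_def)
      ultimately show ?thesis using abs_ge_self[of "ln C"] by linarith
    qed
    have e: "exp (u a t) \<le> C / (infdist (a, t) \<Gamma>)\<^sup>2 \<and> C / (infdist (a, t) \<Gamma>)\<^sup>2 \<le> 4 * C / (T a - t)\<^sup>2"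
      if a: "(a, T a) \<in> D_R R" and t: "t \<in> {0..<T a}" for a t
    proof
      have \<delta>: "T a - t > 0" using t by simp
      have dp: "0 < infdist (a, t) \<Gamma>" using d(1)[OF t] \<delta> by argo
      have "exp (u a t) \<le> C / (T a - t)\<^sup>2" by (rule rate[OF a]) (use t in auto)
      also have "\<dots> \<le> C / (infdist (a, t) \<Gamma>)\<^sup>2"
        using C dp d(2)[OF t] by (intro divide_left_mono power_mono mult_pos_pos) auto
      finally show "exp (u a t) \<le> C / (infdist (a, t) \<Gamma>)\<^sup>2" .
      have "C / (infdist (a, t) \<Gamma>)\<^sup>2 \<le> C / ((T a - t) / 2)\<^sup>2"
        using C dp \<delta> d(1)[OF t] by (intro divide_left_mono power_mono mult_pos_pos) auto
      then show "C / (infdist (a, t) \<Gamma>)\<^sup>2 \<le> 4 * C / (T a - t)\<^sup>2" by (simp add: power_divide mult.commute)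
    qed
    show "\<exists>C1>0. \<exists>C2>0. \<exists>C3>0. \<forall>a. (a, T a) \<in> D_R R \<longrightarrow>
        (\<forall>y s. \<bar>y\<bar> < 1 \<and> s \<ge> - ln (T a) \<longrightarrow> sim_w T u a y s \<le> - 2 * ln (1 - \<bar>y\<bar>) + C1) \<and>
        (\<forall>t\<in>{0..<T a}. exp (u a t) \<le> C2 / (infdist (a, t) \<Gamma>)\<^sup>2 \<and>
           C2 / (infdist (a, t) \<Gamma>)\<^sup>2 \<le> C3 / (T a - t)\<^sup>2)"
    proof (intro exI conjI)
      show "0 < \<bar>ln C\<bar> + 1" "0 < C" "0 < 4 * C" using C by auto
    qed (use w e in blast)
  qed
  have inv: "\<exists>K>0. \<forall>a x t. (a, T a) \<in> D_R R \<longrightarrow> 0 \<le> t \<longrightarrow> \<bar>x - a\<bar> < T a - t \<longrightarrow> exp (- u x t) \<le> K * (T x - t)" if R: "R > 0" for R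
  proof -
    obtain L where L0: "\<forall>x t. t \<ge> 0 \<longrightarrow> \<bar>x\<bar> + t \<le> 3 * R \<longrightarrow> \<bar>lin x t\<bar> \<le> L" using lin_bounded by blast
    have L: "\<bar>lin x t\<bar> \<le> L" if "t \<ge> 0" "\<bar>x\<bar> + t \<le> 3 * R" for x t using L0 that by blast
    have "exp (- u x t) \<le> exp (2 * L) * (3 * R) * (T x - t)"
      if "(a, T a) \<in> D_R R" "0 \<le> t" "\<bar>x - a\<bar> < T a - t" for a x t
      using near[OF that] that(2) by (intro lower_rate[OF L]) auto
    then show ?thesis using R by (intro exI[of _ "exp (2 * L) * (3 * R)"]) auto
  qed
  have lower_mean: "\<forall>R>0. \<exists>C1>0. \<exists>C2>0. \<forall>a. (a, T a) \<in> D_R R \<longrightarrow>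
        (\<forall>t\<in>{0..<T a}.
           ennreal (1 / (T a - t)) * (\<integral>\<^sup>+x\<in>cone_section T a t. ennreal (exp (- u x t)) \<partial>lebesgue)
             \<le> ennreal (C1 * sqrt (infdist (a, t) \<Gamma>)) \<and>
           C1 * sqrt (infdist (a, t) \<Gamma>) \<le> C2 * sqrt (T a - t))"
  proof (intro allI impI)
    fix R :: real assume R: "R > 0"
    obtain K where K: "K > 0" "\<forall>a x t. (a, T a) \<in> D_R R \<longrightarrow> 0 \<le> t \<longrightarrow> \<bar>x - a\<bar> < T a - t \<longrightarrow> exp (- u x t) \<le> K * (T x - t)"
      using inv[OF R] by (elim exE conjE) (rule that)
    define C where "C = 4 * K * sqrt (2 * R)"
    have C: "C > 0" using K R by (simp add: C_def)
    have "ennreal (1 / (T a - t)) * (\<integral>\<^sup>+x\<in>cone_section T a t. ennreal (exp (- u x t)) \<partial>lebesgue)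
             \<le> ennreal (C * sqrt (infdist (a, t) \<Gamma>)) \<and> C * sqrt (infdist (a, t) \<Gamma>) \<le> C * sqrt (T a - t)"
      if a: "(a, T a) \<in> D_R R" and t: "t \<in> {0..<T a}" for a t
    proof
      define \<delta> where "\<delta> = T a - t"
      have \<delta>: "\<delta> > 0" using t by (simp add: \<delta>_def)
      have "(\<integral>\<^sup>+x\<in>cone_section T a t. ennreal (exp (- u x t)) \<partial>lebesgue) \<le> (\<integral>\<^sup>+x\<in>cone_section T a t. ennreal (2 * K * \<delta>) \<partial>lebesgue)"
      proof (rule nn_integral_mono)
        fix x
        show "ennreal (exp (- u x t)) * indicator (cone_section T a t) x \<le> ennreal (2 * K * \<delta>) * indicator (cone_section T a t) x"
        proof (cases "x \<in> cone_section T a t")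
          case True
          then have x: "\<bar>x - a\<bar> < T a - t" by (auto simp: cone_section_def)
          have "exp (- u x t) \<le> K * (T x - t)" using K(2) a t x by auto
          also have "\<dots> \<le> K * (2 * \<delta>)" using near[OF a _ x] t K(1) by (intro mult_left_mono) (auto simp: \<delta>_def)
          finally have "ennreal (exp (- u x t)) \<le> ennreal (2 * K * \<delta>)" by (intro ennreal_leI) (simp add: mult_ac)
          with True show ?thesis by simp
        qed simp
      qed
      also have "\<dots> = ennreal (2 * K * \<delta>) * ennreal (2 * \<delta>)"
        using \<delta> by (subst nn_integral_cmult_indicator) (auto simp: cone_section_def \<delta>_def)
      finally have "ennreal (1 / \<delta>) * (\<integral>\<^sup>+x\<in>cone_section T a t. ennreal (exp (- u x t)) \<partial>lebesgue)
          \<le> ennreal (1 / \<delta>) * (ennreal (2 * K * \<delta>) * ennreal (2 * \<delta>))"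
        by (intro mult_left_mono) auto
      also have "\<dots> = ennreal (4 * K * \<delta>)"
        using \<delta> K(1) by (simp add: ennreal_mult[symmetric])
      also have "\<dots> \<le> ennreal (C * sqrt (infdist (a, t) \<Gamma>))"
      proof (rule ennreal_leI)
        have "\<delta> \<le> R" using a t by (auto simp: D_R_def \<delta>_def)
        then have "sqrt \<delta> * sqrt \<delta> \<le> sqrt R * sqrt (2 * infdist (a, t) \<Gamma>)"
          using d(1)[OF t] \<delta> by (intro mult_mono real_sqrt_le_mono) (auto simp: \<delta>_def)
        then have "\<delta> \<le> sqrt (2 * R) * sqrt (infdist (a, t) \<Gamma>)" using \<delta> by (simp add: real_sqrt_mult mult_ac)
        then have "4 * K * \<delta> \<le> 4 * K * (sqrt (2 * R) * sqrt (infdist (a, t) \<Gamma>))" using K(1) by (intro mult_left_mono) auto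
        then show "4 * K * \<delta> \<le> C * sqrt (infdist (a, t) \<Gamma>)" by (simp add: C_def mult_ac)
      qed
      finally show "ennreal (1 / (T a - t)) * (\<integral>\<^sup>+x\<in>cone_section T a t. ennreal (exp (- u x t)) \<partial>lebesgue)
             \<le> ennreal (C * sqrt (infdist (a, t) \<Gamma>))" by (simp only: \<delta>_def)
      show "C * sqrt (infdist (a, t) \<Gamma>) \<le> C * sqrt (T a - t)"
        using C d(2)[OF t] by (intro mult_left_mono real_sqrt_le_mono) auto
    qed
    then show "\<exists>C1>0. \<exists>C2>0. \<forall>a. (a, T a) \<in> D_R R \<longrightarrow>
        (\<forall>t\<in>{0..<T a}.
           ennreal (1 / (T a - t)) * (\<integral>\<^sup>+x\<in>cone_section T a t. ennreal (exp (- u x t)) \<partial>lebesgue)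
             \<le> ennreal (C1 * sqrt (infdist (a, t) \<Gamma>)) \<and>
           C1 * sqrt (infdist (a, t) \<Gamma>) \<le> C2 * sqrt (T a - t))"
      using C by blast
  qed
  have lower_pointwise: "\<forall>R>0. \<exists>C1>0. \<exists>C2>0. \<forall>a. (a, T a) \<in> D_R R \<longrightarrow>
          (\<forall>t\<in>{0..<T a}. exp (u a t) \<ge> C1 / infdist (a, t) \<Gamma> \<and> C1 / infdist (a, t) \<Gamma> \<ge> C2 / (T a - t))"
  proof (intro allI impI)
    fix R :: real assume R: "R > 0"
    obtain K where K: "K > 0" "\<forall>a x t. (a, T a) \<in> D_R R \<longrightarrow> 0 \<le> t \<longrightarrow> \<bar>x - a\<bar> < T a - t \<longrightarrow> exp (- u x t) \<le> K * (T x - t)"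
      using inv[OF R] by (elim exE conjE) (rule that)
    define C where "C = 1 / (2 * K)"
    have C: "C > 0" using K by (simp add: C_def)
    have "exp (u a t) \<ge> C / infdist (a, t) \<Gamma> \<and> C / infdist (a, t) \<Gamma> \<ge> C / (T a - t)"
      if a: "(a, T a) \<in> D_R R" and t: "t \<in> {0..<T a}" for a t
    proof
      have dp: "0 < infdist (a, t) \<Gamma>" using d(1)[OF t] t by auto
      have "exp (- u a t) \<le> K * (T a - t)" using K(2) a t by auto
      also have "\<dots> \<le> K * (2 * infdist (a, t) \<Gamma>)" using d(1)[OF t] K(1) by (intro mult_left_mono) auto
      finally have "inverse (K * (2 * infdist (a, t) \<Gamma>)) \<le> inverse (exp (- u a t))"
        by (intro le_imp_inverse_le) auto
      moreover have "C / infdist (a, t) \<Gamma> = inverse (K * (2 * infdist (a, t) \<Gamma>))"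
        unfolding C_def by (simp add: inverse_eq_divide mult_ac)
      moreover have "inverse (exp (- u a t)) = exp (u a t)" by (simp add: exp_minus)
      ultimately show "C / infdist (a, t) \<Gamma> \<le> exp (u a t)" by (simp only:)
      show "C / (T a - t) \<le> C / infdist (a, t) \<Gamma>"
        using C dp d(2)[OF t] t by (intro divide_left_mono mult_pos_pos) auto
    qed
    then show "\<exists>C1>0. \<exists>C2>0. \<forall>a. (a, T a) \<in> D_R R \<longrightarrow>
          (\<forall>t\<in>{0..<T a}. exp (u a t) \<ge> C1 / infdist (a, t) \<Gamma> \<and> C1 / infdist (a, t) \<Gamma> \<ge> C2 / (T a - t))"
      using C by blast
  qed
  have energy: "\<exists>\<epsilon>0>0. \<forall>a. \<forall>t\<in>{0..<T a}.
        ennreal (1 / (T a - t)) *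
            (\<integral>\<^sup>+x\<in>cone_section T a t. ennreal ((ut x t)\<^sup>2 + (ux x t)\<^sup>2 + exp (u x t)) \<partial>lebesgue)
          \<ge> ennreal (\<epsilon>0 / (T a - t)\<^sup>2)"
    using energy_lower_bound by (intro exI[of _ "1 / 32"]) simp
  show ?thesis
    by (intro conjI impI upper lower_mean lower_pointwise energy)
qed

end
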